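(* Let $(M,\omega)$ be a symplectic manifold and $X\subseteq M$ a closed subset. The following statements hold. (i) The set $\operatorname{Ham}(X,\omega)=\operatorname{Ham}(X,M,\omega)$ is a subgroup of the group of homeomorphisms of $X$. (ii) If $X$ is a symplectic submanifold of $M$ then $\operatorname{Ham}(X,M,\omega)=\operatorname{Ham}(X,X,\omega|_X)$, i.e. the group of Hamiltonian diffeomorphisms of $X$ as a subset of $(M,\omega)$ equals the one of $X$ regarded as a subset of the symplectic manifold $(X,\omega|_X)$.
   Context: All manifolds are smooth with empty boundary. For a time-dependent vector field $V:[0,1]\times M\to TM$ let $\mathcal{D}_V^t$ be the set of $x_0\in M$ for which $\dot x(s)=V(s,x(s))$, $x(0)=x_0$ has a solution $x\in C^\infty([0,t],M)$, and put $\varphi_V^t(x_0):=x(t)$ on $\mathcal{D}_V^t$. For $H\in C^\infty([0,1]\times M,\mathbb{R})$, $H^t:=H(t,\cdot)$, the Hamiltonian vector field is given by $\omega(X_{H^t},\cdot)=dH^t$, and $\varphi_H^t:=\varphi_{X_H}^t$. $V$ is called $X$-compatible iff $X\subseteq\mathcal{D}_V^1$ and $\varphi_V^t(X)=X$ for every $t\in[0,1]$. Define $\mathcal{H}(M,\omega,X):=\{H\in C^\infty([0,1]\times M,\mathbb{R})\mid X_H \text{ is } X\text{-compatible}\}$ and $\operatorname{Ham}(X,M,\omega):=\{\varphi_H^1|_X\mid H\in\mathcal{H}(M,\omega,X)\}$, abbreviated $\operatorname{Ham}(X,\omega)$. *)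

theory Defs
  imports "HOL-Analysis.Analysis" "HOL-Algebra.Bij"
begin

section \<open>Smooth maps between subsets of Euclidean spaces\<close>

text \<open>Meaningful for open \<open>U\<close> only.\<close>

fun Ck_on :: "nat \<Rightarrow> 'a::euclidean_space set \<Rightarrow> ('a \<Rightarrow> 'b::euclidean_space) \<Rightarrow> bool" where
  "Ck_on 0 U f \<longleftrightarrow> continuous_on U f"
| "Ck_on (Suc k) U f \<longleftrightarrow>
     (\<forall>x\<in>U. f differentiable (at x)) \<and>
     (\<forall>v. Ck_on k U (\<lambda>x. frechet_derivative f (at x) v))"

text \<open>Smoothness on an arbitrary subset means existence of local smooth extensions. This is used
  for relatively open subsets \<open>V\<close> of linear subspaces, for intervals \<open>[0,t]\<close> and for \<open>[0,1] \<times> V\<close>;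
  in the last two cases it is smoothness up to the end points.\<close>

definition smooth_on :: "'a::euclidean_space set \<Rightarrow> ('a \<Rightarrow> 'b::euclidean_space) \<Rightarrow> bool" where
  "smooth_on S f \<longleftrightarrow>
     (\<forall>x\<in>S. \<exists>N g. open N \<and> x \<in> N \<and> (\<forall>k. Ck_on k N g) \<and> (\<forall>y\<in>S \<inter> N. g y = f y))"

section \<open>Manifolds\<close>

text \<open>The model space is a linear subspace of a Euclidean type and not the whole type, because
  Euclidean types have dimension at least one, whereas manifolds, in particular submanifolds, may
  have dimension zero. A chart is a pair of a domain \<open>U\<close> and a map whose values outside \<open>U\<close> are
  irrelevant.\<close>

type_synonym ('a, 'e) chart = "'a set \<times> ('a \<Rightarrow> 'e)"

record ('a, 'e) mfd =
  mtop :: "'a topology"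
  model :: "'e set"
  atlas :: "('a, 'e) chart set"

abbreviation points :: "('a, 'e) mfd \<Rightarrow> 'a set" where
  "points M \<equiv> topspace (mtop M)"

definition is_chart :: "('a, 'e::euclidean_space) mfd \<Rightarrow> ('a, 'e) chart \<Rightarrow> bool" where
  "is_chart M = (\<lambda>(U, \<phi>).
     openin (mtop M) U \<and>
     openin (top_of_set (model M)) (\<phi> ` U) \<and>
     homeomorphic_map (subtopology (mtop M) U) (top_of_set (\<phi> ` U)) \<phi>)"

definition smooth_transition :: "('a, 'e::euclidean_space) chart \<Rightarrow> ('a, 'e) chart \<Rightarrow> bool" where
  "smooth_transition = (\<lambda>(U, \<phi>) (W, \<psi>). smooth_on (\<phi> ` (U \<inter> W)) (\<psi> \<circ> inv_into U \<phi>))"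

definition smooth_manifold :: "('a, 'e::euclidean_space) mfd \<Rightarrow> bool" where
  "smooth_manifold M \<longleftrightarrow>
     Hausdorff_space (mtop M) \<and> second_countable (mtop M) \<and>
     subspace (model M) \<and>
     (\<forall>c\<in>atlas M. is_chart M c) \<and>
     \<Union> (fst ` atlas M) = points M \<and>
     (\<forall>c\<in>atlas M. \<forall>d\<in>atlas M. smooth_transition c d)"

definition maximal_atlas :: "('a, 'e::euclidean_space) mfd \<Rightarrow> ('a, 'e) chart set" where
  "maximal_atlas M =
     {c. is_chart M c \<and> (\<forall>d\<in>atlas M. smooth_transition c d \<and> smooth_transition d c)}"

text \<open>Elements of \<open>C\<^sup>\<infinity>(M)\<close> are total functions whose values outside \<open>M\<close> are irrelevant.\<close>

definition smooth_funs :: "('a, 'e::euclidean_space) mfd \<Rightarrow> ('a \<Rightarrow> real) set" where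
  "smooth_funs M = {f. \<forall>(U, \<phi>)\<in>atlas M. smooth_on (\<phi> ` U) (f \<circ> inv_into U \<phi>)}"

definition smooth_time_funs :: "('a, 'e::euclidean_space) mfd \<Rightarrow> (real \<Rightarrow> 'a \<Rightarrow> real) set" where
  "smooth_time_funs M =
     {H. \<forall>(U, \<phi>)\<in>atlas M. smooth_on ({0..1} \<times> \<phi> ` U) (\<lambda>(t, y). H t (inv_into U \<phi> y))}"

definition smooth_curve :: "('a, 'e::euclidean_space) mfd \<Rightarrow> real \<Rightarrow> (real \<Rightarrow> 'a) \<Rightarrow> bool" where
  "smooth_curve M t x \<longleftrightarrow>
     continuous_map (top_of_set {0..t}) (mtop M) x \<and>
     (\<forall>(U, \<phi>)\<in>atlas M. smooth_on {s\<in>{0..t}. x s \<in> U} (\<phi> \<circ> x))"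

section \<open>Tangent vectors, vector fields and two-forms\<close>

text \<open>Tangent vectors at \<open>p\<close> are the derivations of \<open>C\<^sup>\<infinity>(M)\<close> at \<open>p\<close>, set to zero on functions
  that are not smooth. By the lemma below they do not see the values of functions outside \<open>M\<close>.\<close>

type_synonym 'a tvec = "('a \<Rightarrow> real) \<Rightarrow> real"

definition tangent_space :: "('a, 'e::euclidean_space) mfd \<Rightarrow> 'a \<Rightarrow> 'a tvec set" where
  "tangent_space M p = {v.
     (\<forall>f\<in>smooth_funs M. \<forall>g\<in>smooth_funs M. \<forall>a b.
        v (\<lambda>x. a * f x + b * g x) = a * v f + b * v g) \<and>
     (\<forall>f\<in>smooth_funs M. \<forall>g\<in>smooth_funs M.
        v (\<lambda>x. f x * g x) = f p * v g + g p * v f) \<and>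
     (\<forall>f. f \<notin> smooth_funs M \<longrightarrow> v f = 0)}"

definition smooth_vector_field :: "('a, 'e::euclidean_space) mfd \<Rightarrow> ('a \<Rightarrow> 'a tvec) \<Rightarrow> bool" where
  "smooth_vector_field M V \<longleftrightarrow>
     (\<forall>p\<in>points M. V p \<in> tangent_space M p) \<and>
     (\<forall>f\<in>smooth_funs M. (\<lambda>p. V p f) \<in> smooth_funs M)"

definition lie_bracket :: "('a \<Rightarrow> 'a tvec) \<Rightarrow> ('a \<Rightarrow> 'a tvec) \<Rightarrow> 'a \<Rightarrow> 'a tvec" where
  "lie_bracket V W p f = V p (\<lambda>q. W q f) - W p (\<lambda>q. V q f)"

text \<open>Only the values \<open>\<omega> p v w\<close> with \<open>p \<in> M\<close> and \<open>v, w \<in> T\<^sub>pM\<close> matter.\<close>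

type_synonym 'a form2 = "'a \<Rightarrow> 'a tvec \<Rightarrow> 'a tvec \<Rightarrow> real"

definition smooth_two_form :: "('a, 'e::euclidean_space) mfd \<Rightarrow> 'a form2 \<Rightarrow> bool" where
  "smooth_two_form M \<omega> \<longleftrightarrow>
     (\<forall>p\<in>points M. \<forall>u\<in>tangent_space M p. \<forall>v\<in>tangent_space M p. \<forall>w\<in>tangent_space M p. \<forall>a b.
        \<omega> p (\<lambda>f. a * u f + b * v f) w = a * \<omega> p u w + b * \<omega> p v w) \<and>
     (\<forall>p\<in>points M. \<forall>v\<in>tangent_space M p. \<forall>w\<in>tangent_space M p. \<omega> p v w = - \<omega> p w v) \<and>
     (\<forall>V W. smooth_vector_field M V \<and> smooth_vector_field M W \<longrightarrow>
        (\<lambda>p. \<omega> p (V p) (W p)) \<in> smooth_funs M)"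

text \<open>Closedness is expressed by the coordinate-free formula for the exterior derivative.\<close>

definition ext_deriv2 ::
    "'a form2 \<Rightarrow> ('a \<Rightarrow> 'a tvec) \<Rightarrow> ('a \<Rightarrow> 'a tvec) \<Rightarrow> ('a \<Rightarrow> 'a tvec) \<Rightarrow> 'a \<Rightarrow> real" where
  "ext_deriv2 \<omega> U V W p =
     U p (\<lambda>q. \<omega> q (V q) (W q)) + V p (\<lambda>q. \<omega> q (W q) (U q)) + W p (\<lambda>q. \<omega> q (U q) (V q))
     - \<omega> p (lie_bracket U V p) (W p) - \<omega> p (lie_bracket V W p) (U p)
     - \<omega> p (lie_bracket W U p) (V p)"

definition closed_form :: "('a, 'e::euclidean_space) mfd \<Rightarrow> 'a form2 \<Rightarrow> bool" where
  "closed_form M \<omega> \<longleftrightarrow>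
     (\<forall>U V W. smooth_vector_field M U \<and> smooth_vector_field M V \<and> smooth_vector_field M W \<longrightarrow>
        (\<forall>p\<in>points M. ext_deriv2 \<omega> U V W p = 0))"

definition nondegenerate :: "('a, 'e::euclidean_space) mfd \<Rightarrow> 'a form2 \<Rightarrow> bool" where
  "nondegenerate M \<omega> \<longleftrightarrow>
     (\<forall>p\<in>points M. \<forall>v\<in>tangent_space M p.
        (\<forall>w\<in>tangent_space M p. \<omega> p v w = 0) \<longrightarrow> v = (\<lambda>f. 0))"

definition symplectic_manifold :: "('a, 'e::euclidean_space) mfd \<Rightarrow> 'a form2 \<Rightarrow> bool" where
  "symplectic_manifold M \<omega> \<longleftrightarrow>
     smooth_manifold M \<and> smooth_two_form M \<omega> \<and> closed_form M \<omega> \<and> nondegenerate M \<omega>"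

section \<open>Submanifolds\<close>

text \<open>Embedded submanifolds, given by slice charts \<open>\<phi>(U \<inter> X) = \<phi>(U) \<inter> F\<close> with a fixed linear
  subspace \<open>F\<close> of the model space of \<open>M\<close>. They are modelled on \<open>F\<close>.\<close>

definition slice_charts ::
    "('a, 'e::euclidean_space) mfd \<Rightarrow> 'e set \<Rightarrow> 'a set \<Rightarrow> ('a, 'e) chart set" where
  "slice_charts M F X = {(U, \<phi>) \<in> maximal_atlas M. \<phi> ` (U \<inter> X) = \<phi> ` U \<inter> F}"

definition submanifold :: "('a, 'e::euclidean_space) mfd \<Rightarrow> 'e set \<Rightarrow> 'a set \<Rightarrow> bool" where
  "submanifold M F X \<longleftrightarrow>
     subspace F \<and> F \<subseteq> model M \<and> X \<subseteq> points M \<and> X \<subseteq> \<Union> (fst ` slice_charts M F X)"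

definition submfd ::
    "('a, 'e::euclidean_space) mfd \<Rightarrow> 'e set \<Rightarrow> 'a set \<Rightarrow> ('a, 'e) mfd" where
  "submfd M F X =
     \<lparr>mtop = subtopology (mtop M) X, model = F,
      atlas = (\<lambda>(U, \<phi>). (U \<inter> X, \<phi>)) ` slice_charts M F X\<rparr>"

text \<open>The differential of the inclusion into \<open>M\<close>: a derivation is applied to the restriction of a
  smooth function on \<open>M\<close>. Restricting needs no change of the function.\<close>

definition incl_diff :: "('a, 'e::euclidean_space) mfd \<Rightarrow> 'a tvec \<Rightarrow> 'a tvec" where
  "incl_diff M v = (\<lambda>f. if f \<in> smooth_funs M then v f else 0)"

definition restrict_form :: "('a, 'e::euclidean_space) mfd \<Rightarrow> 'a form2 \<Rightarrow> 'a form2" where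
  "restrict_form M \<omega> = (\<lambda>p v w. \<omega> p (incl_diff M v) (incl_diff M w))"

definition symplectic_submanifold ::
    "('a, 'e::euclidean_space) mfd \<Rightarrow> 'a form2 \<Rightarrow> 'e set \<Rightarrow> 'a set \<Rightarrow> bool" where
  "symplectic_submanifold M \<omega> F X \<longleftrightarrow>
     submanifold M F X \<and> nondegenerate (submfd M F X) (restrict_form M \<omega>)"

section \<open>Flows and Hamiltonian diffeomorphisms of subsets\<close>

text \<open>The equation \<open>x'(s) = V(s, x(s))\<close> is an equation of derivations. For \<open>t = 0\<close> it is void,
  since the filter \<open>at 0 within {0}\<close> is trivial.\<close>

definition solution ::
    "('a, 'e::euclidean_space) mfd \<Rightarrow> (real \<Rightarrow> 'a \<Rightarrow> 'a tvec) \<Rightarrow> real \<Rightarrow> (real \<Rightarrow> 'a) \<Rightarrow> bool" where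
  "solution M V t x \<longleftrightarrow>
     smooth_curve M t x \<and>
     (\<forall>s\<in>{0..t}. \<forall>f\<in>smooth_funs M.
        ((\<lambda>r. f (x r)) has_real_derivative V s (x s) f) (at s within {0..t}))"

definition flow_dom ::
    "('a, 'e::euclidean_space) mfd \<Rightarrow> (real \<Rightarrow> 'a \<Rightarrow> 'a tvec) \<Rightarrow> real \<Rightarrow> 'a set" where
  "flow_dom M V t = {x\<^sub>0 \<in> points M. \<exists>x. solution M V t x \<and> x 0 = x\<^sub>0}"

definition flow ::
    "('a, 'e::euclidean_space) mfd \<Rightarrow> (real \<Rightarrow> 'a \<Rightarrow> 'a tvec) \<Rightarrow> real \<Rightarrow> 'a \<Rightarrow> 'a" where
  "flow M V t x\<^sub>0 = (THE y. \<exists>x. solution M V t x \<and> x 0 = x\<^sub>0 \<and> x t = y)"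

definition compatible ::
    "('a, 'e::euclidean_space) mfd \<Rightarrow> 'a set \<Rightarrow> (real \<Rightarrow> 'a \<Rightarrow> 'a tvec) \<Rightarrow> bool" where
  "compatible M X V \<longleftrightarrow> X \<subseteq> flow_dom M V 1 \<and> (\<forall>t\<in>{0..1}. flow M V t ` X = X)"

definition ham_vf ::
    "('a, 'e::euclidean_space) mfd \<Rightarrow> 'a form2 \<Rightarrow> (real \<Rightarrow> 'a \<Rightarrow> real) \<Rightarrow> real \<Rightarrow> 'a \<Rightarrow> 'a tvec" where
  "ham_vf M \<omega> H t p =
     (THE v. v \<in> tangent_space M p \<and> (\<forall>w\<in>tangent_space M p. \<omega> p v w = w (H t)))"

definition ham_funs ::
    "('a, 'e::euclidean_space) mfd \<Rightarrow> 'a form2 \<Rightarrow> 'a set \<Rightarrow> (real \<Rightarrow> 'a \<Rightarrow> real) set" where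
  "ham_funs M \<omega> X = {H \<in> smooth_time_funs M. compatible M X (ham_vf M \<omega> H)}"

definition Ham ::
    "'a set \<Rightarrow> ('a, 'e::euclidean_space) mfd \<Rightarrow> 'a form2 \<Rightarrow> ('a \<Rightarrow> 'a) set" where
  "Ham X M \<omega> = {restrict (flow M (ham_vf M \<omega> H) 1) X | H. H \<in> ham_funs M \<omega> X}"

definition HomeoGroup :: "'a topology \<Rightarrow> ('a \<Rightarrow> 'a) monoid" where
  "HomeoGroup T =
     BijGroup (topspace T) \<lparr>carrier := {f \<in> extensional (topspace T). homeomorphic_map T T f}\<rparr>"

section \<open>Basic facts\<close>

lemma homeo_in_Bij:
  assumes "f \<in> extensional (topspace T)" "homeomorphic_map T T f"
  shows "f \<in> Bij (topspace T)"
  using assms by (auto simp: Bij_def bij_betw_def homeomorphic_eq_everything_map)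

lemma homeomorphic_map_compose_ext:
  assumes "homeomorphic_map T T f" "homeomorphic_map T T g"
  shows "homeomorphic_map T T (compose (topspace T) g f)"
  using homeomorphic_map_compose[OF assms]
  by (rule homeomorphic_map_eq) (simp add: compose_def)

lemma homeomorphic_map_inv_ext:
  assumes "homeomorphic_map T T f"
  shows "homeomorphic_map T T (restrict (inv_into (topspace T) f) (topspace T))"
proof -
  obtain g where g: "homeomorphic_maps T T f g"
    using assms homeomorphic_map_maps by blast
  have inj: "inj_on f (topspace T)"
    using assms by (simp add: homeomorphic_eq_everything_map)
  have "homeomorphic_map T T g"
    using g homeomorphic_maps_map by blast
  moreover have "g x = restrict (inv_into (topspace T) f) (topspace T) x" if "x \<in> topspace T" for x
  proof -
    have "g x \<in> topspace T" "f (g x) = x"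
      using g that by (auto simp: homeomorphic_maps_def continuous_map_def)
    then show ?thesis
      using inv_into_f_f[OF inj, of "g x"] that by simp
  qed
  ultimately show ?thesis
    by (rule homeomorphic_map_eq)
qed

lemma subgroup_homeo:
  "subgroup {f \<in> extensional (topspace T). homeomorphic_map T T f} (BijGroup (topspace T))"
  (is "subgroup ?H ?G")
proof (rule group.subgroupI[OF group_BijGroup])
  have "homeomorphic_map T T (\<lambda>x\<in>topspace T. x)"
    by (rule homeomorphic_map_eq[of T T id]) (auto simp: homeomorphic_map_id)
  then have "(\<lambda>x\<in>topspace T. x) \<in> ?H" by simp
  then show "?H \<noteq> {}" by blast
  show "?H \<subseteq> carrier ?G"
    using homeo_in_Bij by (auto simp: BijGroup_def)
  show "inv\<^bsub>?G\<^esub> f \<in> ?H" if "f \<in> ?H" for f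
    using that homeo_in_Bij[of f T] homeomorphic_map_inv_ext[of T f]
    by (simp add: inv_BijGroup)
  show "f \<otimes>\<^bsub>?G\<^esub> g \<in> ?H" if "f \<in> ?H" "g \<in> ?H" for f g
    using that homeo_in_Bij[of f T] homeo_in_Bij[of g T] homeomorphic_map_compose_ext[of T g f]
    by (simp add: BijGroup_def compose_extensional)
qed

lemma group_HomeoGroup: "group (HomeoGroup T)"
  unfolding HomeoGroup_def
  by (rule group.subgroup_imp_group[OF group_BijGroup subgroup_homeo])

lemma Ck_on_zero: "Ck_on k U (\<lambda>x. 0)"
  by (induction k) (auto simp: frechet_derivative_const)

lemma smooth_funs_zero:
  assumes "smooth_manifold M" "\<And>x. x \<in> points M \<Longrightarrow> h x = 0"
  shows "h \<in> smooth_funs M"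
proof -
  have "h (inv_into U \<phi> y) = 0" if c: "(U, \<phi>) \<in> atlas M" and y: "y \<in> \<phi> ` U" for U \<phi> y
  proof -
    have "U \<subseteq> points M"
      using assms(1) c by (force simp: smooth_manifold_def)
    then show ?thesis
      using inv_into_into[OF y] assms(2) by blast
  qed
  then show ?thesis
    unfolding smooth_funs_def smooth_on_def
    by (fastforce intro!: exI[of _ UNIV] exI[of _ "\<lambda>x. 0"] simp: Ck_on_zero)
qed

lemma tangent_space_cong:
  assumes M: "smooth_manifold M" and p: "p \<in> points M" and v: "v \<in> tangent_space M p"
    and fg: "f \<in> smooth_funs M" "g \<in> smooth_funs M"
    and eq: "\<And>x. x \<in> points M \<Longrightarrow> f x = g x"
  shows "v f = v g"
proof -
  define h where "h = (\<lambda>x. 1 * f x + (- 1) * g x)"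
  define e :: "'a \<Rightarrow> real" where "e = (\<lambda>x. if x \<in> points M then 0 else 1)"
  have h: "h \<in> smooth_funs M" and e: "e \<in> smooth_funs M"
    using eq by (auto intro!: smooth_funs_zero[OF M] simp: h_def e_def)
  have "h = (\<lambda>x. h x * e x)"
    using eq by (auto simp: h_def e_def)
  moreover have "v (\<lambda>x. h x * e x) = h p * v e + e p * v h"
    using v h e by (simp add: tangent_space_def)
  moreover have "h p = 0" "e p = 0"
    using p eq[OF p] by (simp_all add: h_def e_def)
  ultimately have "v h = 0" by simp
  moreover have "v h = 1 * v f + (- 1) * v g"
    using v fg unfolding tangent_space_def h_def by blast
  ultimately show ?thesis by simp
qed

end

theory Submission
  imports Defs
begin

text \<open>For (i), both group operations are time changes: replacing \<open>H\<close> by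
  \<open>\<sigma>'(t) H(\<sigma>(t), _)\<close> replaces every trajectory \<open>x\<close> by \<open>x \<circ> \<sigma>\<close>. The choice \<open>\<sigma>(t) = 1 - t\<close>
  gives the inverse, and adding two time changes whose derivatives have disjoint supports gives the
  product, so no flow has to be defined outside \<open>X\<close>. Homeomorphy then only needs uniqueness of
  solutions and continuous dependence on the initial value for trajectories that exist up to time one.

  For (ii), a Hamiltonian vector field of \<open>M\<close> whose flow preserves \<open>X\<close> is tangent to \<open>X\<close> and hence is
  the Hamiltonian vector field of the restricted function. Conversely, a function \<open>K\<close> on \<open>X\<close> extends
  to \<open>M\<close> with the prescribed differential \<open>\<omega>(X\<^sub>K, _)\<close> along \<open>X\<close>: in a slice chart add to \<open>K\<close> a term
  that is linear in the normal coordinates, then glue. Both parts rest on the identification of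
  derivations with coordinate vectors and on the smoothness of Hamiltonian vector fields in charts.\<close>

section \<open>Calculus of smooth functions\<close>

text \<open>Compatibility already supplies every trajectory that is used, so no existence theorem
  for differential equations enters. Uniqueness and continuous dependence come from a mean value
  estimate over short times, uniform in nearby trajectories, and are carried along the time interval
  by connectedness.

  Functions in charts live on relatively open subsets of a linear subspace, possibly times [0,1],
  with arbitrary values elsewhere. Only derivatives in directions of the subspace are intrinsic;
  arguments that need an open set use a local extension or compose with an orthogonal projection.

  The flows are studied in the locale \<open>form_mfd\<close>, which covers both M and X with the
  restricted form, so that (ii) compares two instances of one theory.

  Prescribing a differential along X is not stable under cutoffs, because the product rule brings in
  the differential of the cutoff times the function. Therefore the gluing in (ii) keeps track of
  values and differentials together.\<close>

lemma Ck_on_subset: "Ck_on k U f \<Longrightarrow> V \<subseteq> U \<Longrightarrow> Ck_on k V f"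
  by (induction k arbitrary: f) (auto intro: continuous_on_subset)

lemma Ck_on_cong:
  assumes "open U" "\<And>x. x \<in> U \<Longrightarrow> f x = g x" "Ck_on k U f"
  shows "Ck_on k U g"
  using assms(2,3)
proof (induction k arbitrary: f g)
  case 0
  then show ?case by (auto cong: continuous_on_cong)
next
  case (Suc k)
  have der: "(g has_derivative frechet_derivative f (at x)) (at x)" if "x \<in> U" for x
  proof -
    have "(f has_derivative frechet_derivative f (at x)) (at x)"
      using Suc.prems that by (auto simp: frechet_derivative_works)
    then show ?thesis
      using has_derivative_transform_within_open[OF _ assms(1) that] Suc.prems(1) by blast
  qed
  then have "frechet_derivative g (at x) = frechet_derivative f (at x)" if "x \<in> U" for x
    using frechet_derivative_at that by metis
  then have "Ck_on k U (\<lambda>x. frechet_derivative g (at x) v)" for v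
    using Suc.IH[of "\<lambda>x. frechet_derivative f (at x) v" "\<lambda>x. frechet_derivative g (at x) v"] Suc.prems(2)
    by auto
  then show ?case
    using der by (auto simp: differentiable_def)
qed

lemma Ck_on_SucI:
  assumes "open U" "\<And>x. x \<in> U \<Longrightarrow> (f has_derivative D x) (at x)"
    and "\<And>v. Ck_on k U (\<lambda>x. D x v)"
  shows "Ck_on (Suc k) U f"
proof -
  have "frechet_derivative f (at x) = D x" if "x \<in> U" for x
    using assms(2)[OF that] frechet_derivative_at by metis
  then have "Ck_on k U (\<lambda>x. frechet_derivative f (at x) v)" for v
    using Ck_on_cong[OF assms(1) _ assms(3)[of v]] by auto
  then show ?thesis
    using assms(2) by (auto simp: differentiable_def)
qed

lemma Ck_on_has_derivative:
  assumes "Ck_on (Suc k) U f" "x \<in> U"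
  shows "(f has_derivative frechet_derivative f (at x)) (at x)"
  using assms by (auto simp: frechet_derivative_works)

lemma Ck_on_continuous_on: "Ck_on k U f \<Longrightarrow> continuous_on U f"
  by (cases k) (auto intro!: differentiable_imp_continuous_on differentiable_at_imp_differentiable_on)

lemma Ck_on_Suc_imp: "Ck_on (Suc k) U f \<Longrightarrow> Ck_on k U f"
proof (induction k arbitrary: f)
  case 0
  then show ?case using Ck_on_continuous_on[of "Suc 0" U f] by (metis Ck_on.simps(1))
next
  case (Suc k)
  have "Ck_on k U (\<lambda>x. frechet_derivative f (at x) v)" for v
    using Suc.IH Suc.prems by (metis Ck_on.simps(2))
  moreover have "\<forall>x\<in>U. f differentiable at x"
    using Suc.prems by simp
  ultimately show ?case by simp
qed

lemma Ck_on_local: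
  assumes "\<And>x. x \<in> U \<Longrightarrow> \<exists>N. open N \<and> x \<in> N \<and> Ck_on k N f"
  shows "Ck_on k U f"
  using assms
proof (induction k arbitrary: f)
  case 0
  then have "isCont f x" if "x \<in> U" for x
    using that continuous_on_eq_continuous_at by fastforce
  then show ?case by (simp add: continuous_at_imp_continuous_on)
next
  case (Suc k)
  have "f differentiable at x" if "x \<in> U" for x
    using Suc.prems[OF that] by auto
  moreover have "Ck_on k U (\<lambda>x. frechet_derivative f (at x) v)" for v
    by (rule Suc.IH) (use Suc.prems in fastforce)
  ultimately show ?case by simp
qed

lemma Ck_on_const: "Ck_on k U (\<lambda>x. c)"
  by (cases k) (auto simp: Ck_on_zero)

lemma Ck_on_bounded_linear: "bounded_linear L \<Longrightarrow> Ck_on k UNIV L"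
  by (cases k)
    (auto intro!: Ck_on_SucI[where D = "\<lambda>_. L"] Ck_on_const bounded_linear_imp_has_derivative
      simp del: Ck_on.simps(2) simp: linear_continuous_on)

lemma Ck_on_add:
  assumes "open U" "Ck_on k U f" "Ck_on k U g"
  shows "Ck_on k U (\<lambda>x. f x + g x)"
  using assms(2,3)
proof (induction k arbitrary: f g)
  case 0
  then show ?case by (auto intro: continuous_on_add)
next
  case (Suc k)
  show ?case
    by (rule Ck_on_SucI[OF assms(1) has_derivative_add])
      (use Suc in \<open>auto intro!: Ck_on_has_derivative simp del: Ck_on.simps(2)\<close>, simp)
qed

lemma Ck_on_bilinear:
  assumes "bounded_bilinear p" "open U" "Ck_on k U f" "Ck_on k U g"
  shows "Ck_on k U (\<lambda>x. p (f x) (g x))"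
  using assms(3,4)
proof (induction k arbitrary: f g)
  case 0
  then show ?case using bounded_bilinear.continuous_on[OF assms(1)] by auto
next
  case (Suc k)
  have 1: "Ck_on k U (\<lambda>x. p (f x) (frechet_derivative g (at x) v))" for v
    using Suc.IH[of f] Ck_on_Suc_imp[of k U f] Suc.prems by auto
  have 2: "Ck_on k U (\<lambda>x. p (frechet_derivative f (at x) v) (g x))" for v
    using Suc.IH[of _ g] Ck_on_Suc_imp[of k U g] Suc.prems by auto
  show ?case
    by (rule Ck_on_SucI[OF assms(2) bounded_bilinear.FDERIV[OF assms(1)]])
      (use Suc 1 2 in \<open>auto intro!: Ck_on_has_derivative Ck_on_add assms(2) simp del: Ck_on.simps(2)\<close>)
qed

lemma Ck_on_sum:
  assumes "open U" "\<And>i. i \<in> I \<Longrightarrow> Ck_on k U (f i)"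
  shows "Ck_on k U (\<lambda>x. \<Sum>i\<in>I. f i x)"
  using assms(2) by (induction I rule: infinite_finite_induct) (auto intro!: Ck_on_const Ck_on_add assms(1))

lemma Ck_on_compose:
  fixes f :: "'a::euclidean_space \<Rightarrow> 'b::euclidean_space" and g :: "'b \<Rightarrow> 'c::euclidean_space"
  assumes "open U" "open V" "Ck_on k U f" "Ck_on k V g" "f ` U \<subseteq> V"
  shows "Ck_on k U (\<lambda>x. g (f x))"
  using assms(3,4,5)
proof (induction k arbitrary: f g)
  case 0
  then show ?case by (auto intro: continuous_on_compose2)
next
  case (Suc k)
  \<comment> \<open>The chain rule evaluates the derivative of \<open>g\<close> in a direction that
    varies with \<open>x\<close>, while \<open>Ck_on\<close> speaks of fixed directions. Expanding
    in \<open>Basis\<close> makes the directions fixed and moves the variation into scalar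
    factors.\<close>
  define D where "D x v = (\<Sum>b\<in>Basis. (frechet_derivative f (at x) v \<bullet> b) *\<^sub>R frechet_derivative g (at (f x)) b)" for x v
  have der: "((\<lambda>x. g (f x)) has_derivative D x) (at x)" if x: "x \<in> U" for x
  proof -
    have f: "(f has_derivative frechet_derivative f (at x)) (at x)"
      and g: "(g has_derivative frechet_derivative g (at (f x))) (at (f x))"
      using Ck_on_has_derivative Suc.prems x by blast+
    have "frechet_derivative g (at (f x)) (frechet_derivative f (at x) v) = D x v" for v
    proof -
      have l: "linear (frechet_derivative g (at (f x)))"
        using g has_derivative_linear by blast
      show ?thesis
        unfolding D_def
        by (subst euclidean_representation[symmetric, of "frechet_derivative f (at x) v"])
          (simp add: linear_sum[OF l] linear_scale[OF l])
    qed
    then show ?thesis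
      using diff_chain_at[OF f g] by (simp add: o_def)
  qed
  have "Ck_on k U (\<lambda>x. D x v)" for v
    unfolding D_def
  proof (rule Ck_on_sum[OF assms(1)], rule Ck_on_bilinear[OF bounded_bilinear_scaleR assms(1)])
    fix b :: 'b
    show "Ck_on k U (\<lambda>x. frechet_derivative f (at x) v \<bullet> b)"
      by (rule Ck_on_bilinear[OF bounded_bilinear_inner assms(1) _ Ck_on_const]) (use Suc.prems in simp)
    show "Ck_on k U (\<lambda>x. frechet_derivative g (at (f x)) b)"
      by (rule Suc.IH) (use Suc.prems Ck_on_Suc_imp[of k U f] in auto)
  qed
  then show ?case
    by (intro Ck_on_SucI[OF assms(1) der])
qed

lemma Ck_on_inverse: "Ck_on k (- {0}) (inverse :: real \<Rightarrow> real)"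
proof (induction k)
  case 0
  then show ?case by (auto intro!: continuous_intros)
next
  case (Suc k)
  have "Ck_on k (- {0::real}) (\<lambda>x. - (inverse x * v * inverse x))" for v
    using Ck_on_bilinear[OF bounded_bilinear_mult _ Ck_on_bilinear[OF bounded_bilinear_mult _ Suc Ck_on_const[of _ _ "-v"]] Suc]
    by (simp add: open_Compl)
  then show ?case
    by (intro Ck_on_SucI[where D = "\<lambda>x v. - (inverse x * v * inverse x)"] has_derivative_inverse')
      (auto simp: open_Compl)
qed

text \<open>The weight \<open>t ^ m\<close> makes the induction on \<open>k\<close> go through, because differentiating
  \<open>f (y0 + t *\<^sub>R (y - y0))\<close> with respect to \<open>y\<close> produces a factor \<open>t\<close>.\<close>

lemma Ck_on_ray_integral:
  fixes f :: "'a::euclidean_space \<Rightarrow> 'b::euclidean_space"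
  assumes U: "open U" "convex U" "y0 \<in> U" and f: "Ck_on k U f"
  shows "Ck_on k U (\<lambda>y. integral {0..1} (\<lambda>t. t ^ m *\<^sub>R f (y0 + t *\<^sub>R (y - y0))))"
  using f
proof (induction k arbitrary: f m)
  case 0
  have ray: "y0 + t *\<^sub>R (y - y0) \<in> U" if "y \<in> U" "0 \<le> t" "t \<le> 1" for y t
    using convexD_alt[OF U(2,3) that(1), of t] that by (simp add: algebra_simps)
  have "continuous_on U (\<lambda>y. integral (cbox 0 1) (\<lambda>t. t ^ m *\<^sub>R f (y0 + t *\<^sub>R (y - y0))))"
    by (rule integral_continuous_on_param)
      (use 0 ray in \<open>auto simp: split_beta intro!: continuous_intros continuous_on_compose2[of U f]\<close>)
  then show ?case by simp
next
  case (Suc k)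
  have ray: "y0 + t *\<^sub>R (y - y0) \<in> U" if "y \<in> U" "0 \<le> t" "t \<le> 1" for y t
    using convexD_alt[OF U(2,3) that(1), of t] that by (simp add: algebra_simps)
  \<comment> \<open>The Leibniz rule integrates operator-valued derivatives, so the derivative of
    the integrand in \<open>y\<close> is packaged as a bounded operator. One of the factors
    \<open>t\<close> in \<open>t ^ Suc m\<close> is the inner derivative of the ray.\<close>
  define B where "B y t = Blinfun (\<lambda>v. t ^ Suc m *\<^sub>R frechet_derivative f (at (y0 + t *\<^sub>R (y - y0))) v)" for y t
  have bl: "bounded_linear (frechet_derivative f (at y))" if "y \<in> U" for y
    using Suc.prems that Ck_on_has_derivative has_derivative_bounded_linear by blast
  have B: "blinfun_apply (B y t) = (\<lambda>v. t ^ Suc m *\<^sub>R frechet_derivative f (at (y0 + t *\<^sub>R (y - y0))) v)"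
    if "y \<in> U" "t \<in> cbox 0 1" for y t
    unfolding B_def
    by (rule bounded_linear_Blinfun_apply, rule bounded_linear_const_scaleR, rule bl, rule ray)
      (use that in auto)
  have cont: "continuous_on U (\<lambda>y. frechet_derivative f (at y) v)" for v
    using Suc.prems by (auto intro: Ck_on_continuous_on)
  have cont_B: "continuous_on (U \<times> cbox 0 1) (\<lambda>(y, t). B y t)"
  proof (rule continuous_on_blinfun_componentwise)
    fix i :: 'a
    have "continuous_on (U \<times> cbox 0 1) (\<lambda>z. snd z ^ Suc m *\<^sub>R frechet_derivative f (at (y0 + snd z *\<^sub>R (fst z - y0))) i)"
      by (intro continuous_intros continuous_on_compose2[OF cont]) (use ray in auto)
    then show "continuous_on (U \<times> cbox 0 1) (\<lambda>z. blinfun_apply (case z of (y, t) \<Rightarrow> B y t) i)"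
      by (rule continuous_on_eq) (auto simp: B)
  qed
  have der: "((\<lambda>y. integral (cbox 0 1) (\<lambda>t. t ^ m *\<^sub>R f (y0 + t *\<^sub>R (y - y0)))) has_derivative
      blinfun_apply (integral (cbox 0 1) (B y))) (at y)" if y: "y \<in> U" for y
  proof -
    have "((\<lambda>y. integral (cbox 0 1) (\<lambda>t. t ^ m *\<^sub>R f (y0 + t *\<^sub>R (y - y0)))) has_derivative
      blinfun_apply (integral (cbox 0 1) (B y))) (at y within U)"
    proof (rule leibniz_rule[OF _ _ cont_B y U(2)])
      fix x and t :: real
      assume x: "x \<in> U" and t: "t \<in> cbox 0 1"
      have 1: "(f has_derivative frechet_derivative f (at (y0 + t *\<^sub>R (x - y0)))) (at (y0 + t *\<^sub>R (x - y0)))"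
        using Ck_on_has_derivative[OF Suc.prems] ray x t by auto
      have "((\<lambda>x. f (y0 + t *\<^sub>R (x - y0))) has_derivative
          (\<lambda>v. frechet_derivative f (at (y0 + t *\<^sub>R (x - y0))) (t *\<^sub>R v))) (at x within U)"
        by (rule has_derivative_compose[where f = "\<lambda>x. y0 + t *\<^sub>R (x - y0)", OF _ 1])
          (auto intro!: derivative_eq_intros)
      moreover have "frechet_derivative f (at (y0 + t *\<^sub>R (x - y0))) (t *\<^sub>R v)
          = t *\<^sub>R frechet_derivative f (at (y0 + t *\<^sub>R (x - y0))) v" for v
        using bl[of "y0 + t *\<^sub>R (x - y0)"] ray x t by (auto simp: linear_simps)
      ultimately have "((\<lambda>x. t ^ m *\<^sub>R f (y0 + t *\<^sub>R (x - y0))) has_derivative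
          (\<lambda>v. t ^ m *\<^sub>R (t *\<^sub>R frechet_derivative f (at (y0 + t *\<^sub>R (x - y0))) v))) (at x within U)"
        by (auto intro!: derivative_eq_intros)
      then show "((\<lambda>x. t ^ m *\<^sub>R f (y0 + t *\<^sub>R (x - y0))) has_derivative blinfun_apply (B x t)) (at x within U)"
        by (simp add: B[OF x t] mult.commute)
    next
      fix x assume "x \<in> U"
      then show "(\<lambda>t. t ^ m *\<^sub>R f (y0 + t *\<^sub>R (x - y0))) integrable_on cbox 0 1"
        by (intro integrable_continuous continuous_intros continuous_on_compose2[OF Ck_on_continuous_on[OF Suc.prems]])
          (use ray in auto)
    qed
    then show ?thesis by (simp only: at_within_open[OF y U(1)])
  qed
  \<comment> \<open>Evaluation at \<open>v\<close> commutes with the integral and leaves a ray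
    integral of a derivative of \<open>f\<close> with weight \<open>Suc m\<close>, to which the
    induction hypothesis applies.\<close>
  have dir: "Ck_on k U (\<lambda>y. blinfun_apply (integral (cbox 0 1) (B y)) v)" for v
  proof (rule Ck_on_cong[OF U(1)])
    show "Ck_on k U (\<lambda>y. integral {0..1} (\<lambda>t. t ^ Suc m *\<^sub>R frechet_derivative f (at (y0 + t *\<^sub>R (y - y0))) v))"
      using Suc.IH[of "\<lambda>y. frechet_derivative f (at y) v" "Suc m"] Suc.prems by simp
    fix y assume y: "y \<in> U"
    have "continuous_on (cbox 0 1) (\<lambda>t. case (y, t) of (y, t) \<Rightarrow> B y t)"
      by (rule continuous_on_compose2[OF cont_B]) (use y in \<open>auto intro!: continuous_intros\<close>)
    then have "B y integrable_on cbox 0 1"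
      by (intro integrable_continuous) simp
    then show "integral {0..1} (\<lambda>t. t ^ Suc m *\<^sub>R frechet_derivative f (at (y0 + t *\<^sub>R (y - y0))) v)
        = blinfun_apply (integral (cbox 0 1) (B y)) v"
      by (subst blinfun_apply_integral) (auto intro!: integral_cong simp: B[OF y])
  qed
  from Ck_on_SucI[OF U(1) der dir] show ?case by (simp only: cbox_interval)
qed

section \<open>Smoothness on arbitrary sets by local extensions\<close>

lemma smooth_onI:
  assumes "\<And>x. x \<in> S \<Longrightarrow> \<exists>N g. open N \<and> x \<in> N \<and> (\<forall>k. Ck_on k N g) \<and> (\<forall>y\<in>S \<inter> N. g y = f y)"
  shows "smooth_on S f"
  using assms by (auto simp: smooth_on_def)

lemma smooth_onE:
  assumes "smooth_on S f" "x \<in> S"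
  obtains N g where "open N" "x \<in> N" "\<And>k. Ck_on k N g" "\<And>y. y \<in> S \<Longrightarrow> y \<in> N \<Longrightarrow> g y = f y"
  using assms unfolding smooth_on_def by (metis IntI)

lemma smooth_on_subset: "smooth_on S f \<Longrightarrow> T \<subseteq> S \<Longrightarrow> smooth_on T f"
  by (rule smooth_onI) (erule smooth_onE[of S f], blast+)

lemma smooth_on_cong:
  assumes "\<And>x. x \<in> S \<Longrightarrow> f x = g x" "smooth_on S f"
  shows "smooth_on S g"
proof (rule smooth_onI)
  fix x assume "x \<in> S"
  then obtain N h where "open N" "x \<in> N" "\<And>k. Ck_on k N h" "\<And>y. y \<in> S \<Longrightarrow> y \<in> N \<Longrightarrow> h y = f y"
    using smooth_onE[OF assms(2)] by blast
  then show "\<exists>N h. open N \<and> x \<in> N \<and> (\<forall>k. Ck_on k N h) \<and> (\<forall>y\<in>S \<inter> N. h y = g y)"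
    using assms(1) by (intro exI[of _ N] exI[of _ h]) auto
qed

lemma smooth_on_local:
  assumes "\<And>x. x \<in> S \<Longrightarrow> \<exists>N. open N \<and> x \<in> N \<and> smooth_on (S \<inter> N) f"
  shows "smooth_on S f"
proof (rule smooth_onI)
  fix x assume x: "x \<in> S"
  then obtain N where N: "open N" "x \<in> N" "smooth_on (S \<inter> N) f"
    using assms by blast
  obtain N' g where "open N'" "x \<in> N'" "\<And>k. Ck_on k N' g" "\<And>y. y \<in> S \<inter> N \<Longrightarrow> y \<in> N' \<Longrightarrow> g y = f y"
    using smooth_onE[OF N(3)] x N(2) by blast
  then show "\<exists>N g. open N \<and> x \<in> N \<and> (\<forall>k. Ck_on k N g) \<and> (\<forall>y\<in>S \<inter> N. g y = f y)"
    using N by (intro exI[of _ "N \<inter> N'"] exI[of _ g]) (auto intro: Ck_on_subset)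
qed

lemma smooth_on_open_iff:
  assumes "open S"
  shows "smooth_on S f \<longleftrightarrow> (\<forall>k. Ck_on k S f)"
proof
  assume f: "smooth_on S f"
  show "\<forall>k. Ck_on k S f"
  proof (intro allI Ck_on_local)
    fix k x assume x: "x \<in> S"
    then obtain N g where N: "open N" "x \<in> N" "\<And>k. Ck_on k N g" "\<And>y. y \<in> S \<Longrightarrow> y \<in> N \<Longrightarrow> g y = f y"
      using smooth_onE[OF f] by blast
    have "Ck_on k (N \<inter> S) f"
      by (rule Ck_on_cong[of _ g]) (use N assms in \<open>auto intro: Ck_on_subset\<close>)
    then show "\<exists>N. open N \<and> x \<in> N \<and> Ck_on k N f"
      using N assms x by (intro exI[of _ "N \<inter> S"]) auto
  qed
qed (use assms in \<open>auto intro!: smooth_onI exI[of _ S] exI[of _ f]\<close>)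

lemma smooth_on_UNIV_imp: "(\<And>k. Ck_on k UNIV f) \<Longrightarrow> smooth_on S f"
  by (rule smooth_onI) auto

lemma smooth_on_const: "smooth_on S (\<lambda>x. c)"
  by (rule smooth_on_UNIV_imp) (rule Ck_on_const)

lemma smooth_on_bounded_linear: "bounded_linear L \<Longrightarrow> smooth_on S L"
  by (rule smooth_on_UNIV_imp) (rule Ck_on_bounded_linear)

lemma smooth_on_id: "smooth_on S (\<lambda>x. x)"
  by (rule smooth_on_bounded_linear) (rule bounded_linear_ident)

lemma smooth_on_compose:
  assumes f: "smooth_on S f" and g: "smooth_on T g" and sub: "\<And>x. x \<in> S \<Longrightarrow> f x \<in> T"
  shows "smooth_on S (\<lambda>x. g (f x))"
proof (rule smooth_onI)
  fix x assume x: "x \<in> S"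
  obtain N f' where N: "open N" "x \<in> N" "\<And>k. Ck_on k N f'" "\<And>y. y \<in> S \<Longrightarrow> y \<in> N \<Longrightarrow> f' y = f y"
    using smooth_onE[OF f x] by blast
  obtain O' g' where O': "open O'" "f x \<in> O'" "\<And>k. Ck_on k O' g'" "\<And>y. y \<in> T \<Longrightarrow> y \<in> O' \<Longrightarrow> g' y = g y"
    using smooth_onE[OF g sub[OF x]] by blast
  have op: "open (N \<inter> f' -` O')"
    using continuous_open_preimage[OF Ck_on_continuous_on[OF N(3)] N(1) O'(1)] .
  have "Ck_on k (N \<inter> f' -` O') (\<lambda>x. g' (f' x))" for k
    by (rule Ck_on_compose[OF op O'(1) _ O'(3)]) (auto intro: Ck_on_subset[OF N(3)])
  then show "\<exists>N h. open N \<and> x \<in> N \<and> (\<forall>k. Ck_on k N h) \<and> (\<forall>y\<in>S \<inter> N. h y = g (f y))"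
    using op x N O' sub by (intro exI[of _ "N \<inter> f' -` O'"] exI[of _ "\<lambda>x. g' (f' x)"]) auto
qed

lemma smooth_on_Pair:
  assumes f: "smooth_on S f" and g: "smooth_on S g"
  shows "smooth_on S (\<lambda>x. (f x, g x))"
proof (rule smooth_onI)
  fix x assume x: "x \<in> S"
  obtain N f' where N: "open N" "x \<in> N" "\<And>k. Ck_on k N f'" "\<And>y. y \<in> S \<Longrightarrow> y \<in> N \<Longrightarrow> f' y = f y"
    using smooth_onE[OF f x] by blast
  obtain O' g' where O': "open O'" "x \<in> O'" "\<And>k. Ck_on k O' g'" "\<And>y. y \<in> S \<Longrightarrow> y \<in> O' \<Longrightarrow> g' y = g y"
    using smooth_onE[OF g x] by blast
  have op: "open (N \<inter> O')" using N O' by auto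
  have "Ck_on k (N \<inter> O') (\<lambda>x. (f' x, 0) + (0, g' x))" for k
  proof (rule Ck_on_add[OF op])
    show "Ck_on k (N \<inter> O') (\<lambda>x. (f' x, 0))"
      by (rule Ck_on_compose[OF op open_UNIV Ck_on_subset[OF N(3)] Ck_on_bounded_linear])
        (auto intro!: bounded_linear_Pair bounded_linear_ident bounded_linear_zero)
    show "Ck_on k (N \<inter> O') (\<lambda>x. (0, g' x))"
      by (rule Ck_on_compose[OF op open_UNIV Ck_on_subset[OF O'(3)] Ck_on_bounded_linear])
        (auto intro!: bounded_linear_Pair bounded_linear_ident bounded_linear_zero)
  qed
  then show "\<exists>N h. open N \<and> x \<in> N \<and> (\<forall>k. Ck_on k N h) \<and> (\<forall>y\<in>S \<inter> N. h y = (f y, g y))"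
    using op N O' by (intro exI[of _ "N \<inter> O'"] exI[of _ "\<lambda>x. (f' x, g' x)"]) auto
qed

lemma smooth_on_bilinear:
  assumes p: "bounded_bilinear p" and f: "smooth_on S f" and g: "smooth_on S g"
  shows "smooth_on S (\<lambda>x. p (f x) (g x))"
proof -
  have "smooth_on UNIV (\<lambda>z. p (fst z) (snd z))"
    by (rule smooth_on_UNIV_imp)
      (intro Ck_on_bilinear[OF p open_UNIV] Ck_on_bounded_linear bounded_linear_fst bounded_linear_snd)
  from smooth_on_compose[OF smooth_on_Pair[OF f g] this] show ?thesis by simp
qed

lemmas smooth_on_mult = smooth_on_bilinear[OF bounded_bilinear_mult]
lemmas smooth_on_scaleR = smooth_on_bilinear[OF bounded_bilinear_scaleR]
lemmas smooth_on_inner = smooth_on_bilinear[OF bounded_bilinear_inner]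

lemma smooth_on_linear_compose:
  "bounded_linear L \<Longrightarrow> smooth_on S f \<Longrightarrow> smooth_on S (\<lambda>x. L (f x))"
  using smooth_on_compose[of S f UNIV L] smooth_on_bounded_linear by auto

lemmas smooth_on_fst = smooth_on_linear_compose[OF bounded_linear_fst]
lemmas smooth_on_snd = smooth_on_linear_compose[OF bounded_linear_snd]

lemma smooth_on_add:
  assumes "smooth_on S f" "smooth_on S g" shows "smooth_on S (\<lambda>x. f x + g x)"
  using smooth_on_linear_compose[OF bounded_linear_add[OF bounded_linear_fst bounded_linear_snd] smooth_on_Pair[OF assms]]
  by simp

lemma smooth_on_minus: "smooth_on S f \<Longrightarrow> smooth_on S (\<lambda>x. - f x)"
  by (rule smooth_on_linear_compose[OF bounded_linear_minus[OF bounded_linear_ident]])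

lemma smooth_on_diff:
  "smooth_on S f \<Longrightarrow> smooth_on S g \<Longrightarrow> smooth_on S (\<lambda>x. f x - g x)"
  using smooth_on_add[OF _ smooth_on_minus] by fastforce

lemma smooth_on_sum:
  "(\<And>i. i \<in> I \<Longrightarrow> smooth_on S (f i)) \<Longrightarrow> smooth_on S (\<lambda>x. \<Sum>i\<in>I. f i x)"
  by (induction I rule: infinite_finite_induct) (auto intro: smooth_on_const smooth_on_add)

lemma smooth_on_inverse:
  fixes f :: "'a::euclidean_space \<Rightarrow> real"
  assumes "smooth_on S f" "\<And>x. x \<in> S \<Longrightarrow> f x \<noteq> 0"
  shows "smooth_on S (\<lambda>x. inverse (f x))"
proof -
  have "smooth_on (- {0}) (inverse :: real \<Rightarrow> real)"
    by (auto simp: smooth_on_open_iff open_Compl Ck_on_inverse)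
  from smooth_on_compose[OF assms(1) this] assms(2) show ?thesis by simp
qed

lemma smooth_on_divide:
  fixes f :: "'a::euclidean_space \<Rightarrow> real"
  assumes "smooth_on S f" "smooth_on S g" "\<And>x. x \<in> S \<Longrightarrow> g x \<noteq> 0"
  shows "smooth_on S (\<lambda>x. f x / g x)"
  using smooth_on_mult[OF assms(1) smooth_on_inverse[OF assms(2,3)]] by (simp add: divide_inverse)

lemmas smooth_on_intros =
  smooth_on_const smooth_on_id smooth_on_Pair smooth_on_mult smooth_on_scaleR smooth_on_inner
  smooth_on_fst smooth_on_snd smooth_on_add smooth_on_minus smooth_on_diff smooth_on_sum

lemma smooth_on_imp_continuous_on:
  assumes "smooth_on S f" shows "continuous_on S f"
  unfolding continuous_on_eq_continuous_within
proof
  fix x assume x: "x \<in> S"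
  then obtain N g where N: "open N" "x \<in> N" "\<And>k. Ck_on k N g" "\<And>y. y \<in> S \<Longrightarrow> y \<in> N \<Longrightarrow> g y = f y"
    using smooth_onE[OF assms] by blast
  have "continuous (at x within S) g"
    using Ck_on_continuous_on[OF N(3)] N(1,2) continuous_on_eq_continuous_at continuous_at_imp_continuous_at_within by blast
  then show "continuous (at x within S) f"
    by (rule continuous_transform_within_openin[OF _ openin_open_Int[OF N(1)]]) (use N x in auto)
qed


section \<open>Directional derivatives\<close>

text \<open>A derivative along a line sees only the values of \<open>f\<close> on that line. It is
  therefore meaningful for functions on a relatively open subset of a subspace, where a total
  derivative would depend on the values off the subspace.\<close>

definition dirderiv :: "('a::euclidean_space \<Rightarrow> 'b::euclidean_space) \<Rightarrow> 'a \<Rightarrow> 'a \<Rightarrow> 'b" where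
  "dirderiv f x e = vector_derivative (\<lambda>r. f (x + r *\<^sub>R e)) (at 0)"

definition open_along :: "'a::euclidean_space set \<Rightarrow> 'a \<Rightarrow> bool" where
  "open_along S e \<longleftrightarrow> (\<forall>x\<in>S. \<forall>\<^sub>F r in nhds 0. x + r *\<^sub>R e \<in> S)"

lemma dirderiv_eqI:
  "((\<lambda>r. f (x + r *\<^sub>R e)) has_vector_derivative D) (at 0) \<Longrightarrow> dirderiv f x e = D"
  by (simp add: dirderiv_def vector_derivative_at)

lemma dirderiv_cong:
  assumes "\<forall>\<^sub>F r in nhds 0. f (x + r *\<^sub>R e) = g (x + r *\<^sub>R e)"
  shows "dirderiv f x e = dirderiv g x e"
  unfolding dirderiv_def by (rule vector_derivative_cong_eq) (use assms in auto)

lemma eventually_line_in_open: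
  fixes x :: "'a::euclidean_space"
  assumes "open N" "x \<in> N"
  shows "\<forall>\<^sub>F r in nhds 0. x + r *\<^sub>R e \<in> N"
proof -
  have "open ((\<lambda>r::real. x + r *\<^sub>R e) -` N)"
    by (intro open_vimage assms continuous_on_add continuous_on_scaleR continuous_on_const continuous_on_id)
  then show ?thesis
    unfolding eventually_nhds using assms by (intro exI[of _ "(\<lambda>r. x + r *\<^sub>R e) -` N"]) auto
qed

lemma open_along_open: "open S \<Longrightarrow> open_along S e"
  by (simp add: open_along_def eventually_line_in_open)

lemma open_along_subspace:
  assumes "subspace E" "openin (top_of_set E) S" "e \<in> E"
  shows "open_along S e"
  unfolding open_along_def
proof
  fix x assume x: "x \<in> S"
  obtain T where T: "open T" "S = E \<inter> T"
    using assms(2) by (auto simp: openin_open)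
  have "x + r *\<^sub>R e \<in> E" for r
    using x T assms by (auto intro: subspace_add subspace_scale)
  then show "\<forall>\<^sub>F r in nhds 0. x + r *\<^sub>R e \<in> S"
    using eventually_line_in_open[OF T(1), of x e] x T by simp
qed

lemma open_along_Times:
  "open_along S e \<Longrightarrow> open_along (T \<times> S) (0, e)"
  by (auto simp: open_along_def)

text \<open>For small \<open>r\<close> the line stays both in \<open>S\<close> and in the domain of
  the extension, where the two functions agree. Hence any local extension computes the same
  directional derivative.\<close>

lemma line_extension_derivative:
  assumes N: "open N" "x \<in> N" "Ck_on (Suc 0) N g" and eq: "\<And>y. y \<in> S \<Longrightarrow> y \<in> N \<Longrightarrow> g y = f y"
    and S: "open_along S e" "x \<in> S"
  shows "((\<lambda>r. f (x + r *\<^sub>R e)) has_vector_derivative frechet_derivative g (at x) e) (at 0)"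
proof -
  have g: "(g has_derivative frechet_derivative g (at x)) (at (x + 0 *\<^sub>R e))"
    using Ck_on_has_derivative[OF N(3,2)] by simp
  have "((\<lambda>r. x + r *\<^sub>R e) has_derivative (\<lambda>r. r *\<^sub>R e)) (at 0)"
    by (auto intro!: derivative_eq_intros)
  from has_derivative_compose[OF this g]
  have "((\<lambda>r. g (x + r *\<^sub>R e)) has_vector_derivative frechet_derivative g (at x) e) (at 0)"
    using has_derivative_linear[OF g] by (simp add: has_vector_derivative_def linear_scale)
  moreover have "\<forall>\<^sub>F r in nhds 0. f (x + r *\<^sub>R e) = g (x + r *\<^sub>R e)"
    using eventually_line_in_open[OF N(1,2), of e] S(1)[unfolded open_along_def, rule_format, OF S(2)]
    by eventually_elim (simp add: eq)
  ultimately show ?thesis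
    using has_vector_derivative_cong_ev[of UNIV "\<lambda>r. f (x + r *\<^sub>R e)" "\<lambda>r. g (x + r *\<^sub>R e)" 0] eq N S
    by simp
qed

lemma dirderiv_extension:
  assumes "open N" "x \<in> N" "Ck_on (Suc 0) N g" "\<And>y. y \<in> S \<Longrightarrow> y \<in> N \<Longrightarrow> g y = f y"
    and "open_along S e" "x \<in> S"
  shows "dirderiv f x e = frechet_derivative g (at x) e"
  by (rule dirderiv_eqI) (rule line_extension_derivative[OF assms], assumption)

lemma has_vector_derivative_dirderiv:
  assumes f: "smooth_on S f" and S: "open_along S e" "x \<in> S"
  shows "((\<lambda>r. f (x + r *\<^sub>R e)) has_vector_derivative dirderiv f x e) (at 0)"
proof -
  obtain N g where N: "open N" "x \<in> N" "\<And>k. Ck_on k N g" "\<And>y. y \<in> S \<Longrightarrow> y \<in> N \<Longrightarrow> g y = f y"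
    using smooth_onE[OF f S(2)] by blast
  show ?thesis
    using line_extension_derivative[OF N(1,2) N(3) N(4) S] dirderiv_extension[OF N(1,2) N(3) N(4) S]
    by simp
qed

lemma has_real_derivative_dirderiv:
  fixes f :: "'a::euclidean_space \<Rightarrow> real"
  assumes "smooth_on S f" "open_along S e" "x \<in> S"
  shows "((\<lambda>r. f (x + r *\<^sub>R e)) has_real_derivative dirderiv f x e) (at 0)"
  using has_vector_derivative_dirderiv[OF assms]
  by (simp add: has_real_derivative_iff_has_vector_derivative)

text \<open>The derivative of a local extension in the fixed direction \<open>e\<close> is itself a
  local extension of the directional derivative.\<close>

lemma smooth_on_dirderiv:
  assumes f: "smooth_on S f" and S: "open_along S e"
  shows "smooth_on S (\<lambda>x. dirderiv f x e)"
proof (rule smooth_onI)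
  fix x assume x: "x \<in> S"
  obtain N g where N: "open N" "x \<in> N" "\<And>k. Ck_on k N g" "\<And>y. y \<in> S \<Longrightarrow> y \<in> N \<Longrightarrow> g y = f y"
    using smooth_onE[OF f x] by blast
  have "Ck_on k N (\<lambda>x. frechet_derivative g (at x) e)" for k
    using N(3)[of "Suc k"] by simp
  then show "\<exists>N h. open N \<and> x \<in> N \<and> (\<forall>k. Ck_on k N h) \<and> (\<forall>y\<in>S \<inter> N. h y = dirderiv f y e)"
    using N dirderiv_extension[OF N(1) _ N(3) N(4) S]
    by (intro exI[of _ N] exI[of _ "\<lambda>x. frechet_derivative g (at x) e"]) auto
qed

lemma dirderiv_linear:
  assumes f: "smooth_on S f" and x: "x \<in> S"
    and S: "open_along S e" "open_along S e'" "open_along S (a *\<^sub>R e + b *\<^sub>R e')"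
  shows "dirderiv f x (a *\<^sub>R e + b *\<^sub>R e') = a *\<^sub>R dirderiv f x e + b *\<^sub>R dirderiv f x e'"
proof -
  obtain N g where N: "open N" "x \<in> N" "\<And>k. Ck_on k N g" "\<And>y. y \<in> S \<Longrightarrow> y \<in> N \<Longrightarrow> g y = f y"
    using smooth_onE[OF f x] by blast
  have "linear (frechet_derivative g (at x))"
    using Ck_on_has_derivative[OF N(3,2)] has_derivative_linear by blast
  then show ?thesis
    using dirderiv_extension[OF N(1,2) N(3) N(4) _ x] S
    by (simp add: linear_add linear_scale)
qed

text \<open>A chain rule for functions that are given on \<open>S\<close> only. The derivative is
  taken within \<open>T\<close>, so that end points of time intervals are included.\<close>

lemma has_vector_derivative_along_curve:
  assumes f: "smooth_on S f" and S: "open_along S e" "y s \<in> S"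
    and ev: "\<forall>\<^sub>F r in at s within T. y r \<in> S" "s \<in> T"
    and y: "(y has_vector_derivative e) (at s within T)"
  shows "((\<lambda>r. f (y r)) has_vector_derivative dirderiv f (y s) e) (at s within T)"
proof -
  obtain N g where N: "open N" "y s \<in> N" "\<And>k. Ck_on k N g" "\<And>z. z \<in> S \<Longrightarrow> z \<in> N \<Longrightarrow> g z = f z"
    using smooth_onE[OF f S(2)] by blast
  have g: "(g has_derivative frechet_derivative g (at (y s))) (at (y s))"
    using Ck_on_has_derivative[OF N(3,2)] by simp
  from has_derivative_compose[OF y[unfolded has_vector_derivative_def] this]
  have 1: "((\<lambda>r. g (y r)) has_vector_derivative dirderiv f (y s) e) (at s within T)"
    using has_derivative_linear[OF g] dirderiv_extension[OF N(1,2) N(3) N(4) S]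
    by (simp add: has_vector_derivative_def linear_scale)
  have "(y \<longlongrightarrow> y s) (at s within T)"
    using has_vector_derivative_continuous[OF y] by (simp add: continuous_within)
  then have "\<forall>\<^sub>F r in at s within T. y r \<in> N"
    using N(1,2) by (simp add: tendsto_def)
  with ev(1) have "\<forall>\<^sub>F r in at s within T. g (y r) = f (y r)"
    by eventually_elim (simp add: N(4))
  from has_derivative_transform_eventually[OF 1[unfolded has_vector_derivative_def] this N(4)[OF S(2) N(2)] ev(2)]
  show ?thesis by (simp add: has_vector_derivative_def)
qed

section \<open>Smooth step functions\<close>

text \<open>The powers of 1/x are included because differentiating exp(-1/x) produces them: the
  linear span of these functions is closed under differentiation.\<close>

definition flat :: "nat \<Rightarrow> real \<Rightarrow> real" where
  "flat n x = (if x > 0 then exp (- (1 / x)) / x ^ n else 0)"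

lemma flat_tendsto_0: "(flat n \<longlongrightarrow> 0) (at 0)"
proof -
  have "((\<lambda>h. inverse h ^ n / exp (inverse h :: real)) \<longlongrightarrow> 0) (at_right 0)"
    by (rule filterlim_compose[OF tendsto_power_div_exp_0 filterlim_inverse_at_top_right])
  then have "(flat n \<longlongrightarrow> 0) (at_right 0)"
    by (rule Lim_transform_eventually)
      (auto simp: eventually_at_right_field flat_def exp_minus divide_simps intro!: exI[of _ 1])
  moreover have "(flat n \<longlongrightarrow> 0) (at_left 0)"
    by (rule Lim_transform_eventually[OF tendsto_const])
      (auto simp: eventually_at_left_field flat_def intro!: exI[of _ "-1"])
  ultimately show ?thesis by (simp add: filterlim_at_split)
qed

lemma flat_derivative:
  "(flat n has_real_derivative - real n * flat (Suc n) x + flat (Suc (Suc n)) x) (at x)"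
proof -
  consider "x > 0" | "x < 0" | "x = 0" by linarith
  then show ?thesis
  proof cases
    case 1
    have "((\<lambda>x. exp (- (1 / x)) / x ^ n) has_real_derivative - real n * flat (Suc n) x + flat (Suc (Suc n)) x) (at x)"
    proof -
      have num: "((\<lambda>x. exp (- (1 / x))) has_real_derivative exp (- (1 / x)) / x\<^sup>2) (at x)"
        using 1 by (auto intro!: derivative_eq_intros simp: power2_eq_square)
      have "(exp (- (1 / x)) / x\<^sup>2 * x ^ n - exp (- (1 / x)) * (real n * x ^ (n - Suc 0))) / (x ^ n * x ^ n)
          = - real n * flat (Suc n) x + flat (Suc (Suc n)) x"
        using 1 by (cases n) (simp_all add: flat_def field_simps power2_eq_square)
      with DERIV_divide[OF num DERIV_pow[of n x]] 1 show ?thesis by simp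
    qed
    then show ?thesis
      by (rule has_field_derivative_transform_within_open[where S = "{0<..}"]) (use 1 in \<open>auto simp: flat_def\<close>)
  next
    case 2
    have "((\<lambda>x. 0) has_real_derivative - real n * flat (Suc n) x + flat (Suc (Suc n)) x) (at x)"
      using 2 by (simp add: flat_def)
    then show ?thesis
      by (rule has_field_derivative_transform_within_open[where S = "{..<0}"]) (use 2 in \<open>auto simp: flat_def\<close>)
  next
    case 3
    \<comment> \<open>The difference quotient of \<open>flat n\<close> at 0 is
      \<open>flat (Suc n)\<close>, which tends to 0.\<close>
    have "((\<lambda>h. (flat n h - flat n 0) / (h - 0)) \<longlongrightarrow> 0) (at 0)"
      by (rule Lim_transform_eventually[OF flat_tendsto_0[of "Suc n"]])
        (auto simp: flat_def eventually_at_filter)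
    then show ?thesis
      using 3 by (simp add: has_field_derivative_iff flat_def)
  qed
qed

lemma Ck_on_flat: "Ck_on k UNIV (flat n)"
proof (induction k arbitrary: n)
  case 0
  then show ?case
    by (auto intro!: continuous_at_imp_continuous_on DERIV_isCont[OF flat_derivative])
next
  case (Suc k)
  show ?case
  proof (rule Ck_on_SucI[OF open_UNIV])
    show "(flat n has_derivative (\<lambda>v. (- real n * flat (Suc n) x + flat (Suc (Suc n)) x) * v)) (at x)" for x
      using flat_derivative unfolding has_field_derivative_def by blast
    show "Ck_on k UNIV (\<lambda>x. (- real n * flat (Suc n) x + flat (Suc (Suc n)) x) * v)" for v
      by (intro Ck_on_bilinear[OF bounded_bilinear_mult open_UNIV] Ck_on_add Suc Ck_on_const open_UNIV)
  qed
qed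

text \<open>The two summands of the denominator never vanish together, so this is a smooth
  transition from 0 on the left of 0 to 1 on the right of 1.\<close>

definition step :: "real \<Rightarrow> real" where
  "step x = flat 0 x / (flat 0 x + flat 0 (1 - x))"

lemma flat_nonneg: "flat n x \<ge> 0"
  by (simp add: flat_def)

lemma flat_pos: "x > 0 \<Longrightarrow> flat n x > 0"
  by (simp add: flat_def)

lemma step_denominator_pos: "flat 0 x + flat 0 (1 - x) > 0"
  using flat_nonneg[of 0 x] flat_nonneg[of 0 "1 - x"] flat_pos[of x 0] flat_pos[of "1 - x" 0]
  by (cases "x > 0") auto

lemma smooth_on_flat: "smooth_on S (flat n)"
  by (rule smooth_on_UNIV_imp) (rule Ck_on_flat)

lemma smooth_on_step: "smooth_on S step"
  unfolding step_def
proof (rule smooth_on_divide)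
  have 1: "smooth_on S (\<lambda>x. flat 0 (1 - x))"
    by (rule smooth_on_compose[where T = UNIV]) (auto intro!: smooth_on_flat smooth_on_intros)
  show "smooth_on S (\<lambda>x. flat 0 x + flat 0 (1 - x))"
    by (intro smooth_on_add smooth_on_flat 1)
  show "flat 0 x + flat 0 (1 - x) \<noteq> 0" for x
    using step_denominator_pos[of x] by simp
qed (rule smooth_on_flat)

lemma step_eq_0: "x \<le> 0 \<Longrightarrow> step x = 0"
  by (simp add: step_def flat_def)

lemma step_eq_1: "x \<ge> 1 \<Longrightarrow> step x = 1"
  by (simp add: step_def flat_def)

lemma step_bounds: "0 \<le> step x" "step x \<le> 1"
  using step_denominator_pos[of x] flat_nonneg[of 0 x] flat_nonneg[of 0 "1 - x"]
  by (simp_all add: step_def)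

section \<open>Smooth solutions of linear systems\<close>

text \<open>Gaussian elimination with coefficients that depend smoothly on a point. Unknowns and
  equations have separate index sets, because the pivot need not lie on the diagonal and each
  elimination step removes one unknown and one equation with different labels.\<close>

lemma smooth_linear_solve_local:
  fixes A :: "'i \<Rightarrow> 'j \<Rightarrow> 'x::euclidean_space \<Rightarrow> real"
  assumes "finite I" "finite J" "card I = card J" "x0 \<in> S"
    and "\<And>i j. i \<in> I \<Longrightarrow> j \<in> J \<Longrightarrow> smooth_on S (A i j)"
    and "\<And>j. j \<in> J \<Longrightarrow> smooth_on S (c j)"
    and "\<And>x a i. x \<in> S \<Longrightarrow> (\<And>j. j \<in> J \<Longrightarrow> (\<Sum>i\<in>I. a i * A i j x) = 0) \<Longrightarrow> i \<in> I \<Longrightarrow> a i = 0"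
  shows "\<exists>N a. open N \<and> x0 \<in> N \<and> (\<forall>i\<in>I. smooth_on (S \<inter> N) (a i)) \<and>
     (\<forall>x\<in>S \<inter> N. \<forall>j\<in>J. (\<Sum>i\<in>I. a i x * A i j x) = c j x)"
  using assms
proof (induction I arbitrary: J A c S rule: finite_induct)
  case empty
  then show ?case by (intro exI[of _ UNIV]) auto
next
  case (insert i0 I)
  note sm = insert.prems(4,5) and nondeg = insert.prems(6) and x0 = insert.prems(3)
  \<comment> \<open>If the unknown \<open>i0\<close> had only zero coefficients at
    \<open>x0\<close>, the unit vector at \<open>i0\<close> would lie in the kernel.\<close>
  have "\<exists>j0\<in>J. A i0 j0 x0 \<noteq> 0"
  proof (rule ccontr)
    assume neg: "\<not> (\<exists>j0\<in>J. A i0 j0 x0 \<noteq> 0)"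
    have "(\<Sum>i\<in>insert i0 I. (if i = i0 then 1 else 0) * A i j x0) = 0" if "j \<in> J" for j
      using neg that insert.hyps by (auto intro!: sum.neutral)
    then have "(if i0 = i0 then 1 else 0 :: real) = 0"
      by (rule nondeg[OF x0, of "\<lambda>i. if i = i0 then 1 else 0"]) auto
    then show False by simp
  qed
  then obtain j0 where j0: "j0 \<in> J" "A i0 j0 x0 \<noteq> 0" by blast
  let ?p = "A i0 j0"
  have "continuous_on S ?p"
    using sm(1)[of i0 j0] j0 smooth_on_imp_continuous_on by auto
  then obtain N1 where N1: "open N1" "N1 \<inter> S = ?p -` (- {0}) \<inter> S"
    using continuous_on_open_invariant[of S ?p] open_Compl[OF closed_singleton[of "0::real"]] by metis
  define S' where "S' = S \<inter> N1"
  have S': "S' \<subseteq> S" "x0 \<in> S'" "\<And>x. x \<in> S' \<Longrightarrow> ?p x \<noteq> 0"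
    using N1 x0 j0 by (auto simp: S'_def)
  have sm': "smooth_on S' (A i j)" if "i \<in> insert i0 I" "j \<in> J" for i j
    using smooth_on_subset[OF sm(1)[OF that] S'(1)] .
  have smc': "smooth_on S' (c j)" if "j \<in> J" for j
    using smooth_on_subset[OF sm(2)[OF that] S'(1)] .
  \<comment> \<open>The reduced system: a multiple of equation \<open>j0\<close> is subtracted from
    equation \<open>j\<close> so that the unknown \<open>i0\<close> cancels.\<close>
  define A' where "A' i j x = A i j x - A i j0 x * (A i0 j x / ?p x)" for i j x
  define c' where "c' j x = c j x - c j0 x * (A i0 j x / ?p x)" for j x
  have "\<exists>N a. open N \<and> x0 \<in> N \<and> (\<forall>i\<in>I. smooth_on (S' \<inter> N) (a i)) \<and>
     (\<forall>x\<in>S' \<inter> N. \<forall>j\<in>J - {j0}. (\<Sum>i\<in>I. a i x * A' i j x) = c' j x)"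
  proof (rule insert.IH)
    show "finite (J - {j0})" "card I = card (J - {j0})"
      using insert.prems insert.hyps j0 by auto
    show "smooth_on S' (A' i j)" if "i \<in> I" "j \<in> J - {j0}" for i j
      unfolding A'_def by (intro smooth_on_diff smooth_on_mult smooth_on_divide sm') (use that j0 S' in auto)
    show "smooth_on S' (c' j)" if "j \<in> J - {j0}" for j
      unfolding c'_def by (intro smooth_on_diff smooth_on_mult smooth_on_divide sm' smc') (use that j0 S' in auto)
    show "a i = 0" if x: "x \<in> S'" and z: "\<And>j. j \<in> J - {j0} \<Longrightarrow> (\<Sum>i\<in>I. a i * A' i j x) = 0" and i: "i \<in> I" for x a i
    proof -
      \<comment> \<open>A kernel vector of the reduced system extends to one of the full system,
        with the entry at \<open>i0\<close> determined by equation \<open>j0\<close>. So the reduced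
        system inherits injectivity.\<close>
      define b where "b = a (i0 := - (\<Sum>i\<in>I. a i * A i j0 x) / ?p x)"
      have b: "(\<Sum>i\<in>I. b i * A i j x) = (\<Sum>i\<in>I. a i * A i j x)" for j
        using insert.hyps by (intro sum.cong) (auto simp: b_def)
      have "(\<Sum>i\<in>insert i0 I. b i * A i j x) = 0" if j: "j \<in> J" for j
      proof (cases "j = j0")
        case True
        then show ?thesis using insert.hyps b[of j0] S'(3)[OF x] by (simp add: b_def)
      next
        case False
        have "(\<Sum>i\<in>I. a i * A' i j x) = (\<Sum>i\<in>I. a i * A i j x) - (\<Sum>i\<in>I. a i * A i j0 x) * (A i0 j x / ?p x)"
          by (simp add: A'_def algebra_simps sum_subtractf sum_distrib_left)
        with z[of j] False j show ?thesis
          using insert.hyps b[of j] by (simp add: b_def algebra_simps)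
      qed
      then have "b i = 0"
        using nondeg[of x b i] x S' i by auto
      then show ?thesis using i insert.hyps by (auto simp: b_def split: if_splits)
    qed
  qed (use S' in auto)
  then obtain N2 a where N2: "open N2" "x0 \<in> N2" "\<And>i. i \<in> I \<Longrightarrow> smooth_on (S' \<inter> N2) (a i)"
    and sol: "\<And>x j. x \<in> S' \<inter> N2 \<Longrightarrow> j \<in> J - {j0} \<Longrightarrow> (\<Sum>i\<in>I. a i x * A' i j x) = c' j x"
    by metis
  \<comment> \<open>Back substitution: equation \<open>j0\<close> is solved for the unknown
    \<open>i0\<close>, which is smooth where the pivot does not vanish.\<close>
  define b where "b = a (i0 := (\<lambda>x. (c j0 x - (\<Sum>i\<in>I. a i x * A i j0 x)) / ?p x))"
  have b: "(\<Sum>i\<in>I. b i x * A i j x) = (\<Sum>i\<in>I. a i x * A i j x)" for j x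
    using insert.hyps by (intro sum.cong) (auto simp: b_def)
  show ?case
  proof (intro exI[of _ "N1 \<inter> N2"] exI[of _ b] conjI ballI)
    show "x0 \<in> N1 \<inter> N2" "open (N1 \<inter> N2)" using N1 N2 S' by (auto simp: S'_def)
    have Seq: "S \<inter> (N1 \<inter> N2) = S' \<inter> N2" by (auto simp: S'_def)
    have sm2: "smooth_on (S' \<inter> N2) (A i j)" if "i \<in> insert i0 I" "j \<in> J" for i j
      using smooth_on_subset[OF sm'[OF that]] by auto
    have "smooth_on (S' \<inter> N2) (\<lambda>x. (c j0 x - (\<Sum>i\<in>I. a i x * A i j0 x)) / ?p x)"
      by (intro smooth_on_divide smooth_on_diff smooth_on_sum smooth_on_mult sm2 N2(3)
          smooth_on_subset[OF smc'[OF j0(1)]]) (use j0 S' in auto)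
    then show "smooth_on (S \<inter> (N1 \<inter> N2)) (b i)" if "i \<in> insert i0 I" for i
      using that N2(3) unfolding Seq b_def by auto
    fix x j assume x: "x \<in> S \<inter> (N1 \<inter> N2)" and j: "j \<in> J"
    have x': "x \<in> S' \<inter> N2" using x Seq by auto
    show "(\<Sum>i\<in>insert i0 I. b i x * A i j x) = c j x"
    proof (cases "j = j0")
      case True
      then show ?thesis using insert.hyps b[of x j0] S'(3)[of x] x' by (simp add: b_def)
    next
      case False
      have "(\<Sum>i\<in>I. a i x * A' i j x) = (\<Sum>i\<in>I. a i x * A i j x) - (\<Sum>i\<in>I. a i x * A i j0 x) * (A i0 j x / ?p x)"
        by (simp add: A'_def algebra_simps sum_subtractf sum_distrib_left)
      with sol[OF x', of j] False j show ?thesis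
        using insert.hyps b[of x j] by (simp add: b_def c'_def algebra_simps diff_divide_distrib)
    qed
  qed
qed

text \<open>Injectivity makes the solution at each point unique. A pointwise choice therefore
  coincides with every smooth local solution and inherits its smoothness.\<close>

lemma smooth_linear_solve:
  fixes A :: "'i \<Rightarrow> 'i \<Rightarrow> 'x::euclidean_space \<Rightarrow> real"
  assumes I: "finite I"
    and A: "\<And>i j. i \<in> I \<Longrightarrow> j \<in> I \<Longrightarrow> smooth_on S (A i j)"
    and c: "\<And>j. j \<in> I \<Longrightarrow> smooth_on S (c j)"
    and nondeg: "\<And>x a i. x \<in> S \<Longrightarrow> (\<And>j. j \<in> I \<Longrightarrow> (\<Sum>i\<in>I. a i * A i j x) = 0) \<Longrightarrow> i \<in> I \<Longrightarrow> a i = 0"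
  obtains a where "\<And>i. i \<in> I \<Longrightarrow> smooth_on S (a i)"
    and "\<And>x j. x \<in> S \<Longrightarrow> j \<in> I \<Longrightarrow> (\<Sum>i\<in>I. a i x * A i j x) = c j x"
proof -
  have loc: "\<exists>N a. open N \<and> x0 \<in> N \<and> (\<forall>i\<in>I. smooth_on (S \<inter> N) (a i)) \<and>
     (\<forall>x\<in>S \<inter> N. \<forall>j\<in>I. (\<Sum>i\<in>I. a i x * A i j x) = c j x)" if "x0 \<in> S" for x0
    by (rule smooth_linear_solve_local) (use assms that in auto)
  have uniq: "a i = b i" if "x \<in> S" "i \<in> I" "\<And>j. j \<in> I \<Longrightarrow> (\<Sum>i\<in>I. a i * A i j x) = c j x"
    "\<And>j. j \<in> I \<Longrightarrow> (\<Sum>i\<in>I. b i * A i j x) = c j x" for a b i x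
    using nondeg[of x "\<lambda>i. a i - b i" i] that by (simp add: algebra_simps sum_subtractf)
  define a where "a i x = (SOME b. \<forall>j\<in>I. (\<Sum>i\<in>I. b i * A i j x) = c j x) i" for i x
  have sol: "(\<Sum>i\<in>I. a i x * A i j x) = c j x" if x: "x \<in> S" and j: "j \<in> I" for x j
  proof -
    obtain N b where "x \<in> N" "\<forall>x\<in>S \<inter> N. \<forall>j\<in>I. (\<Sum>i\<in>I. b i x * A i j x) = c j x"
      using loc[OF x] by blast
    then have "\<exists>b. \<forall>j\<in>I. (\<Sum>i\<in>I. b i * A i j x) = c j x"
      using x by (intro exI[of _ "\<lambda>i. b i x"]) auto
    from someI_ex[OF this] show ?thesis
      using j by (simp add: a_def)
  qed
  have "smooth_on S (a i)" if i: "i \<in> I" for i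
  proof (rule smooth_on_local)
    fix x assume x: "x \<in> S"
    obtain N b where N: "open N" "x \<in> N" "\<forall>i\<in>I. smooth_on (S \<inter> N) (b i)"
      "\<forall>x\<in>S \<inter> N. \<forall>j\<in>I. (\<Sum>i\<in>I. b i x * A i j x) = c j x"
      using loc[OF x] by blast
    have "smooth_on (S \<inter> N) (a i)"
    proof (rule smooth_on_cong)
      show "smooth_on (S \<inter> N) (b i)" using N i by blast
      show "b i y = a i y" if "y \<in> S \<inter> N" for y
        by (rule uniq[of y i "\<lambda>i. b i y" "\<lambda>i. a i y"]) (use that N i sol in auto)
    qed
    then show "\<exists>N. open N \<and> x \<in> N \<and> smooth_on (S \<inter> N) (a i)"
      using N by blast
  qed
  with sol that show ?thesis by blast
qed

section \<open>Orthonormal bases and the Hadamard lemma\<close>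

definition orthonormal_basis :: "'e::euclidean_space set \<Rightarrow> 'e set \<Rightarrow> bool" where
  "orthonormal_basis E B \<longleftrightarrow> finite B \<and> B \<subseteq> E \<and> (\<forall>i\<in>B. \<forall>j\<in>B. i \<bullet> j = (if i = j then 1 else 0)) \<and>
     (\<forall>y\<in>E. y = (\<Sum>i\<in>B. (y \<bullet> i) *\<^sub>R i))"

lemma orthonormal_basis_exists:
  assumes "subspace E" obtains B where "orthonormal_basis E B"
proof -
  obtain B where B: "B \<subseteq> E" "pairwise orthogonal B" "\<And>x. x \<in> B \<Longrightarrow> norm x = 1"
    "independent B" "span B = E"
    using orthonormal_basis_subspace[OF assms] by metis
  have fin: "finite B" using B(4) independent_imp_finite by blast
  have ip: "i \<bullet> j = (if i = j then 1 else 0)" if "i \<in> B" "j \<in> B" for i j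
    using that B(2,3) by (auto simp: pairwise_def orthogonal_def norm_eq_1)
  have "y = (\<Sum>i\<in>B. (y \<bullet> i) *\<^sub>R i)" if y: "y \<in> E" for y
  proof -
    obtain c where c: "y = (\<Sum>i\<in>B. c i *\<^sub>R i)"
      using y B(5) span_finite[OF fin] by auto
    have "y \<bullet> j = c j" if j: "j \<in> B" for j
    proof -
      have "y \<bullet> j = (\<Sum>i\<in>B. if i = j then c i else 0)"
        unfolding c inner_sum_left by (intro sum.cong) (auto simp: ip j)
      also have "\<dots> = c j" using fin j by simp
      finally show ?thesis .
    qed
    then show ?thesis using c by simp
  qed
  with fin ip B(1) show ?thesis
    by (intro that) (auto simp: orthonormal_basis_def)
qed

text \<open>For an orthonormal basis of a subspace this is the orthogonal projection onto it.
  Composing with it turns a function on a relatively open subset of the subspace into one on an open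
  set.\<close>

definition onb_proj :: "'e::euclidean_space set \<Rightarrow> 'e \<Rightarrow> 'e" where
  "onb_proj B y = (\<Sum>i\<in>B. (y \<bullet> i) *\<^sub>R i)"

lemma bounded_linear_onb_proj: "bounded_linear (onb_proj B)"
  unfolding onb_proj_def
  by (intro bounded_linear_sum bounded_linear_scaleR_const bounded_linear_inner_left)

lemma onb_proj_in: "subspace E \<Longrightarrow> orthonormal_basis E B \<Longrightarrow> onb_proj B y \<in> E"
  unfolding onb_proj_def orthonormal_basis_def
  by (intro subspace_sum subspace_scale) auto

lemma onb_proj_id: "orthonormal_basis E B \<Longrightarrow> y \<in> E \<Longrightarrow> onb_proj B y = y"
  unfolding onb_proj_def orthonormal_basis_def by metis

text \<open>The fundamental theorem of calculus along the segment from \<open>y0\<close> to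
  \<open>y\<close>; \<open>g i\<close> is the average over the segment of the derivative of
  \<open>F\<close> in direction \<open>i\<close>. The increment is expanded in an arbitrary family
  \<open>B\<close>, so that a basis of a subspace can be inserted.\<close>

lemma hadamard_lemma:
  fixes F :: "'a::euclidean_space \<Rightarrow> real"
  assumes D: "open D" "convex D" "y0 \<in> D" and F: "\<And>k. Ck_on k D F"
  obtains g where "\<And>i. smooth_on D (g i)" "\<And>i. g i y0 = frechet_derivative F (at y0) i"
    "\<And>y B c. y \<in> D \<Longrightarrow> y - y0 = (\<Sum>i\<in>B. c i *\<^sub>R i) \<Longrightarrow> F y = F y0 + (\<Sum>i\<in>B. c i * g i y)"
proof
  \<comment> \<open>The trivial weight \<open>t ^ 0\<close> only brings the integral into the form
    of \<open>Ck_on_ray_integral\<close>.\<close>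
  define g where "g i y = integral {0..1} (\<lambda>t. t ^ 0 *\<^sub>R frechet_derivative F (at (y0 + t *\<^sub>R (y - y0))) i)" for i y
  have dF: "Ck_on k D (\<lambda>y. frechet_derivative F (at y) i)" for k i
    using F[of "Suc k"] by simp
  have ray: "y0 + t *\<^sub>R (y - y0) \<in> D" if "y \<in> D" "0 \<le> t" "t \<le> 1" for y t
    using convexD_alt[OF D(2,3) that(1), of t] that by (simp add: algebra_simps)
  show "smooth_on D (g i)" for i
    unfolding smooth_on_open_iff[OF D(1)] g_def
    using Ck_on_ray_integral[OF D dF] by blast
  show "g i y0 = frechet_derivative F (at y0) i" for i
    by (simp add: g_def)
  show "F y = F y0 + (\<Sum>i\<in>B. c i * g i y)" if y: "y \<in> D" and eq: "y - y0 = (\<Sum>i\<in>B. c i *\<^sub>R i)" for y B c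
  proof -
    have der: "((\<lambda>t. F (y0 + t *\<^sub>R (y - y0))) has_vector_derivative
        frechet_derivative F (at (y0 + t *\<^sub>R (y - y0))) (y - y0)) (at t within {0..1})" if "t \<in> {0..1}" for t
    proof -
      have 1: "(F has_derivative frechet_derivative F (at (y0 + t *\<^sub>R (y - y0)))) (at (y0 + t *\<^sub>R (y - y0)))"
        using Ck_on_has_derivative[OF F] ray[OF y] that by auto
      have "((\<lambda>t. F (y0 + t *\<^sub>R (y - y0))) has_derivative
          (\<lambda>s. frechet_derivative F (at (y0 + t *\<^sub>R (y - y0))) (s *\<^sub>R (y - y0)))) (at t within {0..1})"
        by (rule has_derivative_compose[where f = "\<lambda>t. y0 + t *\<^sub>R (y - y0)", OF _ 1])
          (auto intro!: derivative_eq_intros)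
      then show ?thesis
        using has_derivative_linear[OF 1] by (simp add: has_vector_derivative_def linear_scale)
    qed
    have cont: "continuous_on {0..1} (\<lambda>t. frechet_derivative F (at (y0 + t *\<^sub>R (y - y0))) i)" for i
      by (rule continuous_on_compose2[OF Ck_on_continuous_on[OF dF[of 0 i]]])
        (use ray[OF y] in \<open>auto intro!: continuous_intros\<close>)
    have lin: "frechet_derivative F (at (y0 + t *\<^sub>R (y - y0))) (y - y0)
        = (\<Sum>i\<in>B. c i * frechet_derivative F (at (y0 + t *\<^sub>R (y - y0))) i)" if "t \<in> {0..1}" for t
    proof -
      have l: "linear (frechet_derivative F (at (y0 + t *\<^sub>R (y - y0))))"
        by (rule has_derivative_linear[OF Ck_on_has_derivative[OF F]]) (use ray[OF y] that in auto)
      have "frechet_derivative F (at (y0 + t *\<^sub>R (y - y0))) (\<Sum>i\<in>B. c i *\<^sub>R i)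
        = (\<Sum>i\<in>B. c i * frechet_derivative F (at (y0 + t *\<^sub>R (y - y0))) i)"
        by (simp add: linear_sum[OF l] linear_scale[OF l])
      then show ?thesis by (simp add: eq)
    qed
    have "((\<lambda>t. frechet_derivative F (at (y0 + t *\<^sub>R (y - y0))) (y - y0)) has_integral
        F (y0 + 1 *\<^sub>R (y - y0)) - F (y0 + 0 *\<^sub>R (y - y0))) {0..1}"
      by (rule fundamental_theorem_of_calculus) (use der in auto)
    then have "F y - F y0 = integral {0..1} (\<lambda>t. frechet_derivative F (at (y0 + t *\<^sub>R (y - y0))) (y - y0))"
      by (simp add: integral_unique)
    also have "\<dots> = integral {0..1} (\<lambda>t. \<Sum>i\<in>B. c i * frechet_derivative F (at (y0 + t *\<^sub>R (y - y0))) i)"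
      by (rule integral_cong) (rule lin)
    also have "\<dots> = (\<Sum>i\<in>B. c i * g i y)"
    proof (cases "finite B")
      case True
      then show ?thesis
        by (subst integral_sum) (auto simp: g_def intro!: integrable_continuous_interval continuous_intros cont)
    qed simp
    finally show ?thesis by simp
  qed
qed

section \<open>Charts and smooth functions on manifolds\<close>

locale smooth_mfd =
  fixes M :: "('a, 'e::euclidean_space) mfd"
  assumes mfd: "smooth_manifold M"
begin

lemma subspace_model: "subspace (model M)"
  using mfd by (simp add: smooth_manifold_def)

lemma Hausdorff: "Hausdorff_space (mtop M)"
  using mfd by (simp add: smooth_manifold_def)

lemma atlas_maximal: "c \<in> atlas M \<Longrightarrow> c \<in> maximal_atlas M"
  using mfd unfolding smooth_manifold_def maximal_atlas_def by blast

lemma atlas_cover: "p \<in> points M \<Longrightarrow> \<exists>U \<phi>. (U, \<phi>) \<in> atlas M \<and> p \<in> U"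
proof -
  assume "p \<in> points M"
  then have "p \<in> \<Union> (fst ` atlas M)"
    using mfd unfolding smooth_manifold_def by blast
  then show ?thesis by auto
qed

lemma chart_open: "(U, \<phi>) \<in> maximal_atlas M \<Longrightarrow> openin (mtop M) U"
  by (auto simp: maximal_atlas_def is_chart_def)

lemma chart_subset: "(U, \<phi>) \<in> maximal_atlas M \<Longrightarrow> U \<subseteq> points M"
  using chart_open openin_subset by blast

lemma chart_image_open: "(U, \<phi>) \<in> maximal_atlas M \<Longrightarrow> openin (top_of_set (model M)) (\<phi> ` U)"
  by (auto simp: maximal_atlas_def is_chart_def)

lemma chart_image_model: "(U, \<phi>) \<in> maximal_atlas M \<Longrightarrow> q \<in> U \<Longrightarrow> \<phi> q \<in> model M"
  using openin_subset[OF chart_image_open] by auto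

lemma chart_homeomorphic:
  "(U, \<phi>) \<in> maximal_atlas M \<Longrightarrow> homeomorphic_map (subtopology (mtop M) U) (top_of_set (\<phi> ` U)) \<phi>"
  by (auto simp: maximal_atlas_def is_chart_def)

lemma chart_inj:
  assumes "(U, \<phi>) \<in> maximal_atlas M" shows "inj_on \<phi> U"
  using chart_homeomorphic[OF assms] chart_subset[OF assms]
  by (auto simp: homeomorphic_eq_everything_map Int_absorb1)

lemma chart_continuous:
  assumes "(U, \<phi>) \<in> maximal_atlas M"
  shows "continuous_map (subtopology (mtop M) U) euclidean \<phi>"
  using homeomorphic_imp_continuous_map[OF chart_homeomorphic[OF assms]] continuous_map_in_subtopology by blast

lemma chart_inv_continuous:
  assumes c: "(U, \<phi>) \<in> maximal_atlas M"
  shows "continuous_map (top_of_set (\<phi> ` U)) (mtop M) (inv_into U \<phi>)"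
proof -
  obtain g where g: "homeomorphic_maps (subtopology (mtop M) U) (top_of_set (\<phi> ` U)) \<phi> g"
    using chart_homeomorphic[OF c] homeomorphic_map_maps by blast
  have U: "topspace (subtopology (mtop M) U) = U"
    using chart_subset[OF c] by auto
  have "continuous_map (top_of_set (\<phi> ` U)) (mtop M) g"
    using g continuous_map_in_subtopology by (auto simp: homeomorphic_maps_def)
  then show ?thesis
  proof (rule continuous_map_eq)
    fix y assume "y \<in> topspace (top_of_set (\<phi> ` U))"
    then obtain q where q: "q \<in> U" "y = \<phi> q" by auto
    then have "g y = q" using g U by (auto simp: homeomorphic_maps_def)
    then show "g y = inv_into U \<phi> y" using q chart_inj[OF c] by simp
  qed
qed

lemma chart_inv: "(U, \<phi>) \<in> maximal_atlas M \<Longrightarrow> q \<in> U \<Longrightarrow> inv_into U \<phi> (\<phi> q) = q"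
  using chart_inj by simp

lemma chart_open_image:
  assumes c: "(U, \<phi>) \<in> maximal_atlas M" and W: "openin (mtop M) W" "W \<subseteq> U"
  shows "openin (top_of_set (model M)) (\<phi> ` W)"
proof -
  have "openin (subtopology (mtop M) U) W"
    using W openin_subset_topspace_eq openin_subtopology by fastforce
  then have "openin (top_of_set (\<phi> ` U)) (\<phi> ` W)"
    using homeomorphic_imp_open_map[OF chart_homeomorphic[OF c]] by (simp add: open_map_def)
  then show ?thesis
    using chart_image_open[OF c] openin_trans by blast
qed

lemma chart_open_preimage:
  assumes c: "(U, \<phi>) \<in> maximal_atlas M" and N: "open N"
  shows "openin (mtop M) {q\<in>U. \<phi> q \<in> N}"
proof -
  have "openin (subtopology (mtop M) U) {q \<in> topspace (subtopology (mtop M) U). \<phi> q \<in> N}"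
    using openin_continuous_map_preimage[OF chart_continuous[OF c], of N] N by simp
  then have "openin (mtop M) {q \<in> topspace (subtopology (mtop M) U). \<phi> q \<in> N}"
    using chart_open[OF c] openin_trans_full by blast
  moreover have "{q \<in> topspace (subtopology (mtop M) U). \<phi> q \<in> N} = {q\<in>U. \<phi> q \<in> N}"
    using chart_subset[OF c] by auto
  ultimately show ?thesis by simp
qed

text \<open>Locality of smoothness is phrased with open sets of the Euclidean type. This converts an
  open set \<open>V\<close> of the manifold into such a set, and one \<open>N\<close> serves for all
  subsets \<open>S\<close> of the chart domain.\<close>

lemma chart_nbhd:
  assumes c: "(U, \<phi>) \<in> maximal_atlas M" and V: "openin (mtop M) V"
  obtains N where "open N" "\<And>S. S \<subseteq> U \<Longrightarrow> \<phi> ` S \<inter> N = \<phi> ` (S \<inter> V)"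
proof -
  have "openin (top_of_set (model M)) (\<phi> ` (U \<inter> V))"
    using chart_open_image[OF c openin_Int[OF chart_open[OF c] V]] by simp
  then obtain N where N: "open N" "\<phi> ` (U \<inter> V) = model M \<inter> N"
    by (auto simp: openin_open)
  have "\<phi> ` S \<inter> N = \<phi> ` (S \<inter> V)" if S: "S \<subseteq> U" for S
  proof
    show "\<phi> ` S \<inter> N \<subseteq> \<phi> ` (S \<inter> V)"
    proof
      fix y assume "y \<in> \<phi> ` S \<inter> N"
      then obtain q where q: "q \<in> S" "y = \<phi> q" "\<phi> q \<in> N" by auto
      then have "\<phi> q \<in> \<phi> ` (U \<inter> V)"
        using N(2) S chart_image_model[OF c] by auto
      then have "q \<in> V"
        using chart_inj[OF c] q(1) S by (auto simp: inj_on_def)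
      with q show "y \<in> \<phi> ` (S \<inter> V)" by auto
    qed
    show "\<phi> ` (S \<inter> V) \<subseteq> \<phi> ` S \<inter> N"
      using N(2) S by blast
  qed
  with N(1) that show ?thesis by blast
qed

lemma open_along_chart:
  assumes "(U, \<phi>) \<in> maximal_atlas M" "openin (mtop M) W" "W \<subseteq> U" "e \<in> model M"
  shows "open_along (\<phi> ` W) e"
  using open_along_subspace[OF subspace_model chart_open_image[OF assms(1-3)] assms(4)] .

text \<open>Charts of the maximal atlas are by definition compatible with the atlas only, so near
  each point the transition is factored through an atlas chart.\<close>

lemma maximal_transition:
  assumes c: "(U, \<phi>) \<in> maximal_atlas M" and d: "(V, \<psi>) \<in> maximal_atlas M"
  shows "smooth_on (\<phi> ` (U \<inter> V)) (\<lambda>y. \<psi> (inv_into U \<phi> y))"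
proof (rule smooth_on_local)
  fix y assume "y \<in> \<phi> ` (U \<inter> V)"
  then obtain q where q: "q \<in> U" "q \<in> V" "y = \<phi> q" by auto
  then obtain T \<theta> where T: "(T, \<theta>) \<in> atlas M" "q \<in> T"
    using atlas_cover chart_subset[OF c] by blast
  note Tm = atlas_maximal[OF T(1)]
  obtain N where N: "open N" "\<And>S. S \<subseteq> U \<Longrightarrow> \<phi> ` S \<inter> N = \<phi> ` (S \<inter> T)"
    using chart_nbhd[OF c chart_open[OF Tm]] by blast
  have 1: "smooth_on (\<phi> ` (U \<inter> T)) (\<lambda>y. \<theta> (inv_into U \<phi> y))"
    using c T(1) by (auto simp: maximal_atlas_def smooth_transition_def o_def)
  have 2: "smooth_on (\<theta> ` (T \<inter> V)) (\<lambda>y. \<psi> (inv_into T \<theta> y))"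
    using d T(1) by (auto simp: maximal_atlas_def smooth_transition_def o_def)
  have "smooth_on (\<phi> ` (U \<inter> V \<inter> T)) (\<lambda>y. \<psi> (inv_into T \<theta> (\<theta> (inv_into U \<phi> y))))"
    by (rule smooth_on_compose[OF smooth_on_subset[OF 1] 2]) (use chart_inv[OF c] in auto)
  then have "smooth_on (\<phi> ` (U \<inter> V \<inter> T)) (\<lambda>y. \<psi> (inv_into U \<phi> y))"
    by (rule smooth_on_cong[rotated]) (use chart_inv[OF c] chart_inv[OF Tm] in auto)
  then have "smooth_on (\<phi> ` (U \<inter> V) \<inter> N) (\<lambda>y. \<psi> (inv_into U \<phi> y))"
    using N(2)[of "U \<inter> V"] by simp
  moreover have "y \<in> N"
    using N(2)[of U] q T by blast
  ultimately show "\<exists>N. open N \<and> y \<in> N \<and> smooth_on (\<phi> ` (U \<inter> V) \<inter> N) (\<lambda>y. \<psi> (inv_into U \<phi> y))"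
    using N(1) by blast
qed

lemma smooth_time_change_chart:
  assumes c: "(U, \<phi>) \<in> maximal_atlas M" and d: "(V, \<psi>) \<in> maximal_atlas M"
    and W: "W \<subseteq> U" "W \<subseteq> V"
    and H: "smooth_on (T \<times> \<phi> ` W) (\<lambda>(t, y). H t (inv_into U \<phi> y))"
  shows "smooth_on (T \<times> \<psi> ` W) (\<lambda>(t, y). H t (inv_into V \<psi> y))"
proof -
  have 1: "smooth_on (T \<times> \<psi> ` W) (\<lambda>z. (fst z, \<phi> (inv_into V \<psi> (snd z))))"
    by (intro smooth_on_Pair smooth_on_fst smooth_on_id
        smooth_on_compose[OF smooth_on_snd[OF smooth_on_id] maximal_transition[OF d c]])
      (use W in auto)
  have "smooth_on (T \<times> \<psi> ` W) (\<lambda>z. (\<lambda>(t, y). H t (inv_into U \<phi> y)) (fst z, \<phi> (inv_into V \<psi> (snd z))))"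
    by (rule smooth_on_compose[OF 1 H]) (use W chart_inv[OF d] in \<open>auto simp: subset_iff\<close>)
  then show ?thesis
    by (rule smooth_on_cong[rotated]) (use W chart_inv[OF d] chart_inv[OF c] in \<open>auto simp: subset_iff\<close>)
qed

text \<open>Smoothness may be tested near each point in whichever chart of the maximal atlas is
  convenient there.\<close>

lemma smooth_time_localI:
  fixes H :: "real \<Rightarrow> 'a \<Rightarrow> real"
  assumes d: "(V, \<psi>) \<in> maximal_atlas M"
    and loc: "\<And>p. p \<in> V \<Longrightarrow> \<exists>U \<phi> W. (U, \<phi>) \<in> maximal_atlas M \<and> openin (mtop M) W \<and> p \<in> W \<and> W \<subseteq> U \<and>
       smooth_on ({0..1} \<times> \<phi> ` W) (\<lambda>(t, y). H t (inv_into U \<phi> y))"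
  shows "smooth_on ({0..1} \<times> \<psi> ` V) (\<lambda>(t, y). H t (inv_into V \<psi> y))"
proof (rule smooth_on_local)
  fix z assume "z \<in> {0..1::real} \<times> \<psi> ` V"
  then obtain t p where z: "z = (t, \<psi> p)" "p \<in> V" "t \<in> {0..1}" by auto
  obtain U \<phi> W where U: "(U, \<phi>) \<in> maximal_atlas M" "openin (mtop M) W" "p \<in> W" "W \<subseteq> U"
    "smooth_on ({0..1} \<times> \<phi> ` W) (\<lambda>(t, y). H t (inv_into U \<phi> y))"
    using loc[OF z(2)] by blast
  obtain N where N: "open N" "\<And>S. S \<subseteq> V \<Longrightarrow> \<psi> ` S \<inter> N = \<psi> ` (S \<inter> W)"
    using chart_nbhd[OF d U(2)] by blast
  have "smooth_on ({0..1} \<times> \<psi> ` (V \<inter> W)) (\<lambda>(t, y). H t (inv_into V \<psi> y))"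
    by (rule smooth_time_change_chart[OF U(1) d]) (use U in \<open>auto intro: smooth_on_subset\<close>)
  moreover have "({0..1} \<times> \<psi> ` V) \<inter> (UNIV \<times> N) = {0..1::real} \<times> \<psi> ` (V \<inter> W)"
    using N(2)[of V] by auto
  moreover have "z \<in> UNIV \<times> N"
    using z U N(2)[of V] by blast
  ultimately show "\<exists>N. open N \<and> z \<in> N \<and> smooth_on ({0..1} \<times> \<psi> ` V \<inter> N) (\<lambda>(t, y). H t (inv_into V \<psi> y))"
    using open_Times[OF open_UNIV N(1)] by metis
qed

lemma smooth_time_funsI:
  assumes "\<And>p. p \<in> points M \<Longrightarrow> \<exists>U \<phi> W. (U, \<phi>) \<in> maximal_atlas M \<and> openin (mtop M) W \<and> p \<in> W \<and> W \<subseteq> U \<and>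
       smooth_on ({0..1} \<times> \<phi> ` W) (\<lambda>(t, y). H t (inv_into U \<phi> y))"
  shows "H \<in> smooth_time_funs M"
proof -
  have "smooth_on ({0..1} \<times> \<phi> ` U) (\<lambda>(t, y). H t (inv_into U \<phi> y))" if "(U, \<phi>) \<in> atlas M" for U \<phi>
    by (rule smooth_time_localI[OF atlas_maximal[OF that]])
      (use assms chart_subset[OF atlas_maximal[OF that]] in blast)
  then show ?thesis by (auto simp: smooth_time_funs_def)
qed

lemma smooth_time_funsD:
  assumes H: "H \<in> smooth_time_funs M" and c: "(U, \<phi>) \<in> maximal_atlas M"
  shows "smooth_on ({0..1} \<times> \<phi> ` U) (\<lambda>(t, y). H t (inv_into U \<phi> y))"
proof (rule smooth_time_localI[OF c])
  fix p assume "p \<in> U"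
  then obtain V \<psi> where V: "(V, \<psi>) \<in> atlas M" "p \<in> V"
    using atlas_cover chart_subset[OF c] by blast
  then show "\<exists>U \<phi> W. (U, \<phi>) \<in> maximal_atlas M \<and> openin (mtop M) W \<and> p \<in> W \<and> W \<subseteq> U \<and>
       smooth_on ({0..1} \<times> \<phi> ` W) (\<lambda>(t, y). H t (inv_into U \<phi> y))"
    using H chart_open[OF atlas_maximal[OF V(1)]]
    by (intro exI[of _ V] exI[of _ \<psi>]) (auto simp: smooth_time_funs_def atlas_maximal)
qed

lemma smooth_time_funs_at:
  assumes H: "H \<in> smooth_time_funs M" and t: "t \<in> {0..1}"
  shows "H t \<in> smooth_funs M"
proof -
  have "smooth_on (\<phi> ` U) (\<lambda>y. H t (inv_into U \<phi> y))" if c: "(U, \<phi>) \<in> atlas M" for U \<phi>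
  proof -
    have 1: "smooth_on (\<phi> ` U) (\<lambda>y. (t, y))"
      by (intro smooth_on_intros)
    from smooth_on_compose[OF 1 smooth_time_funsD[OF H atlas_maximal[OF c]]] t show ?thesis by auto
  qed
  then show ?thesis by (auto simp: smooth_funs_def o_def)
qed

text \<open>Regarding functions as constant in time lets the statements for time-dependent functions
  serve for both kinds.\<close>

lemma smooth_funs_time: "f \<in> smooth_funs M \<longleftrightarrow> (\<lambda>t. f) \<in> smooth_time_funs M"
proof
  assume f: "f \<in> smooth_funs M"
  have "smooth_on ({0..1} \<times> \<phi> ` U) (\<lambda>z. f (inv_into U \<phi> (snd z)))" if "(U, \<phi>) \<in> atlas M" for U \<phi>
  proof -
    have "smooth_on (\<phi> ` U) (\<lambda>y. f (inv_into U \<phi> y))"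
      using f that by (auto simp: smooth_funs_def o_def)
    then show ?thesis
      by (rule smooth_on_compose[OF smooth_on_snd[OF smooth_on_id]]) auto
  qed
  then show "(\<lambda>t. f) \<in> smooth_time_funs M"
    by (auto simp: smooth_time_funs_def case_prod_unfold)
next
  assume "(\<lambda>t. f) \<in> smooth_time_funs M"
  from smooth_time_funs_at[OF this, of 0] show "f \<in> smooth_funs M" by simp
qed

lemma smooth_funsD:
  assumes "f \<in> smooth_funs M" and c: "(U, \<phi>) \<in> maximal_atlas M"
  shows "smooth_on (\<phi> ` U) (f \<circ> inv_into U \<phi>)"
proof -
  have 1: "smooth_on (\<phi> ` U) (\<lambda>y. (0::real, y))"
    by (intro smooth_on_Pair smooth_on_const smooth_on_id)
  have "smooth_on ({0..1::real} \<times> \<phi> ` U) (\<lambda>z. f (inv_into U \<phi> (snd z)))"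
    using smooth_time_funsD[OF iffD1[OF smooth_funs_time assms(1)] c] by (simp add: case_prod_unfold)
  from smooth_on_compose[OF 1 this] show ?thesis
    by (auto simp: o_def)
qed

section \<open>The algebra of smooth functions and cutoffs\<close>

lemma smooth_time_funs_add:
  assumes "H \<in> smooth_time_funs M" "K \<in> smooth_time_funs M"
  shows "(\<lambda>t q. H t q + K t q) \<in> smooth_time_funs M"
proof -
  have "smooth_on ({0..1} \<times> \<phi> ` U) (\<lambda>(t, y). H t (inv_into U \<phi> y) + K t (inv_into U \<phi> y))"
    if "(U, \<phi>) \<in> atlas M" for U \<phi>
    using smooth_on_add[OF smooth_time_funsD[OF assms(1) atlas_maximal[OF that]]
        smooth_time_funsD[OF assms(2) atlas_maximal[OF that]]] by (simp add: case_prod_unfold)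
  then show ?thesis by (auto simp: smooth_time_funs_def)
qed

lemma smooth_time_funs_mult:
  assumes "H \<in> smooth_time_funs M" "K \<in> smooth_time_funs M"
  shows "(\<lambda>t q. H t q * K t q) \<in> smooth_time_funs M"
proof -
  have "smooth_on ({0..1} \<times> \<phi> ` U) (\<lambda>(t, y). H t (inv_into U \<phi> y) * K t (inv_into U \<phi> y))"
    if "(U, \<phi>) \<in> atlas M" for U \<phi>
    using smooth_on_mult[OF smooth_time_funsD[OF assms(1) atlas_maximal[OF that]]
        smooth_time_funsD[OF assms(2) atlas_maximal[OF that]]] by (simp add: case_prod_unfold)
  then show ?thesis by (auto simp: smooth_time_funs_def)
qed

lemma smooth_funs_const: "(\<lambda>q. c) \<in> smooth_funs M"
  unfolding smooth_funs_def by (auto simp: o_def intro: smooth_on_const)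

lemma smooth_funs_add: "f \<in> smooth_funs M \<Longrightarrow> g \<in> smooth_funs M \<Longrightarrow> (\<lambda>q. f q + g q) \<in> smooth_funs M"
  using smooth_time_funs_add[of "\<lambda>t. f" "\<lambda>t. g"] by (simp add: smooth_funs_time)

lemma smooth_funs_mult: "f \<in> smooth_funs M \<Longrightarrow> g \<in> smooth_funs M \<Longrightarrow> (\<lambda>q. f q * g q) \<in> smooth_funs M"
  using smooth_time_funs_mult[of "\<lambda>t. f" "\<lambda>t. g"] by (simp add: smooth_funs_time)

lemma smooth_funs_lincomb:
  "f \<in> smooth_funs M \<Longrightarrow> g \<in> smooth_funs M \<Longrightarrow> (\<lambda>q. a * f q + b * g q) \<in> smooth_funs M"
  by (intro smooth_funs_add smooth_funs_mult smooth_funs_const)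

lemma smooth_funs_sum:
  "(\<And>i. i \<in> I \<Longrightarrow> f i \<in> smooth_funs M) \<Longrightarrow> (\<lambda>q. \<Sum>i\<in>I. f i q) \<in> smooth_funs M"
  by (induction I rule: infinite_finite_induct) (auto intro: smooth_funs_const smooth_funs_add)

text \<open>The set \<open>C\<close> is the preimage under a chart of a compact ball, hence compact,
  and closed in M because M is Hausdorff. This is what makes extension by zero smooth: every point
  outside the chart has a neighbourhood disjoint from \<open>C\<close>.\<close>

lemma bump_exists:
  assumes W: "openin (mtop M) W" and p: "p \<in> W"
  obtains b W1 C where "b \<in> smooth_funs M" "openin (mtop M) W1" "p \<in> W1" "\<And>q. q \<in> W1 \<Longrightarrow> b q = 1"
    "closedin (mtop M) C" "C \<subseteq> W" "\<And>q. q \<notin> C \<Longrightarrow> b q = 0"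
proof -
  obtain U \<phi> where U: "(U, \<phi>) \<in> atlas M" "p \<in> U"
    using atlas_cover p openin_subset[OF W] by blast
  note c = atlas_maximal[OF U(1)]
  have "openin (top_of_set (model M)) (\<phi> ` (U \<inter> W))"
    using chart_open_image[OF c openin_Int[OF chart_open[OF c] W]] by simp
  then obtain N where N: "open N" "\<phi> ` (U \<inter> W) = model M \<inter> N"
    by (auto simp: openin_open)
  then have "\<phi> p \<in> N" using U p by blast
  then obtain d where d: "d > 0" "cball (\<phi> p) d \<subseteq> N"
    using open_contains_cball[of N] N(1) by blast
  define r where "r = d / 2"
  have r: "r > 0" "cball (\<phi> p) (2 * r) \<subseteq> N" and r2: "r\<^sup>2 > 0"
    using d by (auto simp: r_def)
  define K where "K = model M \<inter> cball (\<phi> p) (2 * r)"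
  define C where "C = inv_into U \<phi> ` K"
  have K: "K \<subseteq> \<phi> ` (U \<inter> W)" using r N by (auto simp: K_def)
  have "compact K"
    unfolding K_def by (intro closed_Int_compact closed_subspace subspace_model compact_cball)
  moreover have "K \<subseteq> \<phi> ` U" using K by blast
  ultimately have "compactin (top_of_set (\<phi> ` U)) K"
    by (simp add: compactin_subtopology)
  from image_compactin[OF this chart_inv_continuous[OF c]] have C: "closedin (mtop M) C"
    unfolding C_def by (rule compactin_imp_closedin[OF Hausdorff])
  have CW: "C \<subseteq> U \<inter> W"
    using K chart_inv[OF c] by (fastforce simp: C_def)
  \<comment> \<open>The argument of \<open>step\<close> is 2 - |y - \<phi> p|^2 / r^2. It is at
    least 1 within distance r of the centre and at most 0 beyond distance 2 * r, that is outside
    \<open>K\<close>. Squaring the norm keeps \<open>s\<close> smooth at the centre.\<close>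
  define s where "s y = step (2 - (y - \<phi> p) \<bullet> (y - \<phi> p) * inverse (r\<^sup>2))" for y
  define b where "b q = (if q \<in> U then s (\<phi> q) else 0)" for q
  have b0: "b q = 0" if "q \<notin> C" for q
  proof (cases "q \<in> U")
    case True
    have "\<phi> q \<notin> K" using that True chart_inv[OF c True] by (force simp: C_def)
    then have "2 * r < norm (\<phi> q - \<phi> p)"
      using chart_image_model[OF c True] by (auto simp: K_def dist_norm norm_minus_commute)
    then have "(2 * r)\<^sup>2 \<le> (norm (\<phi> q - \<phi> p))\<^sup>2"
      using r by (intro power_mono) auto
    then have "2 * r\<^sup>2 \<le> (\<phi> q - \<phi> p) \<bullet> (\<phi> q - \<phi> p)"
      by (simp add: power2_norm_eq_inner power_mult_distrib, use r2 in linarith)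
    then have "2 - (\<phi> q - \<phi> p) \<bullet> (\<phi> q - \<phi> p) * inverse (r\<^sup>2) \<le> 0"
      using r by (simp add: power2_norm_eq_inner field_simps)
    then show ?thesis using True by (simp add: b_def s_def step_eq_0)
  qed (simp add: b_def)
  have b1: "b q = 1" if "q \<in> U" "\<phi> q \<in> ball (\<phi> p) r" for q
  proof -
    have "norm (\<phi> q - \<phi> p) \<le> r"
      using that by (auto simp: dist_norm norm_minus_commute)
    then have "(norm (\<phi> q - \<phi> p))\<^sup>2 \<le> r\<^sup>2"
      by (intro power_mono) auto
    then have "2 - (\<phi> q - \<phi> p) \<bullet> (\<phi> q - \<phi> p) * inverse (r\<^sup>2) \<ge> 1"
      using r by (simp add: power2_norm_eq_inner field_simps)
    then show ?thesis using that by (simp add: b_def s_def step_eq_1)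
  qed
  have s: "smooth_on S s" for S
    unfolding s_def
    by (rule smooth_on_compose[OF _ smooth_on_step[of UNIV]]) (intro smooth_on_intros, simp)
  have "b \<in> smooth_funs M"
    proof (rule iffD2[OF smooth_funs_time], rule smooth_time_funsI)
    fix q assume q: "q \<in> points M"
    show "\<exists>U \<phi> W. (U, \<phi>) \<in> maximal_atlas M \<and> openin (mtop M) W \<and> q \<in> W \<and> W \<subseteq> U \<and>
       smooth_on ({0..1::real} \<times> \<phi> ` W) (\<lambda>(t, y). b (inv_into U \<phi> y))"
    proof (cases "q \<in> U")
      case True
      have "smooth_on ({0..1::real} \<times> \<phi> ` U) (\<lambda>(t, y). b (inv_into U \<phi> y))"
        by (rule smooth_on_cong[OF _ smooth_on_compose[OF smooth_on_snd[OF smooth_on_id] s[of UNIV]]])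
          (use chart_inv[OF c] in \<open>auto simp: b_def\<close>)
      then show ?thesis using True c chart_open[OF c]
        by (intro exI[of _ U] exI[of _ \<phi>]) simp
    next
      case False
      obtain V \<psi> where V: "(V, \<psi>) \<in> atlas M" "q \<in> V"
        using atlas_cover q by blast
      have op: "openin (mtop M) (V \<inter> (points M - C))"
        using chart_open[OF atlas_maximal[OF V(1)]] C by blast
      have "smooth_on ({0..1::real} \<times> \<psi> ` (V \<inter> (points M - C))) (\<lambda>(t, y). b (inv_into V \<psi> y))"
        by (rule smooth_on_cong[OF _ smooth_on_const[of _ 0]])
          (use chart_inv[OF atlas_maximal[OF V(1)]] in \<open>auto simp: b0\<close>)
      then show ?thesis using op V False CW q atlas_maximal[OF V(1)]
        by (intro exI[of _ V] exI[of _ \<psi>] exI[of _ "V \<inter> (points M - C)"]) auto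
    qed
  qed
  then show ?thesis
    by (rule that[OF _ chart_open_preimage[OF c open_ball[of "\<phi> p" r]] _ _ C])
      (use b0 b1 CW U r in auto)
qed

text \<open>Extension by zero: \<open>P\<close> is controlled only on \<open>W\<close>, and its
  values elsewhere are erased by \<open>b\<close>, which vanishes on the open complement of
  \<open>C\<close>.\<close>

lemma cutoff_smooth_time:
  assumes c: "(U, \<phi>) \<in> maximal_atlas M" and W: "openin (mtop M) W" "W \<subseteq> U"
    and C: "closedin (mtop M) C" "C \<subseteq> W"
    and b: "b \<in> smooth_funs M" "\<And>q. q \<notin> C \<Longrightarrow> b q = 0"
    and P: "smooth_on ({0..1} \<times> \<phi> ` W) (\<lambda>(t, y). P t (inv_into U \<phi> y))"
  shows "(\<lambda>t q. b q * P t q) \<in> smooth_time_funs M"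
proof (rule smooth_time_funsI)
  fix q assume q: "q \<in> points M"
  show "\<exists>U \<phi> W. (U, \<phi>) \<in> maximal_atlas M \<and> openin (mtop M) W \<and> q \<in> W \<and> W \<subseteq> U \<and>
       smooth_on ({0..1} \<times> \<phi> ` W) (\<lambda>(t, y). b (inv_into U \<phi> y) * P t (inv_into U \<phi> y))"
  proof (cases "q \<in> W")
    case True
    have "smooth_on ({0..1::real} \<times> \<phi> ` W) (\<lambda>(t, y). b (inv_into U \<phi> y))"
      by (rule smooth_on_subset[OF smooth_time_funsD[OF iffD1[OF smooth_funs_time b(1)] c]]) (use W in auto)
    from smooth_on_mult[OF this P] show ?thesis
      using True W c by (intro exI[of _ U] exI[of _ \<phi>] exI[of _ W]) (simp add: case_prod_unfold)
  next
    case False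
    obtain V \<psi> where V: "(V, \<psi>) \<in> atlas M" "q \<in> V"
      using atlas_cover q by blast
    have op: "openin (mtop M) (V \<inter> (points M - C))"
      using chart_open[OF atlas_maximal[OF V(1)]] C by blast
    have "smooth_on ({0..1} \<times> \<psi> ` (V \<inter> (points M - C))) (\<lambda>(t, y). b (inv_into V \<psi> y) * P t (inv_into V \<psi> y))"
      by (rule smooth_on_cong[OF _ smooth_on_const[of _ 0]])
        (use chart_inv[OF atlas_maximal[OF V(1)]] in \<open>auto simp: b\<close>)
    then show ?thesis using op V False C q atlas_maximal[OF V(1)]
      by (intro exI[of _ V] exI[of _ \<psi>] exI[of _ "V \<inter> (points M - C)"]) auto
  qed
qed

text \<open>Tangent vectors act on functions that are smooth on all of M. This supplies such
  functions for any family given in a chart, with one neighbourhood of agreement for the whole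
  family.\<close>

lemma chart_functions_extend:
  assumes c: "(U, \<phi>) \<in> maximal_atlas M" and W: "openin (mtop M) W" "W \<subseteq> U" and p: "p \<in> W"
    and g: "\<And>i. i \<in> I \<Longrightarrow> smooth_on (\<phi> ` W) (g i)"
  obtains G W1 where "\<And>i. i \<in> I \<Longrightarrow> G i \<in> smooth_funs M" "openin (mtop M) W1" "p \<in> W1" "W1 \<subseteq> W"
    "\<And>i q. q \<in> W1 \<Longrightarrow> G i q = g i (\<phi> q)"
proof -
  obtain b W1 C where b: "b \<in> smooth_funs M" "openin (mtop M) W1" "p \<in> W1" "\<And>q. q \<in> W1 \<Longrightarrow> b q = 1"
    "closedin (mtop M) C" "C \<subseteq> W" "\<And>q. q \<notin> C \<Longrightarrow> b q = 0"
    using bump_exists[OF W(1) p] by blast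
  have G: "(\<lambda>q. b q * g i (\<phi> q)) \<in> smooth_funs M" if "i \<in> I" for i
  proof -
    have "smooth_on ({0..1::real} \<times> \<phi> ` W) (\<lambda>z. g i (snd z))"
      by (rule smooth_on_compose[OF smooth_on_snd[OF smooth_on_id] g[OF that]]) auto
    then have "smooth_on ({0..1::real} \<times> \<phi> ` W) (\<lambda>(t, y). g i (\<phi> (inv_into U \<phi> y)))"
      by (rule smooth_on_cong[rotated]) (use chart_inv[OF c] W in \<open>auto simp: subset_iff\<close>)
    from cutoff_smooth_time[OF c W b(5,6,1,7) this] show ?thesis
      by (simp add: smooth_funs_time)
  qed
  show ?thesis
    by (rule that[of "\<lambda>i q. b q * g i (\<phi> q)" "W \<inter> W1"]) (use G b W p in auto)
qed

end

section \<open>Tangent vectors in charts\<close>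

text \<open>The tangent vector with coordinates \<open>e\<close> in the chart. The value 0 on other
  functions is the convention of \<open>tangent_space\<close>.\<close>

definition cvec :: "('a, 'e::euclidean_space) mfd \<Rightarrow> 'a set \<Rightarrow> ('a \<Rightarrow> 'e) \<Rightarrow> 'a \<Rightarrow> 'e \<Rightarrow> 'a tvec" where
  "cvec M U \<phi> p e = (\<lambda>f. if f \<in> smooth_funs M then dirderiv (f \<circ> inv_into U \<phi>) (\<phi> p) e else 0)"

context smooth_mfd
begin

lemma cvec_derivative:
  assumes c: "(U, \<phi>) \<in> maximal_atlas M" and p: "p \<in> U" and e: "e \<in> model M" and f: "f \<in> smooth_funs M"
  shows "((\<lambda>r. f (inv_into U \<phi> (\<phi> p + r *\<^sub>R e))) has_real_derivative cvec M U \<phi> p e f) (at 0)"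
proof -
  have "((\<lambda>r. (f \<circ> inv_into U \<phi>) (\<phi> p + r *\<^sub>R e)) has_real_derivative dirderiv (f \<circ> inv_into U \<phi>) (\<phi> p) e) (at 0)"
    by (rule has_real_derivative_dirderiv[OF smooth_funsD[OF f c] open_along_chart[OF c chart_open[OF c] _ e]])
      (use p in auto)
  then show ?thesis using f by (simp add: cvec_def)
qed

lemma cvec_eqI:
  assumes "f \<in> smooth_funs M" "((\<lambda>r. f (inv_into U \<phi> (\<phi> p + r *\<^sub>R e))) has_real_derivative D) (at 0)"
  shows "cvec M U \<phi> p e f = D"
  using assms dirderiv_eqI[of "f \<circ> inv_into U \<phi>" "\<phi> p" e D]
  by (simp add: cvec_def has_real_derivative_iff_has_vector_derivative)

lemma cvec_tangent:
  assumes c: "(U, \<phi>) \<in> maximal_atlas M" and p: "p \<in> U" and e: "e \<in> model M"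
  shows "cvec M U \<phi> p e \<in> tangent_space M p"
  unfolding tangent_space_def
proof (intro CollectI conjI ballI allI impI)
  fix f g and a b :: real assume f: "f \<in> smooth_funs M" and g: "g \<in> smooth_funs M"
  note df = cvec_derivative[OF c p e f] and dg = cvec_derivative[OF c p e g]
  show "cvec M U \<phi> p e (\<lambda>x. a * f x + b * g x) = a * cvec M U \<phi> p e f + b * cvec M U \<phi> p e g"
    by (rule cvec_eqI[OF smooth_funs_lincomb[OF f g]]) (auto intro!: derivative_eq_intros df dg)
  show "cvec M U \<phi> p e (\<lambda>x. f x * g x) = f p * cvec M U \<phi> p e g + g p * cvec M U \<phi> p e f"
  proof (rule cvec_eqI[OF smooth_funs_mult[OF f g]])
    show "((\<lambda>r. f (inv_into U \<phi> (\<phi> p + r *\<^sub>R e)) * g (inv_into U \<phi> (\<phi> p + r *\<^sub>R e))) has_real_derivative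
        f p * cvec M U \<phi> p e g + g p * cvec M U \<phi> p e f) (at 0)"
      using DERIV_mult[OF df dg] chart_inv[OF c p] by (simp add: algebra_simps)
  qed
qed (simp add: cvec_def)

lemma cvec_lincomb:
  assumes c: "(U, \<phi>) \<in> maximal_atlas M" and p: "p \<in> U" and e: "e \<in> model M" "e' \<in> model M"
  shows "cvec M U \<phi> p (a *\<^sub>R e + b *\<^sub>R e') = (\<lambda>f. a * cvec M U \<phi> p e f + b * cvec M U \<phi> p e' f)"
proof
  fix f
  have oa: "open_along (\<phi> ` U) e" if "e \<in> model M" for e
    using open_along_chart[OF c chart_open[OF c] subset_refl that] .
  have m: "a *\<^sub>R e + b *\<^sub>R e' \<in> model M"
    using subspace_model e by (simp add: subspace_add subspace_scale)
  show "cvec M U \<phi> p (a *\<^sub>R e + b *\<^sub>R e') f = a * cvec M U \<phi> p e f + b * cvec M U \<phi> p e' f"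
  proof (cases "f \<in> smooth_funs M")
    case True
    then show ?thesis
      using dirderiv_linear[OF smooth_funsD[OF True c] imageI[OF p] oa[OF e(1)] oa[OF e(2)] oa[OF m]]
      by (simp add: cvec_def)
  qed (simp add: cvec_def)
qed

lemma cvec_zero:
  assumes "(U, \<phi>) \<in> maximal_atlas M" "p \<in> U"
  shows "cvec M U \<phi> p 0 = (\<lambda>f. 0)"
  using cvec_lincomb[OF assms, of 0 0 0 0] subspace_0[OF subspace_model] by simp

lemma cvec_sum:
  assumes c: "(U, \<phi>) \<in> maximal_atlas M" and p: "p \<in> U" and B: "finite B" "B \<subseteq> model M"
  shows "cvec M U \<phi> p (\<Sum>i\<in>B. a i *\<^sub>R i) = (\<lambda>f. \<Sum>i\<in>B. a i * cvec M U \<phi> p i f)"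
  using B
proof (induction B rule: finite_induct)
  case empty
  then show ?case using cvec_zero[OF c p] by simp
next
  case (insert i B)
  have "(\<Sum>i\<in>B. a i *\<^sub>R i) \<in> model M"
    using insert.prems by (intro subspace_sum[OF subspace_model] subspace_scale[OF subspace_model]) auto
  then show ?case
    using cvec_lincomb[OF c p, of i "\<Sum>i\<in>B. a i *\<^sub>R i" "a i" 1] insert by simp
qed

lemma tangent_lincomb:
  assumes "u \<in> tangent_space M p" "v \<in> tangent_space M p"
  shows "(\<lambda>f. a * u f + b * v f) \<in> tangent_space M p"
  using assms unfolding tangent_space_def by (simp add: algebra_simps)

lemma tangent_lin:
  "v \<in> tangent_space M p \<Longrightarrow> f \<in> smooth_funs M \<Longrightarrow> g \<in> smooth_funs M \<Longrightarrow>
    v (\<lambda>x. a * f x + b * g x) = a * v f + b * v g"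
  unfolding tangent_space_def by blast

lemma tangent_add:
  assumes "v \<in> tangent_space M p" "f \<in> smooth_funs M" "g \<in> smooth_funs M"
  shows "v (\<lambda>x. f x + g x) = v f + v g"
  using tangent_lin[OF assms, of 1 1] by simp

lemma tangent_diff:
  assumes "v \<in> tangent_space M p" "f \<in> smooth_funs M" "g \<in> smooth_funs M"
  shows "v (\<lambda>x. f x - g x) = v f - v g"
  using tangent_lin[OF assms, of 1 "-1"] by simp

lemma tangent_mult:
  assumes "v \<in> tangent_space M p" "f \<in> smooth_funs M" "g \<in> smooth_funs M"
  shows "v (\<lambda>x. f x * g x) = f p * v g + g p * v f"
  using assms unfolding tangent_space_def by blast

lemma tangent_const:
  assumes "v \<in> tangent_space M p"
  shows "v (\<lambda>x. c) = 0"
proof -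
  have "v (\<lambda>x. 1 * 1) = 1 * v (\<lambda>x. 1) + 1 * v (\<lambda>x. 1)"
    using tangent_mult[OF assms smooth_funs_const[of 1] smooth_funs_const[of 1]] .
  then have 1: "v (\<lambda>x. 1) = 0" by simp
  show ?thesis
    using tangent_lin[OF assms smooth_funs_const[of 1] smooth_funs_const[of 1], of c 0] 1 by simp
qed

lemma tangent_sum:
  assumes v: "v \<in> tangent_space M p" and f: "\<And>i. i \<in> I \<Longrightarrow> f i \<in> smooth_funs M"
  shows "v (\<lambda>x. \<Sum>i\<in>I. f i x) = (\<Sum>i\<in>I. v (f i))"
  using f
proof (induction I rule: infinite_finite_induct)
  case (insert i I)
  then show ?case
    using tangent_add[OF v, of "f i" "\<lambda>x. \<Sum>i\<in>I. f i x"] smooth_funs_sum[of I f] by simp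
qed (auto simp: tangent_const[OF v])

text \<open>With a bump function \<open>b\<close> at p supported in \<open>W\<close>, the product (f
  - g) * b vanishes identically. The Leibniz rule at p, where f - g is 0 and b is 1, turns this into
  v (f - g) = 0.\<close>

lemma tangent_local:
  assumes v: "v \<in> tangent_space M p" and W: "openin (mtop M) W" "p \<in> W"
    and fg: "f \<in> smooth_funs M" "g \<in> smooth_funs M" and eq: "\<And>q. q \<in> W \<Longrightarrow> f q = g q"
  shows "v f = v g"
proof -
  obtain b W1 C where b: "b \<in> smooth_funs M" "p \<in> W1" "\<And>q. q \<in> W1 \<Longrightarrow> b q = 1"
    "C \<subseteq> W" "\<And>q. q \<notin> C \<Longrightarrow> b q = 0"
    using bump_exists[OF W] by metis
  have h: "(\<lambda>x. f x - g x) \<in> smooth_funs M"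
    using smooth_funs_lincomb[OF fg, of 1 "-1"] by simp
  have "(\<lambda>x. (f x - g x) * b x) = (\<lambda>x. 0)"
    using b eq by (auto simp: fun_eq_iff)
  then have "0 = (f p - g p) * v b + b p * v (\<lambda>x. f x - g x)"
    using tangent_mult[OF v h b(1)] tangent_const[OF v, of 0] by simp
  then show ?thesis
    using b(2,3) eq[OF W(2)] tangent_diff[OF v fg] by simp
qed

lemma cvec_chart_fun:
  assumes c: "(U, \<phi>) \<in> maximal_atlas M" and e: "e \<in> model M" and G: "G \<in> smooth_funs M"
    and W: "openin (mtop M) W" "p \<in> W" "W \<subseteq> U" and eq: "\<And>q. q \<in> W \<Longrightarrow> G q = g (\<phi> q)"
  shows "cvec M U \<phi> p e G = dirderiv g (\<phi> p) e"
proof -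
  have "\<forall>\<^sub>F r in nhds 0. \<phi> p + r *\<^sub>R e \<in> \<phi> ` W"
    using open_along_chart[OF c W(1,3) e] W(2) by (auto simp: open_along_def)
  then have "\<forall>\<^sub>F r in nhds 0. (G \<circ> inv_into U \<phi>) (\<phi> p + r *\<^sub>R e) = g (\<phi> p + r *\<^sub>R e)"
    by eventually_elim (use W(3) chart_inv[OF c] eq in \<open>auto simp: subset_iff\<close>)
  then show ?thesis
    using dirderiv_cong[of "G \<circ> inv_into U \<phi>" "\<phi> p" e g] G by (simp add: cvec_def)
qed

text \<open>The coordinates centred at \<open>p\<close>, made global by a cutoff. They recover the
  components of a coordinate vector, and they generate all functions near \<open>p\<close> in the
  sense of the Hadamard lemma.\<close>

lemma chart_coordinates:
  assumes c: "(U, \<phi>) \<in> maximal_atlas M" and p: "p \<in> U"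
  obtains X W where "\<And>i. X i \<in> smooth_funs M" "openin (mtop M) W" "p \<in> W" "W \<subseteq> U"
    "\<And>i q. q \<in> W \<Longrightarrow> X i q = (\<phi> q - \<phi> p) \<bullet> i"
    "\<And>i e. e \<in> model M \<Longrightarrow> cvec M U \<phi> p e (X i) = e \<bullet> i"
proof -
  have sm: "smooth_on (\<phi> ` U) (\<lambda>y. (y - \<phi> p) \<bullet> i)" for i
    by (intro smooth_on_inner smooth_on_diff smooth_on_id smooth_on_const)
  obtain X W where X: "\<And>i. X i \<in> smooth_funs M" "openin (mtop M) W" "p \<in> W" "W \<subseteq> U"
    "\<And>i q. q \<in> W \<Longrightarrow> X i q = (\<phi> q - \<phi> p) \<bullet> i"
    using chart_functions_extend[OF c chart_open[OF c] subset_refl p, of UNIV "\<lambda>i y. (y - \<phi> p) \<bullet> i"] sm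
    by (metis UNIV_I)
  have "cvec M U \<phi> p e (X i) = e \<bullet> i" if "e \<in> model M" for i e
  proof -
    have "cvec M U \<phi> p e (X i) = dirderiv (\<lambda>y. (y - \<phi> p) \<bullet> i) (\<phi> p) e"
      by (rule cvec_chart_fun[OF c that X(1-4)]) (rule X(5))
    also have "\<dots> = e \<bullet> i"
      by (rule dirderiv_eqI)
        (auto intro!: derivative_eq_intros simp: has_real_derivative_iff_has_vector_derivative[symmetric])
    finally show ?thesis .
  qed
  with X show ?thesis by (intro that[of X W]) auto
qed

lemma cvec_inj:
  assumes c: "(U, \<phi>) \<in> maximal_atlas M" and p: "p \<in> U" and e: "e \<in> model M" "e' \<in> model M"
    and eq: "cvec M U \<phi> p e = cvec M U \<phi> p e'"
  shows "e = e'"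
proof -
  obtain X where "\<And>i e. e \<in> model M \<Longrightarrow> cvec M U \<phi> p e (X i) = e \<bullet> i"
    using chart_coordinates[OF c p] by metis
  then have "e \<bullet> i = e' \<bullet> i" for i
    using e eq by metis
  then show ?thesis unfolding euclidean_eq_iff[of e e'] by blast
qed

text \<open>By the Hadamard lemma f equals f p + \<Sum> X i * G i near p, where X i vanishes at p
  and G i p is the derivative of f in direction i. The Leibniz rule leaves v f = \<Sum> v (X i) * G
  i p, so the coordinates of v can only be the numbers v (X i).\<close>

lemma tangent_eq_cvec:
  assumes c: "(U, \<phi>) \<in> maximal_atlas M" and p: "p \<in> U" and v: "v \<in> tangent_space M p"
  obtains e where "e \<in> model M" "v = cvec M U \<phi> p e"
proof -
  obtain B where B: "orthonormal_basis (model M) B"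
    using orthonormal_basis_exists[OF subspace_model] .
  then have Bf: "finite B" "B \<subseteq> model M"
    and Brep: "y \<in> model M \<Longrightarrow> y = (\<Sum>i\<in>B. (y \<bullet> i) *\<^sub>R i)" for y
    unfolding orthonormal_basis_def by blast+
  obtain X W2 where X: "\<And>i. X i \<in> smooth_funs M" "openin (mtop M) W2" "p \<in> W2" "W2 \<subseteq> U"
    "\<And>i q. q \<in> W2 \<Longrightarrow> X i q = (\<phi> q - \<phi> p) \<bullet> i"
    using chart_coordinates[OF c p] by metis
  define e where "e = (\<Sum>i\<in>B. v (X i) *\<^sub>R i)"
  have e: "e \<in> model M"
    unfolding e_def using Bf by (intro subspace_sum[OF subspace_model] subspace_scale[OF subspace_model]) auto
  have "v f = cvec M U \<phi> p e f" if f: "f \<in> smooth_funs M" for f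
  proof -
    let ?y0 = "\<phi> p" and ?P = "onb_proj B"
    obtain N where N: "open N" "\<phi> ` U = model M \<inter> N"
      using chart_image_open[OF c] by (auto simp: openin_open)
    then obtain R where R: "R > 0" "ball ?y0 R \<subseteq> N"
      using p open_contains_ball by (metis IntD2 imageI)
    \<comment> \<open>The chart image is open only in the model space. Composing with the projection
      \<open>?P\<close> extends the function to \<open>D\<close>, which is open and convex as the
      preimage of a ball under a linear map.\<close>
    define D where "D = ?P -` ball ?y0 R"
    define F where "F y = f (inv_into U \<phi> (?P y))" for y
    have y0: "?y0 \<in> model M" using chart_image_model[OF c p] .
    have D: "open D" "convex D" "?y0 \<in> D"
    proof -
      show "open D" unfolding D_def
        by (intro open_vimage open_ball linear_continuous_on bounded_linear_onb_proj)
      show "convex D" unfolding D_def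
        by (intro convex_linear_vimage convex_ball bounded_linear.linear bounded_linear_onb_proj)
      show "?y0 \<in> D" using R onb_proj_id[OF B y0] by (simp add: D_def)
    qed
    have PD: "?P y \<in> \<phi> ` U" if "y \<in> D" for y
      using that N R onb_proj_in[OF subspace_model B, of y] by (auto simp: D_def)
    have "smooth_on D F"
      unfolding F_def
      using smooth_on_compose[OF smooth_on_bounded_linear[OF bounded_linear_onb_proj] smooth_funsD[OF f c], of D B] PD
      by (simp add: o_def)
    then have F: "Ck_on k D F" for k
      using smooth_on_open_iff[OF D(1)] by blast
    obtain g where g: "\<And>i. smooth_on D (g i)" "\<And>i. g i ?y0 = frechet_derivative F (at ?y0) i"
      "\<And>y B c. y \<in> D \<Longrightarrow> y - ?y0 = (\<Sum>i\<in>B. c i *\<^sub>R i) \<Longrightarrow> F y = F ?y0 + (\<Sum>i\<in>B. c i * g i y)"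
      using that by (rule hadamard_lemma[OF D F])
    define W where "W = {q\<in>U. \<phi> q \<in> ball ?y0 R}"
    have W: "openin (mtop M) W" "W \<subseteq> U" "p \<in> W"
      using chart_open_preimage[OF c open_ball] p R by (auto simp: W_def)
    have WD: "\<phi> q \<in> D" if "q \<in> W" for q
      using that onb_proj_id[OF B chart_image_model[OF c, of q]] by (auto simp: W_def D_def)
    have gW: "smooth_on (\<phi> ` W) (g i)" for i
      by (rule smooth_on_subset[OF g(1)]) (use WD in auto)
    obtain G W1 where G: "\<And>i. i \<in> B \<Longrightarrow> G i \<in> smooth_funs M" "openin (mtop M) W1" "p \<in> W1" "W1 \<subseteq> W"
      "\<And>i q. q \<in> W1 \<Longrightarrow> G i q = g i (\<phi> q)"
      using gW that by (rule chart_functions_extend[OF c W, of B g])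
    define S where "S q = (\<Sum>i\<in>B. X i q * G i q)" for q
    have S: "S \<in> smooth_funs M"
      unfolding S_def using X(1) G(1) by (intro smooth_funs_sum smooth_funs_mult)
    have "v f = v (\<lambda>q. f p + S q)"
    proof (rule tangent_local[OF v openin_Int[OF X(2) G(2)] _ f smooth_funs_add[OF smooth_funs_const S]])
      show "p \<in> W2 \<inter> W1" using X G by auto
      fix q assume q: "q \<in> W2 \<inter> W1"
      have qU: "q \<in> U" "q \<in> W" using q G(4) W(2) by auto
      have m: "\<phi> q - ?y0 \<in> model M"
        using subspace_diff[OF subspace_model chart_image_model[OF c qU(1)] y0] .
      have "F (\<phi> q) = F ?y0 + (\<Sum>i\<in>B. ((\<phi> q - ?y0) \<bullet> i) * g i (\<phi> q))"
        by (rule g(3)[OF WD[OF qU(2)] Brep[OF m]])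
      moreover have "F (\<phi> q) = f q" "F ?y0 = f p"
        using onb_proj_id[OF B chart_image_model[OF c]] chart_inv[OF c] qU p by (auto simp: F_def)
      ultimately show "f q = f p + S q"
        using X(5) G(5) q by (simp add: S_def)
    qed
    also have "\<dots> = v S"
      using tangent_add[OF v smooth_funs_const S] tangent_const[OF v] by simp
    also have "\<dots> = (\<Sum>i\<in>B. v (\<lambda>q. X i q * G i q))"
      unfolding S_def using X(1) G(1) by (intro tangent_sum[OF v] smooth_funs_mult)
    also have "\<dots> = (\<Sum>i\<in>B. v (X i) * frechet_derivative F (at ?y0) i)"
      by (intro sum.cong refl) (use tangent_mult[OF v X(1) G(1)] X(3,5) G(3,5) g(2) in simp)
    also have "\<dots> = frechet_derivative F (at ?y0) e"
    proof -
      have l: "linear (frechet_derivative F (at ?y0))"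
        by (rule has_derivative_linear[OF Ck_on_has_derivative[OF F D(3)]])
      show ?thesis by (simp add: e_def linear_sum[OF l] linear_scale[OF l])
    qed
    also have "\<dots> = dirderiv (f \<circ> inv_into U \<phi>) ?y0 e"
      by (rule dirderiv_extension[OF D(1,3) F _ open_along_chart[OF c chart_open[OF c] subset_refl e], symmetric])
        (use p onb_proj_id[OF B chart_image_model[OF c]] in \<open>auto simp: F_def\<close>)
    finally show ?thesis using f by (simp add: cvec_def)
  qed
  moreover have "v f = cvec M U \<phi> p e f" if "f \<notin> smooth_funs M" for f
    using that v by (simp add: cvec_def tangent_space_def)
  ultimately have "v = cvec M U \<phi> p e" by blast
  with e that show ?thesis by blast
qed

text \<open>Turns an equation of derivations into an ordinary vector equation in the chart: near
  \<open>x s\<close> the curve in coordinates is a fixed linear combination of the global coordinate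
  functions along the curve, whose derivatives are known.\<close>

lemma curve_chart_derivative:
  assumes c: "(U, \<phi>) \<in> maximal_atlas M" and s: "s \<in> T" "x s \<in> U" and e: "e \<in> model M"
    and cont: "\<And>W. openin (mtop M) W \<Longrightarrow> x s \<in> W \<Longrightarrow> \<forall>\<^sub>F r in at s within T. x r \<in> W"
    and der: "\<And>f. f \<in> smooth_funs M \<Longrightarrow>
       ((\<lambda>r. f (x r)) has_real_derivative cvec M U \<phi> (x s) e f) (at s within T)"
  shows "((\<lambda>r. \<phi> (x r)) has_vector_derivative e) (at s within T)"
proof -
  obtain B where B: "orthonormal_basis (model M) B"
    using orthonormal_basis_exists[OF subspace_model] .
  then have Brep: "y \<in> model M \<Longrightarrow> y = (\<Sum>i\<in>B. (y \<bullet> i) *\<^sub>R i)" for y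
    unfolding orthonormal_basis_def by blast+
  obtain X W where X: "\<And>i. X i \<in> smooth_funs M" "openin (mtop M) W" "x s \<in> W" "W \<subseteq> U"
    "\<And>i q. q \<in> W \<Longrightarrow> X i q = (\<phi> q - \<phi> (x s)) \<bullet> i"
    "\<And>i e. e \<in> model M \<Longrightarrow> cvec M U \<phi> (x s) e (X i) = e \<bullet> i"
    using chart_coordinates[OF c s(2)] by metis
  have eq: "\<phi> (x s) + (\<Sum>i\<in>B. X i q *\<^sub>R i) = \<phi> q" if q: "q \<in> W" for q
  proof -
    have "\<phi> q - \<phi> (x s) \<in> model M"
      using subspace_diff[OF subspace_model chart_image_model[OF c] chart_image_model[OF c s(2)]] q X(4) by auto
    then have "\<phi> q - \<phi> (x s) = (\<Sum>i\<in>B. X i q *\<^sub>R i)"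
      unfolding X(5)[OF q] by (rule Brep)
    then show ?thesis by (simp add: algebra_simps)
  qed
  have "((\<lambda>r. \<phi> (x s) + (\<Sum>i\<in>B. X i (x r) *\<^sub>R i)) has_vector_derivative (0 + (\<Sum>i\<in>B. (e \<bullet> i) *\<^sub>R i))) (at s within T)"
  proof (intro has_vector_derivative_add has_vector_derivative_const has_vector_derivative_sum)
    fix i
    have "((\<lambda>r. X i (x r)) has_real_derivative e \<bullet> i) (at s within T)"
      using der[OF X(1)] X(6)[OF e] by simp
    from has_vector_derivative_scaleR[OF this has_vector_derivative_const[of i]]
    show "((\<lambda>r. X i (x r) *\<^sub>R i) has_vector_derivative (e \<bullet> i) *\<^sub>R i) (at s within T)" by simp
  qed
  then have 1: "((\<lambda>r. \<phi> (x s) + (\<Sum>i\<in>B. X i (x r) *\<^sub>R i)) has_vector_derivative e) (at s within T)"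
    using Brep[OF e] by simp
  have "\<forall>\<^sub>F r in at s within T. \<phi> (x s) + (\<Sum>i\<in>B. X i (x r) *\<^sub>R i) = \<phi> (x r)"
    using cont[OF X(2,3)] by eventually_elim (rule eq)
  from has_derivative_transform_eventually[OF 1[unfolded has_vector_derivative_def] this eq[OF X(3)] s(1)]
  show ?thesis by (simp add: has_vector_derivative_def)
qed

end

section \<open>Hamiltonian vector fields in charts\<close>

text \<open>Common ground for a symplectic manifold and a symplectic submanifold with the restricted
  form. Smoothness is required of the coefficients in atlas charts: for the restricted form they can
  be read off in slice charts, without extending vector fields from X to M.\<close>

locale form_mfd = smooth_mfd M for M :: "('a, 'e::euclidean_space) mfd" +
  fixes \<omega> :: "'a form2"
  assumes form_lin: "\<And>p u v w a b. \<lbrakk>p \<in> points M; u \<in> tangent_space M p; v \<in> tangent_space M p; w \<in> tangent_space M p\<rbrakk> \<Longrightarrow>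
      \<omega> p (\<lambda>f. a * u f + b * v f) w = a * \<omega> p u w + b * \<omega> p v w"
    and form_skew: "\<And>p v w. \<lbrakk>p \<in> points M; v \<in> tangent_space M p; w \<in> tangent_space M p\<rbrakk> \<Longrightarrow> \<omega> p v w = - \<omega> p w v"
    and nondeg: "nondegenerate M \<omega>"
    and form_coeff: "\<And>U \<phi> e e'. \<lbrakk>(U, \<phi>) \<in> atlas M; e \<in> model M; e' \<in> model M\<rbrakk> \<Longrightarrow>
      smooth_on (\<phi> ` U) (\<lambda>y. \<omega> (inv_into U \<phi> y) (cvec M U \<phi> (inv_into U \<phi> y) e) (cvec M U \<phi> (inv_into U \<phi> y) e'))"
begin

lemma sum_in_model:
  assumes "B \<subseteq> model M"
  shows "(\<Sum>i\<in>B. a i *\<^sub>R i) \<in> model M"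
  using assms by (intro subspace_sum[OF subspace_model] subspace_scale[OF subspace_model]) auto

lemma form_cvec_sum:
  assumes c: "(U, \<phi>) \<in> maximal_atlas M" and p: "p \<in> U" and B: "finite B" "B \<subseteq> model M"
    and w: "w \<in> tangent_space M p"
  shows "\<omega> p (cvec M U \<phi> p (\<Sum>i\<in>B. a i *\<^sub>R i)) w = (\<Sum>i\<in>B. a i * \<omega> p (cvec M U \<phi> p i) w)"
  using B
proof (induction B rule: finite_induct)
  case empty
  have pM: "p \<in> points M" using chart_subset[OF c] p by auto
  show ?case using form_lin[OF pM w w w, of 0 0] cvec_zero[OF c p] by simp
next
  case (insert i B)
  have pM: "p \<in> points M" using chart_subset[OF c] p by auto
  have m: "i \<in> model M" "(\<Sum>i\<in>B. a i *\<^sub>R i) \<in> model M"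
    using insert sum_in_model[of B] by auto
  have "cvec M U \<phi> p (\<Sum>i\<in>insert i B. a i *\<^sub>R i)
      = (\<lambda>f. a i * cvec M U \<phi> p i f + 1 * cvec M U \<phi> p (\<Sum>i\<in>B. a i *\<^sub>R i) f)"
    using cvec_lincomb[OF c p m, of "a i" 1] insert.hyps by simp
  then show ?case
    using form_lin[OF pM cvec_tangent[OF c p m(1)] cvec_tangent[OF c p m(2)] w, of "a i" 1] insert by simp
qed

lemma form_cvec_right:
  assumes c: "(U, \<phi>) \<in> maximal_atlas M" and p: "p \<in> U" and B: "orthonormal_basis (model M) B"
    and u: "u \<in> tangent_space M p" and e: "e \<in> model M"
  shows "\<omega> p u (cvec M U \<phi> p e) = (\<Sum>j\<in>B. (e \<bullet> j) * \<omega> p u (cvec M U \<phi> p j))"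
proof -
  have Bf: "finite B" "B \<subseteq> model M" and Brep: "e = (\<Sum>i\<in>B. (e \<bullet> i) *\<^sub>R i)"
    using B e unfolding orthonormal_basis_def by blast+
  have pM: "p \<in> points M" using chart_subset[OF c] p by auto
  have "\<omega> p u (cvec M U \<phi> p e) = - \<omega> p (cvec M U \<phi> p (\<Sum>j\<in>B. (e \<bullet> j) *\<^sub>R j)) u"
    using form_skew[OF pM u cvec_tangent[OF c p e]] Brep by simp
  also have "\<dots> = - (\<Sum>j\<in>B. (e \<bullet> j) * \<omega> p (cvec M U \<phi> p j) u)"
    by (subst form_cvec_sum[OF c p Bf u]) simp
  also have "\<dots> = (\<Sum>j\<in>B. (e \<bullet> j) * \<omega> p u (cvec M U \<phi> p j))"
    unfolding sum_negf[symmetric]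
  proof (intro sum.cong refl)
    fix j assume "j \<in> B"
    then have "\<omega> p (cvec M U \<phi> p j) u = - \<omega> p u (cvec M U \<phi> p j)"
      by (intro form_skew[OF pM cvec_tangent[OF c p] u]) (use Bf in auto)
    then show "- (e \<bullet> j * \<omega> p (cvec M U \<phi> p j) u) = e \<bullet> j * \<omega> p u (cvec M U \<phi> p j)" by simp
  qed
  finally show ?thesis .
qed

text \<open>The difference of two candidates pairs to zero with every tangent vector, so
  nondegeneracy justifies the definite description in \<open>ham_vf\<close>.\<close>

lemma ham_vf_eqI:
  assumes p: "p \<in> points M" and v: "v \<in> tangent_space M p"
    and eq: "\<And>w. w \<in> tangent_space M p \<Longrightarrow> \<omega> p v w = w (H t)"
  shows "ham_vf M \<omega> H t p = v"
  unfolding ham_vf_def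
proof (rule the_equality)
  show "v \<in> tangent_space M p \<and> (\<forall>w\<in>tangent_space M p. \<omega> p v w = w (H t))"
    using v eq by blast
  fix v' assume v': "v' \<in> tangent_space M p \<and> (\<forall>w\<in>tangent_space M p. \<omega> p v' w = w (H t))"
  have d: "(\<lambda>f. 1 * v' f + (-1) * v f) \<in> tangent_space M p"
    using v v' tangent_lincomb by blast
  have "\<omega> p (\<lambda>f. 1 * v' f + (-1) * v f) w = 0" if "w \<in> tangent_space M p" for w
    using form_lin[OF p _ v that, of v' 1 "-1"] v' eq[OF that] that by simp
  then have "(\<lambda>f. 1 * v' f + (-1) * v f) = (\<lambda>f. 0)"
    using nondeg p d unfolding nondegenerate_def by blast
  then show "v' = v" by (simp add: fun_eq_iff)
qed

text \<open>In coordinates, the equation that defines the Hamiltonian vector field is a linear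
  system whose matrix \<open>A\<close> consists of the coefficients of the form. Solving it smoothly
  in time and space yields existence and smoothness at once.\<close>

lemma ham_vf_chart:
  assumes a: "(U, \<phi>) \<in> atlas M" and H: "H \<in> smooth_time_funs M"
  obtains h where "smooth_on ({0..1} \<times> \<phi> ` U) h"
    "\<And>t y. t \<in> {0..1} \<Longrightarrow> y \<in> \<phi> ` U \<Longrightarrow> h (t, y) \<in> model M"
    "\<And>t q. t \<in> {0..1} \<Longrightarrow> q \<in> U \<Longrightarrow> ham_vf M \<omega> H t q = cvec M U \<phi> q (h (t, \<phi> q))"
    "\<And>t q w. t \<in> {0..1} \<Longrightarrow> q \<in> U \<Longrightarrow> w \<in> tangent_space M q \<Longrightarrow>
       \<omega> q (cvec M U \<phi> q (h (t, \<phi> q))) w = w (H t)"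
proof -
  note c = atlas_maximal[OF a]
  obtain B where B: "orthonormal_basis (model M) B"
    using orthonormal_basis_exists[OF subspace_model] .
  then have Bf: "finite B" "B \<subseteq> model M"
    and Brep: "y \<in> model M \<Longrightarrow> y = (\<Sum>i\<in>B. (y \<bullet> i) *\<^sub>R i)"
    and Bip: "i \<in> B \<Longrightarrow> j \<in> B \<Longrightarrow> i \<bullet> j = (if i = j then 1 else 0)" for y i j
    unfolding orthonormal_basis_def by blast+
  let ?S = "{0..1} \<times> \<phi> ` U"
  let ?v = "\<lambda>e y. cvec M U \<phi> (inv_into U \<phi> y) e"
  define A where "A i j z = \<omega> (inv_into U \<phi> (snd z)) (?v i (snd z)) (?v j (snd z))" for i j and z :: "real \<times> 'e"
  \<comment> \<open>The derivative is taken of the function of both variables in a purely spatial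
    direction, which makes the right-hand side jointly smooth up to the end points of time.\<close>
  define b where "b j z = dirderiv (\<lambda>(t, y). H t (inv_into U \<phi> y)) z (0, j)" for j and z :: "real \<times> 'e"
  have yU: "inv_into U \<phi> y \<in> U" "\<phi> (inv_into U \<phi> y) = y" if "y \<in> \<phi> ` U" for y
    using that by (auto simp: inv_into_into f_inv_into_f)
  have UM: "q \<in> U \<Longrightarrow> q \<in> points M" for q using chart_subset[OF c] by auto
  have smA: "smooth_on ?S (A i j)" if "i \<in> B" "j \<in> B" for i j
    unfolding A_def
    by (rule smooth_on_compose[OF smooth_on_snd[OF smooth_on_id] form_coeff[OF a]]) (use that Bf in auto)
  have smb: "smooth_on ?S (b j)" if "j \<in> B" for j
    unfolding b_def
    by (rule smooth_on_dirderiv[OF smooth_time_funsD[OF H c] open_along_Times[OF open_along_chart[OF c chart_open[OF c]]]])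
      (use that Bf in auto)
  have b_eq: "b j (t, y) = ?v j y (H t)" if "t \<in> {0..1}" "y \<in> \<phi> ` U" for j t y
    using that smooth_time_funs_at[OF H that(1)] yU[OF that(2)]
    by (simp add: b_def cvec_def dirderiv_def)
  have pair: "\<omega> q (cvec M U \<phi> q (\<Sum>i\<in>B. a i *\<^sub>R i)) (cvec M U \<phi> q e) =
      (\<Sum>j\<in>B. (e \<bullet> j) * (\<Sum>i\<in>B. a i * \<omega> q (cvec M U \<phi> q i) (cvec M U \<phi> q j)))"
    if q: "q \<in> U" and e: "e \<in> model M" for q e and a :: "'e \<Rightarrow> real"
  proof -
    have "\<omega> q (cvec M U \<phi> q (\<Sum>i\<in>B. a i *\<^sub>R i)) (cvec M U \<phi> q e) =
        (\<Sum>j\<in>B. (e \<bullet> j) * \<omega> q (cvec M U \<phi> q (\<Sum>i\<in>B. a i *\<^sub>R i)) (cvec M U \<phi> q j))"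
      by (rule form_cvec_right[OF c q B cvec_tangent[OF c q sum_in_model[OF Bf(2)]] e])
    also have "\<dots> = (\<Sum>j\<in>B. (e \<bullet> j) * (\<Sum>i\<in>B. a i * \<omega> q (cvec M U \<phi> q i) (cvec M U \<phi> q j)))"
      by (intro sum.cong refl arg_cong2[of _ _ _ _ "(*)"] form_cvec_sum[OF c q Bf cvec_tangent[OF c q]])
        (use Bf in auto)
    finally show ?thesis .
  qed
  \<comment> \<open>A kernel vector of the matrix is the coordinate vector of a tangent vector that
    pairs to zero with all coordinate vectors. These exhaust the tangent space, so nondegeneracy
    applies.\<close>
  have nd: "a i = 0" if z: "z \<in> ?S" and s: "\<And>j. j \<in> B \<Longrightarrow> (\<Sum>i\<in>B. a i * A i j z) = 0" and i: "i \<in> B" for z a i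
  proof -
    define q where "q = inv_into U \<phi> (snd z)"
    have q: "q \<in> U" using z yU by (auto simp: q_def)
    let ?e = "\<Sum>i\<in>B. a i *\<^sub>R i"
    have em: "?e \<in> model M" by (rule sum_in_model[OF Bf(2)])
    have "\<omega> q (cvec M U \<phi> q ?e) w = 0" if w: "w \<in> tangent_space M q" for w
    proof -
      obtain e where e: "e \<in> model M" "w = cvec M U \<phi> q e"
        using tangent_eq_cvec[OF c q w] by blast
      have "\<omega> q (cvec M U \<phi> q ?e) w = (\<Sum>j\<in>B. (e \<bullet> j) * (\<Sum>i\<in>B. a i * A i j z))"
        using pair[OF q e(1)] e(2) by (simp add: A_def q_def)
      then show ?thesis using s by simp
    qed
    then have "cvec M U \<phi> q ?e = (\<lambda>f. 0)"
      using nondeg UM[OF q] cvec_tangent[OF c q em] unfolding nondegenerate_def by blast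
    then have "?e = 0"
      using cvec_inj[OF c q em subspace_0[OF subspace_model]] cvec_zero[OF c q] by simp
    then have "0 = (\<Sum>j\<in>B. a j *\<^sub>R j) \<bullet> i" by simp
    also have "\<dots> = (\<Sum>j\<in>B. if j = i then a j else 0)"
      unfolding inner_sum_left by (intro sum.cong) (auto simp: Bip i)
    finally show ?thesis using Bf i by simp
  qed
  have "\<exists>k. (\<forall>i\<in>B. smooth_on ?S (k i)) \<and> (\<forall>z\<in>?S. \<forall>j\<in>B. (\<Sum>i\<in>B. k i z * A i j z) = b j z)"
  proof (rule smooth_linear_solve[of B ?S A b])
    show "a i = 0" if "z \<in> ?S" "\<And>j. j \<in> B \<Longrightarrow> (\<Sum>i\<in>B. a i * A i j z) = 0" "i \<in> B" for z a i
      using nd[of z a i] that by blast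
  qed (use Bf smA smb in blast)+
  then obtain k where k: "\<And>i. i \<in> B \<Longrightarrow> smooth_on ?S (k i)"
    "\<And>z j. z \<in> ?S \<Longrightarrow> j \<in> B \<Longrightarrow> (\<Sum>i\<in>B. k i z * A i j z) = b j z"
    by blast
  define h where "h z = (\<Sum>i\<in>B. k i z *\<^sub>R i)" for z
  have 1: "smooth_on ?S h"
    unfolding h_def by (intro smooth_on_sum smooth_on_scaleR smooth_on_const k(1))
  have 2: "h (t, y) \<in> model M" if "t \<in> {0..1}" "y \<in> \<phi> ` U" for t y
    unfolding h_def using Bf by (intro subspace_sum[OF subspace_model] subspace_scale[OF subspace_model]) auto
  have 4: "\<omega> q (cvec M U \<phi> q (h (t, \<phi> q))) w = w (H t)"
    if t: "t \<in> {0..1}" and q: "q \<in> U" and w: "w \<in> tangent_space M q" for t q w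
  proof -
    obtain e where e: "e \<in> model M" "w = cvec M U \<phi> q e"
      using tangent_eq_cvec[OF c q w] by blast
    have z: "(t, \<phi> q) \<in> ?S" using t q by auto
    have "\<omega> q (cvec M U \<phi> q (h (t, \<phi> q))) w = (\<Sum>j\<in>B. (e \<bullet> j) * (\<Sum>i\<in>B. k i (t, \<phi> q) * A i j (t, \<phi> q)))"
      using pair[OF q e(1)] e(2) chart_inv[OF c q] by (simp add: A_def h_def)
    also have "\<dots> = (\<Sum>j\<in>B. (e \<bullet> j) * cvec M U \<phi> q j (H t))"
      by (intro sum.cong refl) (use k(2)[OF z] b_eq[OF t imageI[OF q]] chart_inv[OF c q] in simp)
    also have "\<dots> = cvec M U \<phi> q (\<Sum>j\<in>B. (e \<bullet> j) *\<^sub>R j) (H t)"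
      using cvec_sum[OF c q Bf] by simp
    finally show ?thesis using Brep[OF e(1)] e(2) by simp
  qed
  have 3: "ham_vf M \<omega> H t q = cvec M U \<phi> q (h (t, \<phi> q))" if "t \<in> {0..1}" "q \<in> U" for t q
    by (rule ham_vf_eqI[OF UM cvec_tangent[OF c _ 2]]) (use that 4 in auto)
  from that[OF 1 2 3 4] show ?thesis by blast
qed

lemma ham_vf_works:
  assumes H: "H \<in> smooth_time_funs M" and t: "t \<in> {0..1}" and p: "p \<in> points M"
  shows "ham_vf M \<omega> H t p \<in> tangent_space M p"
    and "w \<in> tangent_space M p \<Longrightarrow> \<omega> p (ham_vf M \<omega> H t p) w = w (H t)"
proof -
  obtain U \<phi> where a: "(U, \<phi>) \<in> atlas M" and pU: "p \<in> U" using atlas_cover[OF p] by blast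
  obtain h where h: "smooth_on ({0..1} \<times> \<phi> ` U) h"
    "\<And>t y. t \<in> {0..1} \<Longrightarrow> y \<in> \<phi> ` U \<Longrightarrow> h (t, y) \<in> model M"
    "\<And>t q. t \<in> {0..1} \<Longrightarrow> q \<in> U \<Longrightarrow> ham_vf M \<omega> H t q = cvec M U \<phi> q (h (t, \<phi> q))"
    "\<And>t q w. t \<in> {0..1} \<Longrightarrow> q \<in> U \<Longrightarrow> w \<in> tangent_space M q \<Longrightarrow>
       \<omega> q (cvec M U \<phi> q (h (t, \<phi> q))) w = w (H t)"
    using that by (rule ham_vf_chart[OF a H])
  show "ham_vf M \<omega> H t p \<in> tangent_space M p"
    using h(2,3)[OF t] pU cvec_tangent[OF atlas_maximal[OF a] pU] by simp
  show "\<omega> p (ham_vf M \<omega> H t p) w = w (H t)" if "w \<in> tangent_space M p"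
    using h(3,4)[OF t pU] that by simp
qed

text \<open>Three independent times \<open>s\<close>, \<open>r\<close> and \<open>t\<close> are
  allowed, because time-changed Hamiltonians evaluate \<open>H\<close> and \<open>K\<close> at times
  other than that of \<open>G\<close>.\<close>

lemma ham_vf_lincomb:
  assumes H: "H \<in> smooth_time_funs M" "s \<in> {0..1}" and K: "K \<in> smooth_time_funs M" "r \<in> {0..1}"
    and p: "p \<in> points M" and G: "G t = (\<lambda>q. a * H s q + b * K r q)"
  shows "ham_vf M \<omega> G t p = (\<lambda>f. a * ham_vf M \<omega> H s p f + b * ham_vf M \<omega> K r p f)"
proof (rule ham_vf_eqI[OF p])
  note h = ham_vf_works[OF H p] and k = ham_vf_works[OF K p]
  show "(\<lambda>f. a * ham_vf M \<omega> H s p f + b * ham_vf M \<omega> K r p f) \<in> tangent_space M p"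
    by (rule tangent_lincomb[OF h(1) k(1)])
  fix w assume w: "w \<in> tangent_space M p"
  have "w (G t) = a * w (H s) + b * w (K r)"
    using w smooth_time_funs_at[OF H] smooth_time_funs_at[OF K] unfolding G tangent_space_def by blast
  then show "\<omega> p (\<lambda>f. a * ham_vf M \<omega> H s p f + b * ham_vf M \<omega> K r p f) w = w (G t)"
    using form_lin[OF p h(1) k(1) w] h(2)[OF w] k(2)[OF w] by simp
qed

end

text \<open>A smooth two-form is tested with vector fields on all of M, whereas coordinate fields
  exist only on the chart. Multiplied by a bump function they become global and stay unchanged near
  the given point.\<close>

lemma symplectic_form_coeff:
  assumes S: "symplectic_manifold M \<omega>" and c: "(U, \<phi>) \<in> maximal_atlas M" and e: "e \<in> model M" "e' \<in> model M"
  shows "smooth_on (\<phi> ` U) (\<lambda>y. \<omega> (inv_into U \<phi> y) (cvec M U \<phi> (inv_into U \<phi> y) e) (cvec M U \<phi> (inv_into U \<phi> y) e'))"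
proof (rule smooth_on_local)
  interpret smooth_mfd M using S by (simp add: smooth_mfd_def symplectic_manifold_def)
  fix y assume "y \<in> \<phi> ` U"
  then obtain p where p: "p \<in> U" "y = \<phi> p" by auto
  obtain b W C where b: "b \<in> smooth_funs M" "openin (mtop M) W" "p \<in> W" "\<And>q. q \<in> W \<Longrightarrow> b q = 1"
    "closedin (mtop M) C" "C \<subseteq> U" "\<And>q. q \<notin> C \<Longrightarrow> b q = 0"
    using bump_exists[OF chart_open[OF c] p(1)] by blast
  define V where "V e q = (\<lambda>f. b q * cvec M U \<phi> q e f)" for e q
  have V: "smooth_vector_field M (V e)" if e: "e \<in> model M" for e
    unfolding smooth_vector_field_def
  proof (intro conjI ballI)
    fix q assume q: "q \<in> points M"
    show "V e q \<in> tangent_space M q"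
    proof (cases "q \<in> U")
      case True
      then show ?thesis
        using tangent_lincomb[OF cvec_tangent[OF c True e] cvec_tangent[OF c True e], of "b q" 0] by (simp add: V_def)
    next
      case False
      then have "b q = 0" using b(6,7) by blast
      then have "V e q = (\<lambda>f. 0)" by (simp add: V_def)
      then show ?thesis by (simp add: tangent_space_def)
    qed
  next
    fix f assume f: "f \<in> smooth_funs M"
    have "smooth_on (\<phi> ` U) (\<lambda>y. dirderiv (f \<circ> inv_into U \<phi>) y e)"
      by (rule smooth_on_dirderiv[OF smooth_funsD[OF f c] open_along_chart[OF c chart_open[OF c] subset_refl e]])
    then have "smooth_on ({0..1::real} \<times> \<phi> ` U) (\<lambda>z. dirderiv (f \<circ> inv_into U \<phi>) (snd z) e)"
      by (rule smooth_on_compose[OF smooth_on_snd[OF smooth_on_id]]) auto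
    then have "smooth_on ({0..1::real} \<times> \<phi> ` U) (\<lambda>(t, y). cvec M U \<phi> (inv_into U \<phi> y) e f)"
      by (rule smooth_on_cong[rotated]) (use f chart_inv[OF c] in \<open>auto simp: cvec_def\<close>)
    from cutoff_smooth_time[OF c chart_open[OF c] subset_refl b(5,6,1,7) this]
    show "(\<lambda>q. V e q f) \<in> smooth_funs M"
      by (simp add: V_def smooth_funs_time)
  qed
  have "(\<lambda>q. \<omega> q (V e q) (V e' q)) \<in> smooth_funs M"
    using S V[OF e(1)] V[OF e(2)] unfolding symplectic_manifold_def smooth_two_form_def by blast
  from smooth_funsD[OF this c] have sm: "smooth_on (\<phi> ` U) ((\<lambda>q. \<omega> q (V e q) (V e' q)) \<circ> inv_into U \<phi>)" .
  obtain N where N: "open N" "\<And>S. S \<subseteq> U \<Longrightarrow> \<phi> ` S \<inter> N = \<phi> ` (S \<inter> W)"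
    using chart_nbhd[OF c b(2)] by blast
  have "smooth_on (\<phi> ` U \<inter> N) (\<lambda>y. \<omega> (inv_into U \<phi> y) (cvec M U \<phi> (inv_into U \<phi> y) e) (cvec M U \<phi> (inv_into U \<phi> y) e'))"
  proof (rule smooth_on_cong[OF _ smooth_on_subset[OF sm]])
    fix y assume "y \<in> \<phi> ` U \<inter> N"
    then obtain q where "q \<in> U" "q \<in> W" "y = \<phi> q" using N(2)[of U] by auto
    then show "((\<lambda>q. \<omega> q (V e q) (V e' q)) \<circ> inv_into U \<phi>) y =
        \<omega> (inv_into U \<phi> y) (cvec M U \<phi> (inv_into U \<phi> y) e) (cvec M U \<phi> (inv_into U \<phi> y) e')"
      using chart_inv[OF c] b(4) by (simp add: V_def)
  qed auto
  moreover have "y \<in> N" using N(2)[of U] p b(3) by blast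
  ultimately show "\<exists>N. open N \<and> y \<in> N \<and> smooth_on (\<phi> ` U \<inter> N)
      (\<lambda>y. \<omega> (inv_into U \<phi> y) (cvec M U \<phi> (inv_into U \<phi> y) e) (cvec M U \<phi> (inv_into U \<phi> y) e'))"
    using N(1) by blast
qed

lemma symplectic_form_mfd:
  assumes S: "symplectic_manifold M \<omega>"
  shows "form_mfd M \<omega>"
proof -
  interpret smooth_mfd M using S by (simp add: smooth_mfd_def symplectic_manifold_def)
  have 1: "smooth_two_form M \<omega>" "nondegenerate M \<omega>"
    using S by (auto simp: symplectic_manifold_def)
  show ?thesis
  proof unfold_locales
    show "nondegenerate M \<omega>" by fact
    fix p u v w and a b :: real
    assume "p \<in> points M" "u \<in> tangent_space M p" "v \<in> tangent_space M p" "w \<in> tangent_space M p"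
    then show "\<omega> p (\<lambda>f. a * u f + b * v f) w = a * \<omega> p u w + b * \<omega> p v w"
      using 1(1) unfolding smooth_two_form_def by blast
  next
    fix p v w
    assume "p \<in> points M" "v \<in> tangent_space M p" "w \<in> tangent_space M p"
    then show "\<omega> p v w = - \<omega> p w v"
      using 1(1) unfolding smooth_two_form_def by blast
  next
    fix U \<phi> e e'
    assume "(U, \<phi>) \<in> atlas M" "e \<in> model M" "e' \<in> model M"
    then show "smooth_on (\<phi> ` U) (\<lambda>y. \<omega> (inv_into U \<phi> y) (cvec M U \<phi> (inv_into U \<phi> y) e) (cvec M U \<phi> (inv_into U \<phi> y) e'))"
      using symplectic_form_coeff[OF S atlas_maximal] by blast
  qed
qed

section \<open>Uniqueness and continuity of Hamiltonian flows\<close>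

text \<open>The set \<open>S\<close> need not be convex, so the mean value inequality is applied to
  a local extension \<open>g\<close> on a compact ball around the point, where \<open>g\<close> and
  its derivative are bounded.\<close>

lemma smooth_on_local_Lipschitz:
  fixes h :: "real \<times> 'e::euclidean_space \<Rightarrow> 'e"
  assumes h: "smooth_on (T \<times> S) h" and z: "s0 \<in> T" "y0 \<in> S"
  obtains \<delta> R B L where "\<delta> > 0" "R > 0" "B \<ge> 0" "L \<ge> 0"
    "\<And>s y. s \<in> T \<Longrightarrow> \<bar>s - s0\<bar> \<le> \<delta> \<Longrightarrow> y \<in> S \<Longrightarrow> norm (y - y0) \<le> R \<Longrightarrow> norm (h (s, y)) \<le> B"
    "\<And>s y y'. s \<in> T \<Longrightarrow> \<bar>s - s0\<bar> \<le> \<delta> \<Longrightarrow> y \<in> S \<Longrightarrow> y' \<in> S \<Longrightarrow> norm (y - y0) \<le> R \<Longrightarrow>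
       norm (y' - y0) \<le> R \<Longrightarrow> norm (h (s, y) - h (s, y')) \<le> L * norm (y - y')"
proof -
  have "(s0, y0) \<in> T \<times> S" using z by simp
  then obtain N g where N: "open N" "(s0, y0) \<in> N" "\<And>k. Ck_on k N g" "\<And>z. z \<in> T \<times> S \<Longrightarrow> z \<in> N \<Longrightarrow> g z = h z"
    using smooth_onE[OF h] by blast
  obtain d where d: "d > 0" "cball (s0, y0) d \<subseteq> N"
    using N(1,2) open_contains_cball by blast
  let ?K = "cball (s0, y0) d"
  have inK: "(s, y) \<in> ?K" if "\<bar>s - s0\<bar> \<le> d / 2" "norm (y - y0) \<le> d / 2" for s y
  proof -
    have "norm (s0 - s, y0 - y) \<le> \<bar>s - s0\<bar> + norm (y - y0)"
      using norm_Pair_le[of "s0 - s" "y0 - y"] by (simp add: norm_minus_commute abs_minus_commute)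
    then have "norm (s0 - s, y0 - y) \<le> d" using that by linarith
    then show ?thesis by (simp add: dist_norm)
  qed
  have "continuous_on ?K g"
    using Ck_on_continuous_on[OF N(3)[of 0]] d(2) continuous_on_subset by blast
  then have "bounded (g ` ?K)"
    using compact_continuous_image compact_cball compact_imp_bounded by blast
  then obtain B where "\<forall>y\<in>g ` ?K. norm y \<le> B"
    unfolding bounded_iff by blast
  then have B: "norm (g z) \<le> B" if "z \<in> ?K" for z using that by blast
  let ?D = "\<lambda>z. frechet_derivative g (at z)"
  \<comment> \<open>Continuity of the derivative is known for each fixed direction only. The sum
    over \<open>Basis\<close> is continuous and bounds the operator norm.\<close>
  let ?M = "\<lambda>z. \<Sum>b\<in>Basis. norm (?D z b)"
  have der: "(g has_derivative ?D z) (at z)" if "z \<in> ?K" for z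
    using Ck_on_has_derivative[OF N(3)] that d(2) by blast
  have "continuous_on N (\<lambda>z. ?D z b)" for b
    using N(3)[of "Suc 0"] unfolding Ck_on.simps by blast
  then have "continuous_on ?K ?M"
    using d(2) by (intro continuous_on_sum continuous_on_norm) (meson continuous_on_subset)
  then have "bounded (?M ` ?K)"
    using compact_continuous_image compact_cball compact_imp_bounded by blast
  then obtain L where "\<forall>y\<in>?M ` ?K. norm y \<le> L"
    unfolding bounded_iff by blast
  then have L: "norm (?M z) \<le> L" if "z \<in> ?K" for z using that by blast
  have onorm: "onorm (?D z) \<le> L" if z: "z \<in> ?K" for z
  proof -
    have l: "linear (?D z)" using der[OF z] has_derivative_linear by blast
    have "norm (?D z v) \<le> ?M z * norm v" for v
    proof -
      have "?D z v = (\<Sum>b\<in>Basis. (v \<bullet> b) *\<^sub>R ?D z b)"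
        by (subst euclidean_representation[symmetric, of v]) (simp add: linear_sum[OF l] linear_scale[OF l])
      also have "norm \<dots> \<le> (\<Sum>b\<in>Basis. norm ((v \<bullet> b) *\<^sub>R ?D z b))" by (rule norm_sum)
      also have "\<dots> \<le> (\<Sum>b\<in>Basis. norm v * norm (?D z b))"
        by (intro sum_mono) (auto intro!: mult_right_mono Basis_le_norm)
      finally show ?thesis by (simp add: sum_distrib_left mult.commute)
    qed
    then have "onorm (?D z) \<le> ?M z"
      by (intro onorm_bound) (auto intro: sum_nonneg)
    then show ?thesis using L[OF z] by simp
  qed
  have zK: "(s0, y0) \<in> ?K" using d by simp
  have pos: "B \<ge> 0" "L \<ge> 0"
    using B[OF zK] L[OF zK] by (meson norm_ge_zero order_trans)+
  have bound: "norm (h (s, y)) \<le> B"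
    if "s \<in> T" "\<bar>s - s0\<bar> \<le> d / 2" "y \<in> S" "norm (y - y0) \<le> d / 2" for s y
    using B[OF inK[OF that(2,4)]] N(4)[of "(s, y)"] inK[OF that(2,4)] d(2) that by auto
  have lip: "norm (h (s, y) - h (s, y')) \<le> L * norm (y - y')"
    if "s \<in> T" "\<bar>s - s0\<bar> \<le> d / 2" "y \<in> S" "y' \<in> S" "norm (y - y0) \<le> d / 2" "norm (y' - y0) \<le> d / 2" for s y y'
  proof -
    have K: "(s, y) \<in> ?K" "(s, y') \<in> ?K" using inK that by auto
    have "norm (g (s, y) - g (s, y')) \<le> L * norm ((s, y) - (s, y'))"
      by (rule differentiable_bound[of ?K g ?D L]) (use der onorm K in \<open>auto intro: has_derivative_at_withinI\<close>)
    moreover have "g (s, y) = h (s, y)" "g (s, y') = h (s, y')"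
      using N(4) K d(2) that by auto
    ultimately show ?thesis by (simp add: norm_Pair)
  qed
  show ?thesis
    by (rule that[of "d / 2" "d / 2" B L]) (use d pos bound lip in auto)
qed

lemma curve_speed_bound:
  fixes y :: "real \<Rightarrow> 'e::real_normed_vector"
  assumes "convex J" "c \<in> J" "s \<in> J"
    and "\<And>r. r \<in> J \<Longrightarrow> (y has_vector_derivative v r) (at r within J)" "\<And>r. r \<in> J \<Longrightarrow> norm (v r) \<le> B"
  shows "norm (y s - y c) \<le> B * \<bar>s - c\<bar>"
proof -
  have "norm (y s - y c) \<le> B * norm (s - c)"
  proof (rule differentiable_bound[OF assms(1) _ _ assms(3,2)])
    show "(y has_derivative (\<lambda>r'. r' *\<^sub>R v r)) (at r within J)" if "r \<in> J" for r
      using assms(4)[OF that] by (simp add: has_vector_derivative_def)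
    show "onorm (\<lambda>r'. r' *\<^sub>R v r) \<le> B" if "r \<in> J" for r
    proof (rule onorm_le)
      show "norm (r' *\<^sub>R v r) \<le> B * norm r'" for r'
        using mult_left_mono[OF assms(5)[OF that], of "\<bar>r'\<bar>"] by (simp add: mult.commute)
    qed
  qed
  then show ?thesis by simp
qed

text \<open>A substitute for the Gronwall inequality over short times. At a point m where the
  distance |u| is maximal, its growth from c to m is at most L * |m - c| * |u m|, hence at most half
  of |u m|, which leaves |u m| bounded by 2 * |u c|.\<close>

lemma curves_stay_close:
  fixes y1 y2 :: "real \<Rightarrow> 'e::real_normed_vector"
  assumes J: "convex J" "compact J" "c \<in> J" "s \<in> J"
    and d1: "\<And>r. r \<in> J \<Longrightarrow> (y1 has_vector_derivative v1 r) (at r within J)"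
    and d2: "\<And>r. r \<in> J \<Longrightarrow> (y2 has_vector_derivative v2 r) (at r within J)"
    and lip: "\<And>r. r \<in> J \<Longrightarrow> norm (v1 r - v2 r) \<le> L * norm (y1 r - y2 r)"
    and L: "L \<ge> 0" "\<And>r. r \<in> J \<Longrightarrow> L * \<bar>r - c\<bar> \<le> 1 / 2"
  shows "norm (y1 s - y2 s) \<le> 2 * norm (y1 c - y2 c)"
proof -
  define u where "u r = y1 r - y2 r" for r
  have du: "(u has_vector_derivative v1 r - v2 r) (at r within J)" if "r \<in> J" for r
    unfolding u_def using d1[OF that] d2[OF that] by (rule has_vector_derivative_diff)
  have "continuous_on J u"
    using du has_vector_derivative_continuous continuous_on_eq_continuous_within by blast
  then have "continuous_on J (\<lambda>r. norm (u r))" by (rule continuous_on_norm)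
  then obtain m where m: "m \<in> J" "\<And>r. r \<in> J \<Longrightarrow> norm (u r) \<le> norm (u m)"
    using continuous_attains_sup[OF J(2)] J(3) by (metis empty_iff)
  have "norm (u m - u c) \<le> (L * norm (u m)) * \<bar>m - c\<bar>"
  proof (rule curve_speed_bound[where y = u and v = "\<lambda>r. v1 r - v2 r", OF J(1,3) m(1)])
    show "(u has_vector_derivative v1 r - v2 r) (at r within J)" if "r \<in> J" for r
      by (rule du[OF that])
    fix r assume r: "r \<in> J"
    have "norm (v1 r - v2 r) \<le> L * norm (u r)" using lip[OF r] by (simp add: u_def)
    also have "\<dots> \<le> L * norm (u m)" using m(2)[OF r] L(1) by (rule mult_left_mono)
    finally show "norm (v1 r - v2 r) \<le> L * norm (u m)" .
  qed
  also have "\<dots> = (L * \<bar>m - c\<bar>) * norm (u m)" by simp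
  also have "\<dots> \<le> (1 / 2) * norm (u m)" by (rule mult_right_mono[OF L(2)[OF m(1)]]) simp
  finally have "norm (u m) \<le> 2 * norm (u c)"
    using norm_triangle_ineq2[of "u m" "u c"] by linarith
  with m(2)[OF J(4)] show ?thesis by (simp add: u_def)
qed

section \<open>Elementary properties of trajectories\<close>

lemma solution_restrict:
  assumes "solution M V t x" "s \<le> t"
  shows "solution M V s x"
proof -
  have sub: "{0..s} \<subseteq> {0..t}" using assms(2) by auto
  have "continuous_map (top_of_set {0..s}) (mtop M) x"
    using assms(1) sub continuous_map_from_subtopology_mono unfolding solution_def smooth_curve_def by blast
  moreover have "smooth_on {r\<in>{0..s}. x r \<in> U} (\<phi> \<circ> x)" if "(U, \<phi>) \<in> atlas M" for U \<phi>
  proof (rule smooth_on_subset)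
    show "smooth_on {r\<in>{0..t}. x r \<in> U} (\<phi> \<circ> x)"
      using assms(1) that unfolding solution_def smooth_curve_def by blast
  qed (use sub in auto)
  moreover have "((\<lambda>r. f (x r)) has_real_derivative V r (x r) f) (at r within {0..s})"
    if "r \<in> {0..s}" "f \<in> smooth_funs M" for r f
  proof (rule has_field_derivative_subset[OF _ sub])
    show "((\<lambda>r. f (x r)) has_real_derivative V r (x r) f) (at r within {0..t})"
      using assms(1) that sub unfolding solution_def by blast
  qed
  ultimately show ?thesis unfolding solution_def smooth_curve_def by blast
qed

lemma solution_continuous: "solution M V t x \<Longrightarrow> continuous_map (top_of_set {0..t}) (mtop M) x"
  by (simp add: solution_def smooth_curve_def)

lemma solution_in_points:
  assumes "solution M V t x" "s \<in> {0..t}" shows "x s \<in> points M"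
  using continuous_map_image_subset_topspace[OF solution_continuous[OF assms(1)]] assms(2) by auto

lemma continuous_curve_open:
  assumes "continuous_map (top_of_set T) Y x" "openin Y W"
  shows "openin (top_of_set T) {r\<in>T. x r \<in> W}"
  using openin_continuous_map_preimage[OF assms] by simp

lemma continuous_curve_eventually:
  assumes x: "continuous_map (top_of_set T) Y x" and W: "openin Y W" "x s \<in> W" and s: "s \<in> T"
  shows "\<forall>\<^sub>F r in at s within T. x r \<in> W"
proof -
  obtain N where N: "open N" "{r\<in>T. x r \<in> W} = T \<inter> N"
    using continuous_curve_open[OF x W(1)] by (auto simp: openin_open)
  then show ?thesis
    unfolding eventually_at_topological using W(2) s by (intro exI[of _ N]) blast
qed

context form_mfd
begin

lemma solution_chart_derivative:
  assumes a: "(U, \<phi>) \<in> atlas M" and sol: "solution M (ham_vf M \<omega> H) t x" and t: "t \<le> 1"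
    and s: "s \<in> {0..t}" "x s \<in> U"
    and h: "\<And>t y. t \<in> {0..1} \<Longrightarrow> y \<in> \<phi> ` U \<Longrightarrow> h (t, y) \<in> model M"
      "\<And>t q. t \<in> {0..1} \<Longrightarrow> q \<in> U \<Longrightarrow> ham_vf M \<omega> H t q = cvec M U \<phi> q (h (t, \<phi> q))"
  shows "((\<lambda>r. \<phi> (x r)) has_vector_derivative h (s, \<phi> (x s))) (at s within {0..t})"
proof (rule curve_chart_derivative[where x = x and s = s, OF atlas_maximal[OF a] s])
  have s1: "s \<in> {0..1}" using s t by auto
  show "h (s, \<phi> (x s)) \<in> model M" using h(1) s1 s(2) by blast
  show "\<forall>\<^sub>F r in at s within {0..t}. x r \<in> W" if "openin (mtop M) W" "x s \<in> W" for W
    by (rule continuous_curve_eventually[OF solution_continuous[OF sol] that s(1)])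
  show "((\<lambda>r. f (x r)) has_real_derivative cvec M U \<phi> (x s) (h (s, \<phi> (x s))) f) (at s within {0..t})"
    if "f \<in> smooth_funs M" for f
    using sol s that h(2)[OF s1 s(2)] unfolding solution_def by metis
qed

text \<open>Suppose the trajectory leaves the open ball, and consider the first exit after
  \<open>c\<close>, in either direction of time. Until then it lies in the ball, and by continuity
  it still lies in the closed ball inside the chart at the exit. The speed bound applies up to that
  moment and shows that the distance travelled is less than R / 2, too little for an exit.\<close>

lemma solution_confined:
  assumes a: "(U, \<phi>) \<in> atlas M" and p: "p \<in> U" and ball: "cball (\<phi> p) R \<inter> model M \<subseteq> \<phi> ` U"
    and sol: "solution M (ham_vf M \<omega> H) t x" and t: "t \<le> 1"
    and c: "c \<in> {0..t}" "s \<in> {0..t}" "x c \<in> U" "norm (\<phi> (x c) - \<phi> p) \<le> R / 2"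
    and R: "R > 0" and B: "B \<ge> 0" "B * \<bar>s - c\<bar> < R / 2"
    and h: "\<And>t y. t \<in> {0..1} \<Longrightarrow> y \<in> \<phi> ` U \<Longrightarrow> h (t, y) \<in> model M"
      "\<And>t q. t \<in> {0..1} \<Longrightarrow> q \<in> U \<Longrightarrow> ham_vf M \<omega> H t q = cvec M U \<phi> q (h (t, \<phi> q))"
      "\<And>r y. r \<in> closed_segment c s \<Longrightarrow> y \<in> \<phi> ` U \<Longrightarrow> norm (y - \<phi> p) \<le> R \<Longrightarrow> norm (h (r, y)) \<le> B"
  shows "x s \<in> U \<and> norm (\<phi> (x s) - \<phi> p) \<le> R"
proof (rule ccontr)
  note ch = atlas_maximal[OF a]
  define O' where "O' = {q\<in>U. \<phi> q \<in> ball (\<phi> p) R}"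
  define K where "K = cball (\<phi> p) R \<inter> model M"
  \<comment> \<open>The closed ball pulled back to M. It is closed in M by compactness and the
    Hausdorff property, so that a trajectory cannot jump from the chart to a point outside it in the
    limit.\<close>
  define Z where "Z = inv_into U \<phi> ` K"
  have O': "openin (mtop M) O'"
    unfolding O'_def by (rule chart_open_preimage[OF ch open_ball])
  have "compact K"
    unfolding K_def by (intro compact_Int_closed closed_subspace subspace_model compact_cball)
  then have "compactin (top_of_set (\<phi> ` U)) K"
    using ball by (simp add: compactin_subtopology K_def)
  from image_compactin[OF this chart_inv_continuous[OF ch]] have Z: "closedin (mtop M) Z"
    unfolding Z_def by (rule compactin_imp_closedin[OF Hausdorff])
  have ZU: "q \<in> U \<and> norm (\<phi> q - \<phi> p) \<le> R" if qZ: "q \<in> Z" for q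
  proof -
    obtain y where y: "y \<in> K" "q = inv_into U \<phi> y" using qZ by (auto simp: Z_def)
    then obtain q' where "q' \<in> U" "y = \<phi> q'" using ball by (auto simp: K_def)
    then show ?thesis using y chart_inv[OF ch] by (auto simp: K_def dist_norm norm_minus_commute)
  qed
  have OZ: "q \<in> Z" if "q \<in> O'" for q
    using that chart_inv[OF ch] chart_image_model[OF ch]
    by (auto simp: O'_def Z_def K_def intro!: image_eqI[of q _ "\<phi> q"])
  have xcO: "x c \<in> O'"
    using c R by (auto simp: O'_def dist_norm norm_minus_commute)
  assume "\<not> (x s \<in> U \<and> norm (\<phi> (x s) - \<phi> p) \<le> R)"
  then have xs: "x s \<notin> O'" by (auto simp: O'_def dist_norm norm_minus_commute)
  define I where "I = closed_segment c s"
  have I: "I \<subseteq> {0..t}" "c \<in> I" "s \<in> I"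
    using c closed_segment_subset[OF c(1,2)] by (auto simp: I_def)
  define E where "E = {r\<in>I. x r \<notin> O'}"
  have "openin (top_of_set {0..t}) {r\<in>{0..t}. x r \<in> O'}"
    by (rule continuous_curve_open[OF solution_continuous[OF sol] O'])
  then obtain N where N: "open N" "{r\<in>{0..t}. x r \<in> O'} = {0..t} \<inter> N"
    by (auto simp: openin_open)
  have "E = I - N" using N(2) I(1) unfolding E_def by blast
  then have "closed E" using N(1) by (simp add: I_def closed_Diff)
  moreover have "s \<in> E" using xs I by (simp add: E_def)
  \<comment> \<open>The exit time nearest to \<open>c\<close>; measuring by distance treats s < c
    and s > c alike.\<close>
  ultimately obtain r0 where r0: "r0 \<in> E" "\<And>r. r \<in> E \<Longrightarrow> dist c r0 \<le> dist c r"
    using distance_attains_inf[of E c] by blast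
  define J where "J = closed_segment c r0"
  have JI: "J \<subseteq> I"
    using r0(1) by (auto simp: J_def I_def E_def closed_segment_eq_real_ivl split: if_splits)
  have r0c: "r0 \<noteq> c" using r0(1) xcO by (auto simp: E_def)
  have JO: "x r \<in> O'" if r: "r \<in> J" "r \<noteq> r0" for r
  proof -
    have "dist c r < dist c r0"
      using r by (auto simp: J_def closed_segment_eq_real_ivl dist_real_def split: if_splits)
    then have "r \<notin> E" using r0(2) by force
    then show ?thesis using r JI by (auto simp: E_def)
  qed
  have r0J: "r0 \<in> J" "c \<in> J" by (auto simp: J_def)
  have r0Z: "x r0 \<in> Z"
  proof (rule ccontr)
    assume "x r0 \<notin> Z"
    then have "x r0 \<in> points M - Z" using solution_in_points[OF sol] r0J JI I by blast
    then have "\<forall>\<^sub>F r in at r0 within {0..t}. x r \<in> points M - Z"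
      by (intro continuous_curve_eventually[OF solution_continuous[OF sol]] openin_diff Z)
        (use r0J JI I in auto)
    then have "\<forall>\<^sub>F r in at r0 within J. x r \<in> points M - Z"
      using JI I by (meson at_le filter_leD order_trans)
    moreover have "\<forall>\<^sub>F r in at r0 within J. x r \<in> O'"
      using JO by (auto simp: eventually_at_filter)
    ultimately have "\<forall>\<^sub>F r in at r0 within J. False"
      by eventually_elim (use OZ in auto)
    moreover have "connected J" by (simp add: J_def)
    then have "r0 islimpt J"
      by (rule connected_imp_perfect) (use r0c r0J in auto)
    ultimately show False by (metis trivial_limit_within eventually_const)
  qed
  have JU: "x r \<in> U" "norm (\<phi> (x r) - \<phi> p) \<le> R" if "r \<in> J" for r
    using ZU[of "x r"] r0Z OZ JO[OF that] by blast+
  have J01: "r \<in> {0..t}" if "r \<in> J" for r using that JI I by blast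
  have "norm (\<phi> (x r0) - \<phi> (x c)) \<le> B * \<bar>r0 - c\<bar>"
  proof (rule curve_speed_bound[where J = J and v = "\<lambda>r. h (r, \<phi> (x r))"])
    show "((\<lambda>r. \<phi> (x r)) has_vector_derivative h (r, \<phi> (x r))) (at r within J)" if "r \<in> J" for r
      using has_vector_derivative_within_subset[OF solution_chart_derivative[OF a sol t J01[OF that] JU(1)[OF that] h(1,2)]] JI I
      by blast
    show "norm (h (r, \<phi> (x r))) \<le> B" if "r \<in> J" for r
      using h(3) JU[OF that] that JI by (auto simp: I_def)
  qed (use r0J in \<open>auto simp: J_def\<close>)
  also have "\<dots> \<le> B * \<bar>s - c\<bar>"
    by (rule mult_left_mono[OF _ B(1)])
      (use r0(1) in \<open>auto simp: E_def I_def closed_segment_eq_real_ivl split: if_splits\<close>)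
  finally have "norm (\<phi> (x r0) - \<phi> (x c)) < R / 2" using B(2) by simp
  then have "norm (\<phi> (x r0) - \<phi> p) < R"
    using c(4) norm_triangle_ineq[of "\<phi> (x r0) - \<phi> (x c)" "\<phi> (x c) - \<phi> p"] by simp
  then have "x r0 \<in> O'" using JU(1)[OF r0J(1)] by (simp add: O'_def dist_norm norm_minus_commute)
  then show False using r0(1) by (simp add: E_def)
qed

text \<open>The chart, the radius and the time span are chosen before the trajectories, which is the
  uniformity that continuous dependence requires. The times \<open>c\<close> and \<open>s\<close>
  may come in either order, so information propagates forwards and backwards.\<close>

lemma flow_tube:
  assumes H: "H \<in> smooth_time_funs M" and s0: "s0 \<in> {0..1}" and p: "p \<in> points M"
  obtains U \<phi> R \<delta> where "(U, \<phi>) \<in> atlas M" "p \<in> U" "R > 0" "\<delta> > 0"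
    "\<And>t x c s. \<lbrakk>t \<le> 1; solution M (ham_vf M \<omega> H) t x; c \<in> {0..t}; s \<in> {0..t}; \<bar>c - s0\<bar> < \<delta>; \<bar>s - s0\<bar> < \<delta>;
       x c \<in> U; norm (\<phi> (x c) - \<phi> p) \<le> R / 2\<rbrakk> \<Longrightarrow> x s \<in> U \<and> norm (\<phi> (x s) - \<phi> p) \<le> R"
    "\<And>t x x' c s. \<lbrakk>t \<le> 1; solution M (ham_vf M \<omega> H) t x; solution M (ham_vf M \<omega> H) t x';
       c \<in> {0..t}; s \<in> {0..t}; \<bar>c - s0\<bar> < \<delta>; \<bar>s - s0\<bar> < \<delta>;
       x c \<in> U; norm (\<phi> (x c) - \<phi> p) \<le> R / 2; x' c \<in> U; norm (\<phi> (x' c) - \<phi> p) \<le> R / 2\<rbrakk> \<Longrightarrow>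
       norm (\<phi> (x s) - \<phi> (x' s)) \<le> 2 * norm (\<phi> (x c) - \<phi> (x' c))"
proof -
  obtain U \<phi> where a: "(U, \<phi>) \<in> atlas M" and pU: "p \<in> U" using atlas_cover[OF p] by blast
  note ch = atlas_maximal[OF a]
  obtain h where h: "smooth_on ({0..1} \<times> \<phi> ` U) h"
    "\<And>t y. t \<in> {0..1} \<Longrightarrow> y \<in> \<phi> ` U \<Longrightarrow> h (t, y) \<in> model M"
    "\<And>t q. t \<in> {0..1} \<Longrightarrow> q \<in> U \<Longrightarrow> ham_vf M \<omega> H t q = cvec M U \<phi> q (h (t, \<phi> q))"
    "\<And>t q w. t \<in> {0..1} \<Longrightarrow> q \<in> U \<Longrightarrow> w \<in> tangent_space M q \<Longrightarrow>
       \<omega> q (cvec M U \<phi> q (h (t, \<phi> q))) w = w (H t)"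
    using that by (rule ham_vf_chart[OF a H])
  obtain \<delta>0 R0 B L where l: "\<delta>0 > 0" "R0 > 0" "B \<ge> 0" "L \<ge> 0"
    "\<And>s y. s \<in> {0..1} \<Longrightarrow> \<bar>s - s0\<bar> \<le> \<delta>0 \<Longrightarrow> y \<in> \<phi> ` U \<Longrightarrow> norm (y - \<phi> p) \<le> R0 \<Longrightarrow> norm (h (s, y)) \<le> B"
    "\<And>s y y'. s \<in> {0..1} \<Longrightarrow> \<bar>s - s0\<bar> \<le> \<delta>0 \<Longrightarrow> y \<in> \<phi> ` U \<Longrightarrow> y' \<in> \<phi> ` U \<Longrightarrow> norm (y - \<phi> p) \<le> R0 \<Longrightarrow>
       norm (y' - \<phi> p) \<le> R0 \<Longrightarrow> norm (h (s, y) - h (s, y')) \<le> L * norm (y - y')"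
    using that by (rule smooth_on_local_Lipschitz[OF h(1) s0 imageI[OF pU]])
  obtain N where N: "open N" "\<phi> ` U = model M \<inter> N"
    using chart_image_open[OF ch] by (auto simp: openin_open)
  then have "\<phi> p \<in> N" using pU by blast
  then obtain R1 where R1: "R1 > 0" "cball (\<phi> p) R1 \<subseteq> N"
    using open_contains_cball N(1) by blast
  define R where "R = min R0 R1"
  have R: "R > 0" "R \<le> R0" "R \<le> R1" using l R1 by (auto simp: R_def)
  have ball: "cball (\<phi> p) R \<inter> model M \<subseteq> \<phi> ` U"
    using R1(2) R(3) N(2) by (auto simp: subset_iff)
  \<comment> \<open>Two times within \<delta> of \<open>s0\<close> differ by less than 2 * \<delta>.
    Then B * |s - c| is at most R / 4, as confinement requires, and L * |s - c| is at most 1 / 2, as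
    \<open>curves_stay_close\<close> requires. Adding 1 to \<open>B\<close> and \<open>L\<close>
    avoids division by zero.\<close>
  define \<delta> where "\<delta> = min \<delta>0 (min (R / (8 * (B + 1))) (1 / (4 * (L + 1))))"
  have \<delta>: "\<delta> > 0" "\<delta> \<le> \<delta>0" "\<delta> \<le> R / (8 * (B + 1))" "\<delta> \<le> 1 / (4 * (L + 1))"
    using l R by (auto simp: \<delta>_def)
  have Bd: "B * d < R / 2" if "d \<le> 2 * \<delta>" "d \<ge> 0" for d
  proof -
    have "(B + 1) * d \<le> (B + 1) * (2 * (R / (8 * (B + 1))))"
      using that \<delta> l by (intro mult_left_mono) auto
    also have "\<dots> = R / 4" using l by (simp add: field_simps)
    finally have "(B + 1) * d \<le> R / 4" .
    moreover have "B * d \<le> (B + 1) * d" using that by (intro mult_right_mono) auto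
    ultimately show ?thesis using R by linarith
  qed
  have Ld: "L * d \<le> 1 / 2" if "d \<le> 2 * \<delta>" "d \<ge> 0" for d
  proof -
    have "(L + 1) * d \<le> (L + 1) * (2 * (1 / (4 * (L + 1))))"
      using that \<delta> l by (intro mult_left_mono) auto
    also have "\<dots> = 1 / 2" using l by (simp add: field_simps)
    finally have "(L + 1) * d \<le> 1 / 2" .
    moreover have "L * d \<le> (L + 1) * d" using that by (intro mult_right_mono) auto
    ultimately show ?thesis by linarith
  qed
  have seg: "r \<in> {0..t} \<and> \<bar>r - s0\<bar> < \<delta> \<and> \<bar>r - c\<bar> \<le> 2 * \<delta>"
    if "r \<in> closed_segment c s" "c \<in> {0..t}" "s \<in> {0..t}" "\<bar>c - s0\<bar> < \<delta>" "\<bar>s - s0\<bar> < \<delta>" for r c s t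
    using that by (auto simp: closed_segment_eq_real_ivl split: if_splits)
  have A: "x s \<in> U \<and> norm (\<phi> (x s) - \<phi> p) \<le> R"
    if "t \<le> 1" "solution M (ham_vf M \<omega> H) t x" "c \<in> {0..t}" "s \<in> {0..t}" "\<bar>c - s0\<bar> < \<delta>" "\<bar>s - s0\<bar> < \<delta>"
       "x c \<in> U" "norm (\<phi> (x c) - \<phi> p) \<le> R / 2" for t x c s
  proof (rule solution_confined[OF a pU ball that(2,1,3,4,7,8) R(1) l(3) _ h(2,3)])
    show "B * \<bar>s - c\<bar> < R / 2" using that by (intro Bd) auto
    show "norm (h (r, y)) \<le> B" if "r \<in> closed_segment c s" "y \<in> \<phi> ` U" "norm (y - \<phi> p) \<le> R" for r y
      using seg[OF that(1) \<open>c \<in> {0..t}\<close> \<open>s \<in> {0..t}\<close> \<open>\<bar>c - s0\<bar> < \<delta>\<close> \<open>\<bar>s - s0\<bar> < \<delta>\<close>] \<open>t \<le> 1\<close> that(2,3) R(2) \<delta>(2)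
      by (intro l(5)) auto
  qed
  have D: "norm (\<phi> (x s) - \<phi> (x' s)) \<le> 2 * norm (\<phi> (x c) - \<phi> (x' c))"
    if t: "t \<le> 1" and sol: "solution M (ham_vf M \<omega> H) t x" "solution M (ham_vf M \<omega> H) t x'"
      and cs: "c \<in> {0..t}" "s \<in> {0..t}" "\<bar>c - s0\<bar> < \<delta>" "\<bar>s - s0\<bar> < \<delta>"
      and xc: "x c \<in> U" "norm (\<phi> (x c) - \<phi> p) \<le> R / 2" "x' c \<in> U" "norm (\<phi> (x' c) - \<phi> p) \<le> R / 2" for t x x' c s
  proof -
    let ?J = "closed_segment c s"
    have J: "r \<in> {0..t}" "\<bar>r - s0\<bar> < \<delta>" "\<bar>r - c\<bar> \<le> 2 * \<delta>" if "r \<in> ?J" for r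
      using seg[OF that cs] by auto
    have Jt: "?J \<subseteq> {0..t}" using J by blast
    have x: "x r \<in> U" "norm (\<phi> (x r) - \<phi> p) \<le> R" and x': "x' r \<in> U" "norm (\<phi> (x' r) - \<phi> p) \<le> R" if "r \<in> ?J" for r
      using A[OF t sol(1) cs(1) J(1)[OF that] cs(3) J(2)[OF that] xc(1,2)]
        A[OF t sol(2) cs(1) J(1)[OF that] cs(3) J(2)[OF that] xc(3,4)] by auto
    show ?thesis
    proof (rule curves_stay_close[where J = ?J and L = L and ?v1.0 = "\<lambda>r. h (r, \<phi> (x r))" and ?v2.0 = "\<lambda>r. h (r, \<phi> (x' r))"])
      show "((\<lambda>r. \<phi> (x r)) has_vector_derivative h (r, \<phi> (x r))) (at r within ?J)" if "r \<in> ?J" for r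
        using has_vector_derivative_within_subset[OF solution_chart_derivative[OF a sol(1) t J(1)[OF that] x(1)[OF that] h(2,3)] Jt] .
      show "((\<lambda>r. \<phi> (x' r)) has_vector_derivative h (r, \<phi> (x' r))) (at r within ?J)" if "r \<in> ?J" for r
        using has_vector_derivative_within_subset[OF solution_chart_derivative[OF a sol(2) t J(1)[OF that] x'(1)[OF that] h(2,3)] Jt] .
      show "norm (h (r, \<phi> (x r)) - h (r, \<phi> (x' r))) \<le> L * norm (\<phi> (x r) - \<phi> (x' r))" if "r \<in> ?J" for r
        by (rule l(6)) (use J[OF that] x[OF that] x'[OF that] R(2) \<delta>(2) t in auto)
      show "L * \<bar>r - c\<bar> \<le> 1 / 2" if "r \<in> ?J" for r
        using J(3)[OF that] by (intro Ld) auto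
    qed (use l in auto)
  qed
  show ?thesis
    by (rule that[OF a pU R(1) \<delta>(1)]) (fact A D)+
qed

text \<open>By the tube estimate, near any time agreement at one moment implies agreement at all
  neighbouring moments. Connectedness carries the agreement from time 0 over the whole
  interval.\<close>

lemma solution_unique:
  assumes H: "H \<in> smooth_time_funs M" and t: "t \<le> 1"
    and sol: "solution M (ham_vf M \<omega> H) t x" "solution M (ham_vf M \<omega> H) t x'" and eq: "x 0 = x' 0"
    and s: "s \<in> {0..t}"
  shows "x s = x' s"
proof (rule connected_induction_simple[of "{0..t}" 0 s "\<lambda>s. x s = x' s"])
  fix s0 assume s0: "s0 \<in> {0..t}"
  have s01: "s0 \<in> {0..1}" using s0 t by auto
  obtain U \<phi> R \<delta> where a: "(U, \<phi>) \<in> atlas M" and pU: "x s0 \<in> U" and R: "R > 0" "\<delta> > 0"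
    and A: "\<And>t' y c s. \<lbrakk>t' \<le> 1; solution M (ham_vf M \<omega> H) t' y; c \<in> {0..t'}; s \<in> {0..t'}; \<bar>c - s0\<bar> < \<delta>; \<bar>s - s0\<bar> < \<delta>;
       y c \<in> U; norm (\<phi> (y c) - \<phi> (x s0)) \<le> R / 2\<rbrakk> \<Longrightarrow> y s \<in> U \<and> norm (\<phi> (y s) - \<phi> (x s0)) \<le> R"
    and D: "\<And>t' y y' c s. \<lbrakk>t' \<le> 1; solution M (ham_vf M \<omega> H) t' y; solution M (ham_vf M \<omega> H) t' y';
       c \<in> {0..t'}; s \<in> {0..t'}; \<bar>c - s0\<bar> < \<delta>; \<bar>s - s0\<bar> < \<delta>;
       y c \<in> U; norm (\<phi> (y c) - \<phi> (x s0)) \<le> R / 2; y' c \<in> U; norm (\<phi> (y' c) - \<phi> (x s0)) \<le> R / 2\<rbrakk> \<Longrightarrow>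
       norm (\<phi> (y s) - \<phi> (y' s)) \<le> 2 * norm (\<phi> (y c) - \<phi> (y' c))"
    using that by (rule flow_tube[OF H s01 solution_in_points[OF sol(1) s0]])
  note ch = atlas_maximal[OF a]
  define O' where "O' = {q\<in>U. \<phi> q \<in> ball (\<phi> (x s0)) (R / 2)}"
  define T where "T = {r\<in>{0..t}. x r \<in> O'} \<inter> ball s0 \<delta>"
  have "openin (mtop M) O'" unfolding O'_def by (rule chart_open_preimage[OF ch open_ball])
  then have "openin (top_of_set {0..t}) T"
    unfolding T_def
    by (metis (no_types, lifting) continuous_curve_open[OF solution_continuous[OF sol(1)]] open_ball openin_Int_open)
  moreover have "s0 \<in> T" using s0 pU R by (auto simp: T_def O'_def)
  moreover have "x r' = x' r'" if r: "r \<in> T" "r' \<in> T" "x r = x' r" for r r'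
  proof -
    have 1: "r \<in> {0..t}" "r' \<in> {0..t}" "\<bar>r - s0\<bar> < \<delta>" "\<bar>r' - s0\<bar> < \<delta>" "x r \<in> U" "norm (\<phi> (x r) - \<phi> (x s0)) \<le> R / 2"
      using r by (auto simp: T_def O'_def dist_norm norm_minus_commute abs_minus_commute)
    have 2: "x' r \<in> U" "norm (\<phi> (x' r) - \<phi> (x s0)) \<le> R / 2" using 1(5,6) r(3) by auto
    have "norm (\<phi> (x r') - \<phi> (x' r')) \<le> 2 * norm (\<phi> (x r) - \<phi> (x' r))"
      by (rule D[of t x x' r r', OF t sol 1 2])
    then have "\<phi> (x r') = \<phi> (x' r')" using r(3) by simp
    moreover have "x r' \<in> U" "x' r' \<in> U"
      using A[of t x r r', OF t sol(1) 1] A[of t x' r r', OF t sol(2) 1(1-4) 2] by auto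
    ultimately show ?thesis using chart_inj[OF ch] by (auto simp: inj_on_def)
  qed
  ultimately show "\<exists>T. openin (top_of_set {0..t}) T \<and> s0 \<in> T \<and> (\<forall>r\<in>T. \<forall>r'\<in>T. x r = x' r \<longrightarrow> x r' = x' r')"
    by blast
qed (use s eq in auto)

lemma flow_solution:
  assumes H: "H \<in> smooth_time_funs M" and sol: "solution M (ham_vf M \<omega> H) 1 x" and s: "s \<in> {0..1}"
  shows "flow M (ham_vf M \<omega> H) s (x 0) = x s"
  unfolding flow_def
proof (rule the_equality)
  have sols: "solution M (ham_vf M \<omega> H) s x"
    using solution_restrict[OF sol] s by simp
  then show "\<exists>x'. solution M (ham_vf M \<omega> H) s x' \<and> x' 0 = x 0 \<and> x' s = x s" by blast
  fix y assume "\<exists>x'. solution M (ham_vf M \<omega> H) s x' \<and> x' 0 = x 0 \<and> x' s = y"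
  then show "y = x s"
    using solution_unique[OF H _ _ sols, of _ s] s by auto
qed

lemma flow_continuous:
  assumes H: "H \<in> smooth_time_funs M" and X: "X \<subseteq> flow_dom M (ham_vf M \<omega> H) 1" and s: "s \<in> {0..1}"
  shows "continuous_map (subtopology (mtop M) X) (mtop M) (flow M (ham_vf M \<omega> H) s)"
proof -
  let ?V = "ham_vf M \<omega> H"
  have "\<forall>z\<in>X. \<exists>x. solution M ?V 1 x \<and> x 0 = z"
    using X by (auto simp: flow_dom_def)
  then obtain g where g: "\<And>z. z \<in> X \<Longrightarrow> solution M ?V 1 (g z)" "\<And>z. z \<in> X \<Longrightarrow> g z 0 = z"
    by metis
  have fl: "flow M ?V s z = g z s" if "z \<in> X" "s \<in> {0..1}" for z s
    using flow_solution[OF H g(1)[OF that(1)] that(2)] g(2)[OF that(1)] by simp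
  have XM: "X \<subseteq> points M" using X by (auto simp: flow_dom_def)
  \<comment> \<open>Continuity at \<open>z0\<close> of the map that sends \<open>z\<close> to the
    position at time \<open>s\<close> of its trajectory. It is trivial at time 0 and is propagated
    through [0,1] by connectedness.\<close>
  define P where "P z0 s \<longleftrightarrow> (\<forall>W. openin (mtop M) W \<and> g z0 s \<in> W \<longrightarrow>
      (\<exists>Q. openin (mtop M) Q \<and> z0 \<in> Q \<and> (\<forall>z\<in>Q \<inter> X. g z s \<in> W)))" for z0 s
  have cont: "P z0 s" if z0: "z0 \<in> X" for z0
  proof (rule connected_induction_simple[of "{0..1}" 0 s "P z0"])
    show "P z0 0"
      using g(2) z0 by (auto simp: P_def)
  next
    fix s0 :: real assume s0: "s0 \<in> {0..1}"
    let ?x = "g z0"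
    obtain U \<phi> R \<delta> where a: "(U, \<phi>) \<in> atlas M" and pU: "?x s0 \<in> U" and R: "R > 0" "\<delta> > 0"
      and A: "\<And>t' y c s. \<lbrakk>t' \<le> 1; solution M ?V t' y; c \<in> {0..t'}; s \<in> {0..t'}; \<bar>c - s0\<bar> < \<delta>; \<bar>s - s0\<bar> < \<delta>;
         y c \<in> U; norm (\<phi> (y c) - \<phi> (?x s0)) \<le> R / 2\<rbrakk> \<Longrightarrow> y s \<in> U \<and> norm (\<phi> (y s) - \<phi> (?x s0)) \<le> R"
      and D: "\<And>t' y y' c s. \<lbrakk>t' \<le> 1; solution M ?V t' y; solution M ?V t' y';
         c \<in> {0..t'}; s \<in> {0..t'}; \<bar>c - s0\<bar> < \<delta>; \<bar>s - s0\<bar> < \<delta>;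
         y c \<in> U; norm (\<phi> (y c) - \<phi> (?x s0)) \<le> R / 2; y' c \<in> U; norm (\<phi> (y' c) - \<phi> (?x s0)) \<le> R / 2\<rbrakk> \<Longrightarrow>
         norm (\<phi> (y s) - \<phi> (y' s)) \<le> 2 * norm (\<phi> (y c) - \<phi> (y' c))"
      using that by (rule flow_tube[OF H s0 solution_in_points[OF g(1)[OF z0] s0]])
    note ch = atlas_maximal[OF a]
    \<comment> \<open>The radius is R / 4 so that trajectories within another R / 4 of the central
      one still start within R / 2, the range of the tube estimate.\<close>
    define O' where "O' = {q\<in>U. \<phi> q \<in> ball (\<phi> (?x s0)) (R / 4)}"
    define T where "T = {r\<in>{0..1}. ?x r \<in> O'} \<inter> ball s0 \<delta>"
    have "openin (mtop M) O'" unfolding O'_def by (rule chart_open_preimage[OF ch open_ball])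
    then have T: "openin (top_of_set {0..1}) T"
      unfolding T_def
      by (metis (no_types, lifting) continuous_curve_open[OF solution_continuous[OF g(1)[OF z0]]] open_ball openin_Int_open)
    have s0T: "s0 \<in> T" using s0 pU R by (auto simp: T_def O'_def)
    have step: "\<exists>Q. openin (mtop M) Q \<and> z0 \<in> Q \<and> (\<forall>z\<in>Q \<inter> X. g z r' \<in> W)"
      if r: "r \<in> T" "r' \<in> T" and P: "P z0 r"
        and W: "openin (mtop M) W" "?x r' \<in> W" for r r' W
    proof -
      have 1: "r \<in> {0..1}" "r' \<in> {0..1}" "\<bar>r - s0\<bar> < \<delta>" "\<bar>r' - s0\<bar> < \<delta>"
        using r by (auto simp: T_def dist_norm abs_minus_commute)
      have 2: "?x r \<in> U" "norm (\<phi> (?x r) - \<phi> (?x s0)) < R / 4" "?x r' \<in> U"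
        using r by (auto simp: T_def O'_def dist_norm norm_minus_commute)
      have 3: "norm (\<phi> (?x r) - \<phi> (?x s0)) \<le> R / 2" using 2 R by simp
      obtain N where N: "open N" "\<And>S. S \<subseteq> U \<Longrightarrow> \<phi> ` S \<inter> N = \<phi> ` (S \<inter> W)"
        using chart_nbhd[OF ch W(1)] by blast
      have "\<phi> (?x r') \<in> N" using N(2)[of U] 2(3) W(2) by blast
      then obtain \<epsilon> where \<epsilon>: "\<epsilon> > 0" "ball (\<phi> (?x r')) \<epsilon> \<subseteq> N"
        using N(1) open_contains_ball by blast
      \<comment> \<open>The radius \<epsilon> / 2 compensates for the factor 2 in the tube
        estimate.\<close>
      define W' where "W' = {q\<in>U. \<phi> q \<in> ball (\<phi> (?x r)) (min (\<epsilon> / 2) (R / 4))}"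
      have "openin (mtop M) W'" unfolding W'_def by (rule chart_open_preimage[OF ch open_ball])
      moreover have "?x r \<in> W'" using 2 \<epsilon> R by (simp add: W'_def)
      ultimately obtain Q where Q: "openin (mtop M) Q" "z0 \<in> Q" "\<forall>z\<in>Q \<inter> X. g z r \<in> W'"
        using P unfolding P_def by blast
      have "g z r' \<in> W" if z: "z \<in> Q \<inter> X" for z
      proof -
        have zr: "g z r \<in> U" "norm (\<phi> (g z r) - \<phi> (?x r)) < \<epsilon> / 2" "norm (\<phi> (g z r) - \<phi> (?x r)) < R / 4"
          using Q(3) z by (auto simp: W'_def dist_norm norm_minus_commute)
        have zr': "norm (\<phi> (g z r) - \<phi> (?x s0)) \<le> R / 2"
          using zr(3) 2(2) norm_triangle_ineq[of "\<phi> (g z r) - \<phi> (?x r)" "\<phi> (?x r) - \<phi> (?x s0)"] by simp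
        have zs: "solution M ?V 1 (g z)" using g(1) z by blast
        have "g z r' \<in> U" using A[of 1 "g z" r r', OF order_refl zs 1 zr(1) zr'] by blast
        moreover have "norm (\<phi> (g z r') - \<phi> (?x r')) < \<epsilon>"
          using D[of 1 "g z" ?x r r', OF order_refl zs g(1)[OF z0] 1 zr(1) zr' 2(1) 3] zr(2) by simp
        ultimately have "\<phi> (g z r') \<in> \<phi> ` U \<inter> N"
          using \<epsilon>(2) by (auto simp: subset_iff dist_norm norm_minus_commute)
        then have "\<phi> (g z r') \<in> \<phi> ` (U \<inter> W)" using N(2)[of U] by blast
        then show ?thesis using \<open>g z r' \<in> U\<close> chart_inj[OF ch] by (auto simp: inj_on_def)
      qed
      with Q show ?thesis by blast
    qed
    have "P z0 r'" if "r \<in> T" "r' \<in> T" "P z0 r" for r r'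
      unfolding P_def using step[OF that] by blast
    then show "\<exists>T. openin (top_of_set {0..1}) T \<and> s0 \<in> T \<and> (\<forall>r\<in>T. \<forall>r'\<in>T. P z0 r \<longrightarrow> P z0 r')"
      using T s0T by blast
  qed (use s in auto)
  show ?thesis
    unfolding continuous_map_def
  proof (intro conjI allI impI)
    show "flow M ?V s \<in> topspace (subtopology (mtop M) X) \<rightarrow> points M"
      using fl[OF _ s] solution_in_points[OF g(1) s] by auto
    fix W assume W: "openin (mtop M) W"
    show "openin (subtopology (mtop M) X) {z \<in> topspace (subtopology (mtop M) X). flow M ?V s z \<in> W}"
    proof (subst openin_subopen, intro ballI)
      fix z0 assume "z0 \<in> {z \<in> topspace (subtopology (mtop M) X). flow M ?V s z \<in> W}"
      then have z0: "z0 \<in> X" "g z0 s \<in> W" using fl[OF _ s] by auto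
      then obtain Q where Q: "openin (mtop M) Q" "z0 \<in> Q" "\<forall>z\<in>Q \<inter> X. g z s \<in> W"
        using cont[OF z0(1)] W unfolding P_def by blast
      have "openin (subtopology (mtop M) X) (Q \<inter> X)"
        using Q(1) by (auto simp: openin_subtopology)
      moreover have "Q \<inter> X \<subseteq> {z \<in> topspace (subtopology (mtop M) X). flow M ?V s z \<in> W}"
        using Q(3) XM fl[OF _ s] by auto
      ultimately show "\<exists>T. openin (subtopology (mtop M) X) T \<and> z0 \<in> T \<and>
          T \<subseteq> {z \<in> topspace (subtopology (mtop M) X). flow M ?V s z \<in> W}"
        using z0 Q(2) by blast
    qed
  qed
qed

end

section \<open>Reparametrizing and concatenating Hamiltonian flows\<close>

text \<open>Here \<sigma> may be any smooth map of [0,1] into itself, which covers both the reversal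
  of time and step functions with plateaus.\<close>

lemma solution_reparam:
  assumes sol: "solution M V 1 x" and \<sigma>: "smooth_on {0..1} \<sigma>" "\<And>s. s \<in> {0..1} \<Longrightarrow> \<sigma> s \<in> {0..1}"
    and d: "\<And>s. s \<in> {0..1} \<Longrightarrow> (\<sigma> has_real_derivative \<sigma>' s) (at s within {0..1})"
  shows "solution M (\<lambda>t q f. \<sigma>' t * V (\<sigma> t) q f) 1 (\<lambda>s. x (\<sigma> s))"
  unfolding solution_def smooth_curve_def
proof (intro conjI ballI)
  have "continuous_map (top_of_set {0..1}) (top_of_set {0..1}) \<sigma>"
    using smooth_on_imp_continuous_on[OF \<sigma>(1)] \<sigma>(2) by auto
  from continuous_map_compose[OF this solution_continuous[OF sol]]
  show "continuous_map (top_of_set {0..1}) (mtop M) (\<lambda>s. x (\<sigma> s))" by (simp add: o_def)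
next
  fix c assume c: "c \<in> atlas M"
  obtain U \<phi> where U: "c = (U, \<phi>)" by (cases c)
  have sm: "smooth_on {s\<in>{0..1}. x s \<in> U} (\<phi> \<circ> x)"
    using sol c U unfolding solution_def smooth_curve_def by blast
  have "smooth_on {s\<in>{0..1}. x (\<sigma> s) \<in> U} (\<lambda>s. (\<phi> \<circ> x) (\<sigma> s))"
    by (rule smooth_on_compose[where f = \<sigma> and g = "\<phi> \<circ> x", OF smooth_on_subset[OF \<sigma>(1)] sm])
      (use \<sigma>(2) in blast)+
  then show "case c of (U, \<phi>) \<Rightarrow> smooth_on {s\<in>{0..1}. x (\<sigma> s) \<in> U} (\<phi> \<circ> (\<lambda>s. x (\<sigma> s)))"
    by (simp add: U o_def)
next
  fix s :: real and f assume s: "s \<in> {0..1}" and f: "f \<in> smooth_funs M"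
  have "((\<lambda>r. f (x r)) has_real_derivative V (\<sigma> s) (x (\<sigma> s)) f) (at (\<sigma> s) within {0..1})"
    using sol f \<sigma>(2)[OF s] unfolding solution_def by blast
  then have "((\<lambda>r. f (x r)) has_real_derivative V (\<sigma> s) (x (\<sigma> s)) f) (at (\<sigma> s) within \<sigma> ` {0..1})"
    by (rule has_field_derivative_subset) (use \<sigma>(2) in blast)
  from DERIV_image_chain[OF this d[OF s]]
  show "((\<lambda>r. f (x (\<sigma> r))) has_real_derivative \<sigma>' s * V (\<sigma> s) (x (\<sigma> s)) f) (at s within {0..1})"
    by (simp add: o_def mult.commute)
qed

lemma solution_cong:
  assumes "solution M V t x" "\<And>s. s \<in> {0..t} \<Longrightarrow> V s (x s) = V' s (x s)"
  shows "solution M V' t x"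
  using assms unfolding solution_def by simp

text \<open>The two pieces agree on the overlap between \<open>a\<close> and \<open>b\<close>, so
  near every time the glued curve is one of two known solutions and smoothness at the junction is
  automatic.\<close>

lemma solution_glue:
  assumes sol: "solution M V1 1 y1" "solution M V2 1 y2" and ab: "a < b"
    and y: "\<And>s. s \<in> {0..1} \<Longrightarrow> s < b \<Longrightarrow> y s = y1 s" "\<And>s. s \<in> {0..1} \<Longrightarrow> s > a \<Longrightarrow> y s = y2 s"
    and V: "\<And>s. s \<in> {0..1} \<Longrightarrow> s < b \<Longrightarrow> V s (y s) = V1 s (y s)" "\<And>s. s \<in> {0..1} \<Longrightarrow> s > a \<Longrightarrow> V s (y s) = V2 s (y s)"
  shows "solution M V 1 y"
  unfolding solution_def smooth_curve_def
proof (intro conjI ballI)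
  show "continuous_map (top_of_set {0..1}) (mtop M) y"
    unfolding continuous_map_def
  proof (intro conjI allI impI)
    have "y s \<in> points M" if s: "s \<in> {0..1}" for s
    proof (cases "s < b")
      case True
      then show ?thesis using y(1)[OF s] solution_in_points[OF sol(1) s] by simp
    next
      case False
      then show ?thesis using y(2)[OF s] solution_in_points[OF sol(2) s] ab by simp
    qed
    then show "y \<in> topspace (top_of_set {0..1}) \<rightarrow> points M" by simp
    fix W assume W: "openin (mtop M) W"
    have "openin (top_of_set {0..1}) ({s\<in>{0..1}. y1 s \<in> W} \<inter> {..<b} \<union> {s\<in>{0..1}. y2 s \<in> W} \<inter> {a<..})"
      by (intro openin_Un openin_Int_open continuous_curve_open[OF solution_continuous[OF sol(1)] W]
          continuous_curve_open[OF solution_continuous[OF sol(2)] W]) auto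
    moreover have "{s \<in> topspace (top_of_set {0..1}). y s \<in> W} =
        {s\<in>{0..1}. y1 s \<in> W} \<inter> {..<b} \<union> {s\<in>{0..1}. y2 s \<in> W} \<inter> {a<..}" (is "?L = ?R")
    proof (rule Set.set_eqI)
      fix s
      show "s \<in> ?L \<longleftrightarrow> s \<in> ?R"
        using y[of s] ab by (cases "s < b"; cases "s > a") auto
    qed
    ultimately show "openin (top_of_set {0..1}) {s \<in> topspace (top_of_set {0..1}). y s \<in> W}" by simp
  qed
next
  fix c assume c: "c \<in> atlas M"
  obtain U \<phi> where U: "c = (U, \<phi>)" by (cases c)
  have sm: "smooth_on {s\<in>{0..1}. y1 s \<in> U} (\<phi> \<circ> y1)" "smooth_on {s\<in>{0..1}. y2 s \<in> U} (\<phi> \<circ> y2)"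
    using sol c U unfolding solution_def smooth_curve_def by blast+
  have 1: "smooth_on ({s\<in>{0..1}. y s \<in> U} \<inter> {..<b}) (\<phi> \<circ> y)"
    by (rule smooth_on_cong[OF _ smooth_on_subset[OF sm(1)]]) (use y(1) in auto)
  have 2: "smooth_on ({s\<in>{0..1}. y s \<in> U} \<inter> {a<..}) (\<phi> \<circ> y)"
    by (rule smooth_on_cong[OF _ smooth_on_subset[OF sm(2)]]) (use y(2) in auto)
  have "smooth_on {s\<in>{0..1}. y s \<in> U} (\<phi> \<circ> y)"
  proof (rule smooth_on_local)
    fix s assume "s \<in> {s\<in>{0..1}. y s \<in> U}"
    show "\<exists>N. open N \<and> s \<in> N \<and> smooth_on ({s\<in>{0..1}. y s \<in> U} \<inter> N) (\<phi> \<circ> y)"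
    proof (cases "s < b")
      case True
      then show ?thesis using 1 by (intro exI[of _ "{..<b}"]) simp
    next
      case False
      then show ?thesis using 2 ab by (intro exI[of _ "{a<..}"]) simp
    qed
  qed
  then show "case c of (U, \<phi>) \<Rightarrow> smooth_on {s\<in>{0..1}. y s \<in> U} (\<phi> \<circ> y)" by (simp add: U)
next
  fix s :: real and f assume s: "s \<in> {0..1}" and f: "f \<in> smooth_funs M"
  have loc: "((\<lambda>r. f (y r)) has_real_derivative V s (y s) f) (at s within {0..1})"
    if z: "solution M V' 1 z" "V s (y s) = V' s (y s)" and N: "open N" "s \<in> N"
      and e: "\<And>r. r \<in> {0..1} \<Longrightarrow> r \<in> N \<Longrightarrow> y r = z r" for V' z N
  proof -
    have d: "((\<lambda>r. f (z r)) has_real_derivative V s (y s) f) (at s within {0..1})"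
      using z s f e[OF s N(2)] unfolding solution_def by metis
    have "\<forall>\<^sub>F r in at s within {0..1}. f (z r) = f (y r)"
      unfolding eventually_at_topological using N e by (intro exI[of _ N]) auto
    from has_derivative_transform_eventually[OF d[unfolded has_field_derivative_def] this _ s]
    show ?thesis using e[OF s N(2)] by (simp add: has_field_derivative_def)
  qed
  show "((\<lambda>r. f (y r)) has_real_derivative V s (y s) f) (at s within {0..1})"
  proof (cases "s < b")
    case True
    show ?thesis by (rule loc[OF sol(1) V(1)[OF s True], of "{..<b}"]) (use True y in auto)
  next
    case False
    then have "s > a" using ab by simp
    then show ?thesis by (intro loc[OF sol(2) V(2)[OF s], of "{a<..}"]) (use y in auto)
  qed
qed

section \<open>Group operations on Hamiltonian flows along X\<close>

context form_mfd
begin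

lemma smooth_time_funs_reparam:
  assumes H: "H \<in> smooth_time_funs M" and \<sigma>: "smooth_on {0..1} \<sigma>" "smooth_on {0..1} \<sigma>'"
    "\<And>s. s \<in> {0..1} \<Longrightarrow> \<sigma> s \<in> {0..1}"
  shows "(\<lambda>t q. \<sigma>' t * H (\<sigma> t) q) \<in> smooth_time_funs M"
proof -
  have "smooth_on ({0..1} \<times> \<phi> ` U) (\<lambda>(t, y). \<sigma>' t * H (\<sigma> t) (inv_into U \<phi> y))" if "(U, \<phi>) \<in> atlas M" for U \<phi>
  proof -
    let ?S = "{0..1::real} \<times> \<phi> ` U"
    have t: "smooth_on ?S (\<lambda>z. \<sigma> (fst z))" "smooth_on ?S (\<lambda>z. \<sigma>' (fst z))"
      by (rule smooth_on_compose[OF smooth_on_fst[OF smooth_on_id] \<sigma>(1)], force,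
          rule smooth_on_compose[OF smooth_on_fst[OF smooth_on_id] \<sigma>(2)], force)
    have 1: "smooth_on ?S (\<lambda>z. (\<sigma> (fst z), snd z))"
      by (intro smooth_on_Pair t smooth_on_snd smooth_on_id)
    have "smooth_on ?S (\<lambda>z. (\<lambda>(t, y). H t (inv_into U \<phi> y)) (\<sigma> (fst z), snd z))"
      by (rule smooth_on_compose[OF 1 smooth_time_funsD[OF H atlas_maximal[OF that]]]) (use \<sigma>(3) in force)
    from smooth_on_mult[OF t(2) this] show ?thesis by (simp add: case_prod_unfold)
  qed
  then show ?thesis by (auto simp: smooth_time_funs_def)
qed

lemma ham_vf_reparam:
  assumes H: "H \<in> smooth_time_funs M" and s: "\<sigma> t \<in> {0..1}" and p: "p \<in> points M"
  shows "ham_vf M \<omega> (\<lambda>t q. \<sigma>' t * H (\<sigma> t) q) t p = (\<lambda>f. \<sigma>' t * ham_vf M \<omega> H (\<sigma> t) p f)"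
  using ham_vf_lincomb[OF H s H s p, of "\<lambda>t q. \<sigma>' t * H (\<sigma> t) q" t "\<sigma>' t" 0] by simp

text \<open>By uniqueness, any family of trajectories starting at the points of X computes the flow.
  Constructions can therefore work with explicit curves and never unfold
  \<open>flow\<close>.\<close>

lemma ham_funsI:
  assumes H: "H \<in> smooth_time_funs M" and g: "\<And>z. z \<in> X \<Longrightarrow> solution M (ham_vf M \<omega> H) 1 (g z)" "\<And>z. z \<in> X \<Longrightarrow> g z 0 = z"
    and im: "\<And>s. s \<in> {0..1} \<Longrightarrow> (\<lambda>z. g z s) ` X = X"
  shows "H \<in> ham_funs M \<omega> X" and "\<And>s z. s \<in> {0..1} \<Longrightarrow> z \<in> X \<Longrightarrow> flow M (ham_vf M \<omega> H) s z = g z s"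
proof -
  show fl: "flow M (ham_vf M \<omega> H) s z = g z s" if "s \<in> {0..1}" "z \<in> X" for s z
    using flow_solution[OF H g(1)[OF that(2)] that(1)] g(2)[OF that(2)] by simp
  have "z \<in> points M" if "z \<in> X" for z
    using solution_in_points[OF g(1)[OF that], of 0] g(2)[OF that] by simp
  then have "X \<subseteq> flow_dom M (ham_vf M \<omega> H) 1"
    using g by (auto simp: flow_dom_def)
  moreover have "flow M (ham_vf M \<omega> H) s ` X = X" if s: "s \<in> {0..1}" for s
    using im[OF s] fl[OF s] by (simp cong: image_cong)
  ultimately show "H \<in> ham_funs M \<omega> X"
    using H by (simp add: ham_funs_def compatible_def)
qed

lemma ham_funsE:
  assumes "H \<in> ham_funs M \<omega> X"
  obtains g where "H \<in> smooth_time_funs M" "\<And>z. z \<in> X \<Longrightarrow> solution M (ham_vf M \<omega> H) 1 (g z)"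
    "\<And>z. z \<in> X \<Longrightarrow> g z 0 = z" "\<And>s. s \<in> {0..1} \<Longrightarrow> (\<lambda>z. g z s) ` X = X"
    "\<And>s z. s \<in> {0..1} \<Longrightarrow> z \<in> X \<Longrightarrow> flow M (ham_vf M \<omega> H) s z = g z s"
proof -
  have H: "H \<in> smooth_time_funs M" using assms by (simp add: ham_funs_def)
  have "\<forall>z\<in>X. \<exists>x. solution M (ham_vf M \<omega> H) 1 x \<and> x 0 = z"
    using assms by (auto simp: ham_funs_def compatible_def flow_dom_def)
  then obtain g where g: "\<And>z. z \<in> X \<Longrightarrow> solution M (ham_vf M \<omega> H) 1 (g z)" "\<And>z. z \<in> X \<Longrightarrow> g z 0 = z"
    by metis
  have fl: "flow M (ham_vf M \<omega> H) s z = g z s" if "s \<in> {0..1}" "z \<in> X" for s z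
    using flow_solution[OF H g(1)[OF that(2)] that(1)] g(2)[OF that(2)] by simp
  have "(\<lambda>z. g z s) ` X = X" if s: "s \<in> {0..1}" for s
  proof -
    have "flow M (ham_vf M \<omega> H) s ` X = X"
      using assms s by (simp add: ham_funs_def compatible_def)
    then show ?thesis using fl[OF s] by (simp cong: image_cong)
  qed
  then show ?thesis
    by (intro that[of g]) (use H g fl in auto)
qed

lemma ham_funs_zero:
  assumes X: "X \<subseteq> points M"
  shows "(\<lambda>t q. 0) \<in> ham_funs M \<omega> X"
proof -
  let ?Z = "\<lambda>(t::real) (q::'a). 0 :: real"
  have Z: "?Z \<in> smooth_time_funs M"
    using smooth_funs_const[of 0] smooth_funs_time by blast
  have vf: "ham_vf M \<omega> ?Z s z = (\<lambda>f. 0)" if "s \<in> {0..1}" "z \<in> points M" for s z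
    using ham_vf_lincomb[OF Z that(1) Z that(1) that(2), of ?Z s 0 0] by simp
  have sol: "solution M (ham_vf M \<omega> ?Z) 1 (\<lambda>s. z)" if "z \<in> X" for z
    unfolding solution_def smooth_curve_def using X that vf by (auto simp: o_def intro: smooth_on_const)
  show "?Z \<in> ham_funs M \<omega> X"
    using ham_funsI(1)[OF Z, of X "\<lambda>z s. z"] sol by auto
qed

text \<open>Trajectories run backwards solve the equation of \<open>G\<close>. They start at the end
  points of the original ones, which fill all of X because the time one map is onto X.\<close>

lemma ham_inverse:
  assumes H: "H \<in> ham_funs M \<omega> X"
  obtains G where "G \<in> ham_funs M \<omega> X"
    "\<And>z. z \<in> X \<Longrightarrow> flow M (ham_vf M \<omega> G) 1 (flow M (ham_vf M \<omega> H) 1 z) = z"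
    "\<And>z. z \<in> X \<Longrightarrow> flow M (ham_vf M \<omega> H) 1 (flow M (ham_vf M \<omega> G) 1 z) = z"
proof -
  obtain g where Hs: "H \<in> smooth_time_funs M" and g: "\<And>z. z \<in> X \<Longrightarrow> solution M (ham_vf M \<omega> H) 1 (g z)"
    "\<And>z. z \<in> X \<Longrightarrow> g z 0 = z" "\<And>s. s \<in> {0..1} \<Longrightarrow> (\<lambda>z. g z s) ` X = X"
    "\<And>s z. s \<in> {0..1} \<Longrightarrow> z \<in> X \<Longrightarrow> flow M (ham_vf M \<omega> H) s z = g z s"
    using that by (rule ham_funsE[OF H])
  define G where "G = (\<lambda>t q. (- 1) * H (1 - t) q)"
  have \<sigma>: "smooth_on {0..1} (\<lambda>s::real. 1 - s)" "smooth_on {0..1} (\<lambda>s::real. - 1 :: real)"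
    by (intro smooth_on_diff smooth_on_const smooth_on_id)+
  have Gs: "G \<in> smooth_time_funs M"
    unfolding G_def by (rule smooth_time_funs_reparam[OF Hs \<sigma>]) auto
  have rev: "solution M (ham_vf M \<omega> G) 1 (\<lambda>s. g z (1 - s))" if z: "z \<in> X" for z
  proof (rule solution_cong)
    show "solution M (\<lambda>t q f. (- 1) * ham_vf M \<omega> H (1 - t) q f) 1 (\<lambda>s. g z (1 - s))"
      by (rule solution_reparam[OF g(1)[OF z] \<sigma>(1)]) (auto intro!: derivative_eq_intros)
    fix s :: real assume s: "s \<in> {0..1}"
    have "g z (1 - s) \<in> points M" using solution_in_points[OF g(1)[OF z]] s by auto
    then show "(\<lambda>f. (- 1) * ham_vf M \<omega> H (1 - s) (g z (1 - s)) f) = ham_vf M \<omega> G s (g z (1 - s))"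
      unfolding G_def using ham_vf_reparam[OF Hs, of "\<lambda>s. 1 - s" s "g z (1 - s)" "\<lambda>s. - 1"] s by simp
  qed
  have "\<forall>z\<in>X. \<exists>w\<in>X. g w 1 = z" using g(3)[of 1] by force
  then obtain w where w: "\<And>z. z \<in> X \<Longrightarrow> w z \<in> X" "\<And>z. z \<in> X \<Longrightarrow> g (w z) 1 = z" by metis
  define k where "k z s = g (w z) (1 - s)" for z s
  have k: "solution M (ham_vf M \<omega> G) 1 (k z)" "k z 0 = z" if "z \<in> X" for z
    using rev[OF w(1)[OF that]] w(2)[OF that] unfolding k_def[abs_def] by auto
  \<comment> \<open>Both curves are trajectories of \<open>G\<close> from \<open>g v 1\<close>, so
    uniqueness removes the dependence on the choice of \<open>w\<close>. At s = 1 this is one of the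
    two inverse identities.\<close>
  have kg: "k (g v 1) s = g v (1 - s)" if v: "v \<in> X" and s: "s \<in> {0..1}" for v s
  proof -
    have z: "g v 1 \<in> X" using g(3)[of 1] v by auto
    show ?thesis
      by (rule solution_unique[OF Gs _ k(1)[OF z] rev[OF v] _ s]) (use k(2)[OF z] in auto)
  qed
  have im: "(\<lambda>z. k z s) ` X = X" if s: "s \<in> {0..1}" for s
  proof
    have s': "1 - s \<in> {0..1}" using s by auto
    show "(\<lambda>z. k z s) ` X \<subseteq> X" using g(3)[OF s'] w(1) by (auto simp: k_def)
    show "X \<subseteq> (\<lambda>z. k z s) ` X"
    proof
      fix u assume "u \<in> X"
      then obtain v where v: "v \<in> X" "u = g v (1 - s)" using g(3)[OF s'] by blast
      then have "u = k (g v 1) s" "g v 1 \<in> X" using kg[OF _ s] g(3)[of 1] by auto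
      then show "u \<in> (\<lambda>z. k z s) ` X" by blast
    qed
  qed
  have I1: "G \<in> ham_funs M \<omega> X"
    by (rule ham_funsI(1)[where g = k, OF Gs]) (erule k(1) k(2) im)+
  have I2: "flow M (ham_vf M \<omega> G) s z = k z s" if "z \<in> X" "s \<in> {0..1}" for s z
    by (rule ham_funsI(2)[where g = k, OF Gs]) (erule k(1) k(2) im | rule that)+
  show ?thesis
  proof (rule that[of G])
    show "G \<in> ham_funs M \<omega> X" by (rule I1)
    fix z assume z: "z \<in> X"
    have gz: "g z 1 \<in> X" using g(3)[of 1] z by auto
    show "flow M (ham_vf M \<omega> G) 1 (flow M (ham_vf M \<omega> H) 1 z) = z"
      using I2[OF gz, of 1] g(4)[OF _ z, of 1] kg[OF z, of 1] g(2)[OF z] by simp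
    show "flow M (ham_vf M \<omega> H) 1 (flow M (ham_vf M \<omega> G) 1 z) = z"
      using I2[OF z, of 1] g(4)[OF _ w(1)[OF z], of 1] w[OF z] g(2)[OF w(1)[OF z]] by (simp add: k_def)
  qed
qed

text \<open>The trajectory of \<open>H\<close> is run first and then that of \<open>K\<close>, each
  compressed into part of the time interval. Only points of X are ever moved.\<close>

lemma ham_compose:
  assumes H: "H \<in> ham_funs M \<omega> X" and K: "K \<in> ham_funs M \<omega> X"
  obtains G where "G \<in> ham_funs M \<omega> X"
    "\<And>z. z \<in> X \<Longrightarrow> flow M (ham_vf M \<omega> G) 1 z = flow M (ham_vf M \<omega> K) 1 (flow M (ham_vf M \<omega> H) 1 z)"
proof -
  obtain g where Hs: "H \<in> smooth_time_funs M" and g: "\<And>z. z \<in> X \<Longrightarrow> solution M (ham_vf M \<omega> H) 1 (g z)"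
    "\<And>z. z \<in> X \<Longrightarrow> g z 0 = z" "\<And>s. s \<in> {0..1} \<Longrightarrow> (\<lambda>z. g z s) ` X = X"
    "\<And>s z. s \<in> {0..1} \<Longrightarrow> z \<in> X \<Longrightarrow> flow M (ham_vf M \<omega> H) s z = g z s"
    using that by (rule ham_funsE[OF H])
  obtain k where Ks: "K \<in> smooth_time_funs M" and k: "\<And>z. z \<in> X \<Longrightarrow> solution M (ham_vf M \<omega> K) 1 (k z)"
    "\<And>z. z \<in> X \<Longrightarrow> k z 0 = z" "\<And>s. s \<in> {0..1} \<Longrightarrow> (\<lambda>z. k z s) ` X = X"
    "\<And>s z. s \<in> {0..1} \<Longrightarrow> z \<in> X \<Longrightarrow> flow M (ham_vf M \<omega> K) s z = k z s"
    using that by (rule ham_funsE[OF K])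
  \<comment> \<open>The change \<sigma> rises from 0 to 1 on [0, 3/8] and \<tau> on [5/8, 1], whence
    the factor 8/3. Between 3/8 and 5/8 both are constant, which gives the overlap needed by
    \<open>solution_glue\<close>.\<close>
  define \<sigma> where "\<sigma> s = step (8 / 3 * s)" for s
  define \<tau> where "\<tau> s = step (8 / 3 * (s - 5 / 8))" for s
  have \<sigma>b: "\<sigma> s \<in> {0..1}" "\<tau> s \<in> {0..1}" for s
    using step_bounds by (auto simp: \<sigma>_def \<tau>_def)
  have \<sigma>1: "\<sigma> s = 1" if "s \<ge> 3 / 8" for s using that by (simp add: \<sigma>_def step_eq_1)
  have \<tau>0: "\<tau> s = 0" if "s \<le> 5 / 8" for s using that by (simp add: \<tau>_def step_eq_0)
  have \<sigma>0: "\<sigma> 0 = 0" and \<tau>1: "\<tau> 1 = 1" by (simp_all add: \<sigma>_def \<tau>_def step_eq_0 step_eq_1)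
  have sm: "smooth_on S \<sigma>" "smooth_on S \<tau>" for S
    unfolding \<sigma>_def \<tau>_def
    by (rule smooth_on_compose[OF _ smooth_on_step[of UNIV]];
        intro smooth_on_mult smooth_on_const smooth_on_diff smooth_on_id UNIV_I)+
  define \<sigma>' where "\<sigma>' s = dirderiv \<sigma> s 1" for s
  define \<tau>' where "\<tau>' s = dirderiv \<tau> s 1" for s
  have sm': "smooth_on S \<sigma>'" "smooth_on S \<tau>'" for S
    unfolding \<sigma>'_def \<tau>'_def
    by (rule smooth_on_subset[OF smooth_on_dirderiv[OF sm(1)[of UNIV]]],
        auto intro: open_along_open,
        rule smooth_on_subset[OF smooth_on_dirderiv[OF sm(2)[of UNIV]]],
        auto intro: open_along_open)
  have der1: "(\<rho> has_real_derivative dirderiv \<rho> s 1) (at s)" if "smooth_on UNIV \<rho>" for \<rho> :: "real \<Rightarrow> real" and s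
  proof -
    have "((\<lambda>r. \<rho> (r + s)) has_real_derivative dirderiv \<rho> s 1) (at 0)"
      using has_real_derivative_dirderiv[OF that open_along_open[OF open_UNIV], of s 1] by (simp add: add.commute)
    then show ?thesis using DERIV_shift[of \<rho> "dirderiv \<rho> s 1" 0 s] by simp
  qed
  have d: "(\<sigma> has_real_derivative \<sigma>' s) (at s)" "(\<tau> has_real_derivative \<tau>' s) (at s)" for s
    unfolding \<sigma>'_def \<tau>'_def using der1 sm by blast+
  have \<sigma>'0: "\<sigma>' s = 0" if "s > 3 / 8" for s
  proof -
    have "(\<sigma> has_real_derivative 0) (at s)"
      by (rule has_field_derivative_transform_within_open[OF DERIV_const[of 1], of "{3/8<..}"])
        (use that \<sigma>1 in auto)
    then show ?thesis using d(1) DERIV_unique by blast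
  qed
  have \<tau>'0: "\<tau>' s = 0" if "s < 5 / 8" for s
  proof -
    have "(\<tau> has_real_derivative 0) (at s)"
      by (rule has_field_derivative_transform_within_open[OF DERIV_const[of 0], of "{..<5/8}"])
        (use that \<tau>0 in auto)
    then show ?thesis using d(2) DERIV_unique by blast
  qed
  define G where "G = (\<lambda>t q. \<sigma>' t * H (\<sigma> t) q + \<tau>' t * K (\<tau> t) q)"
  have Gs: "G \<in> smooth_time_funs M"
    unfolding G_def
    by (intro smooth_time_funs_add smooth_time_funs_reparam Hs Ks sm sm' \<sigma>b)
  have vf: "ham_vf M \<omega> G s q = (\<lambda>f. \<sigma>' s * ham_vf M \<omega> H (\<sigma> s) q f + \<tau>' s * ham_vf M \<omega> K (\<tau> s) q f)"
    if "q \<in> points M" for s q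
    by (rule ham_vf_lincomb[OF Hs \<sigma>b(1) Ks \<sigma>b(2) that]) (simp add: G_def)
  \<comment> \<open>From 3/8 to 5/8 both expressions equal \<open>g z 1\<close>, so the switch at
    1/2 is invisible.\<close>
  define m where "m z s = (if s \<le> 1 / 2 then g z (\<sigma> s) else k (g z 1) (\<tau> s))" for z s
  have gX: "g z s \<in> X" if "z \<in> X" "s \<in> {0..1}" for z s using g(3)[OF that(2)] that(1) by blast
  have kX: "k z s \<in> X" if "z \<in> X" "s \<in> {0..1}" for z s using k(3)[OF that(2)] that(1) by blast
  have XM: "z \<in> points M" if "z \<in> X" for z
    using solution_in_points[OF g(1)[OF that], of 0] g(2)[OF that] by simp
  have mX: "m z s \<in> X" if "z \<in> X" for z s
    using gX[OF that] kX[OF gX[OF that]] \<sigma>b by (simp add: m_def)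
  have sol: "solution M (ham_vf M \<omega> G) 1 (m z)" if z: "z \<in> X" for z
  proof (rule solution_glue[where a = "3 / 8" and b = "5 / 8"])
    have z1: "g z 1 \<in> X" using gX[OF z] by simp
    show "solution M (\<lambda>t q f. \<sigma>' t * ham_vf M \<omega> H (\<sigma> t) q f) 1 (\<lambda>s. g z (\<sigma> s))"
      by (rule solution_reparam[OF g(1)[OF z] sm(1) \<sigma>b(1)]) (rule has_field_derivative_at_within[OF d(1)])
    show "solution M (\<lambda>t q f. \<tau>' t * ham_vf M \<omega> K (\<tau> t) q f) 1 (\<lambda>s. k (g z 1) (\<tau> s))"
      by (rule solution_reparam[OF k(1)[OF z1] sm(2) \<sigma>b(2)]) (rule has_field_derivative_at_within[OF d(2)])
    show "m z s = g z (\<sigma> s)" if "s < 5 / 8" for s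
      using that \<sigma>1[of s] \<tau>0[of s] k(2)[OF z1] by (simp add: m_def)
    show "m z s = k (g z 1) (\<tau> s)" if "s > 3 / 8" for s
      using that \<sigma>1[of s] \<tau>0[of s] k(2)[OF z1] by (simp add: m_def)
    show "ham_vf M \<omega> G s (m z s) = (\<lambda>f. \<sigma>' s * ham_vf M \<omega> H (\<sigma> s) (m z s) f)" if "s < 5 / 8" for s
      using vf[OF XM[OF mX[OF z]]] \<tau>'0[OF that] by simp
    show "ham_vf M \<omega> G s (m z s) = (\<lambda>f. \<tau>' s * ham_vf M \<omega> K (\<tau> s) (m z s) f)" if "s > 3 / 8" for s
      using vf[OF XM[OF mX[OF z]]] \<sigma>'0[OF that] by simp
  qed simp
  have m0: "m z 0 = z" if "z \<in> X" for z
    using g(2)[OF that] by (simp add: m_def \<sigma>0)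
  have im: "(\<lambda>z. m z s) ` X = X" if s: "s \<in> {0..1}" for s
  proof (cases "s \<le> 1 / 2")
    case True
    then show ?thesis using g(3)[OF \<sigma>b(1)] by (simp add: m_def)
  next
    case False
    then have "(\<lambda>z. m z s) ` X = (\<lambda>z. k z (\<tau> s)) ` (\<lambda>z. g z 1) ` X"
      by (simp add: m_def image_image)
    then show ?thesis using g(3)[of 1] k(3)[OF \<sigma>b(2)] by simp
  qed
  have I1: "G \<in> ham_funs M \<omega> X"
    by (rule ham_funsI(1)[where g = m, OF Gs]) (erule sol m0 im)+
  have I2: "flow M (ham_vf M \<omega> G) s z = m z s" if "z \<in> X" "s \<in> {0..1}" for s z
    by (rule ham_funsI(2)[where g = m, OF Gs]) (erule sol m0 im | rule that)+
  show ?thesis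
  proof (rule that[of G])
    show "G \<in> ham_funs M \<omega> X" by (rule I1)
    fix z assume z: "z \<in> X"
    show "flow M (ham_vf M \<omega> G) 1 z = flow M (ham_vf M \<omega> K) 1 (flow M (ham_vf M \<omega> H) 1 z)"
      using I2[OF z, of 1] g(4)[OF _ z, of 1] k(4)[OF _ gX[OF z], of 1 1] by (simp add: m_def \<tau>1)
  qed
qed

text \<open>The inverse of a time one map is again a time one map, so continuity of flows serves in
  both directions.\<close>

lemma Ham_homeomorphic:
  assumes X: "X \<subseteq> points M" and f: "f \<in> Ham X M \<omega>"
  shows "f \<in> extensional X" "homeomorphic_map (subtopology (mtop M) X) (subtopology (mtop M) X) f"
proof -
  let ?T = "subtopology (mtop M) X"
  have T: "topspace ?T = X" using X by auto
  obtain H where H: "H \<in> ham_funs M \<omega> X" and fH: "f = restrict (flow M (ham_vf M \<omega> H) 1) X"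
    using f by (auto simp: Ham_def)
  obtain G where G: "G \<in> ham_funs M \<omega> X"
    "\<And>z. z \<in> X \<Longrightarrow> flow M (ham_vf M \<omega> G) 1 (flow M (ham_vf M \<omega> H) 1 z) = z"
    "\<And>z. z \<in> X \<Longrightarrow> flow M (ham_vf M \<omega> H) 1 (flow M (ham_vf M \<omega> G) 1 z) = z"
    using that by (rule ham_inverse[OF H])
  have c: "continuous_map ?T ?T (flow M (ham_vf M \<omega> K) 1)" if "K \<in> ham_funs M \<omega> X" for K
  proof -
    have K: "K \<in> smooth_time_funs M" "X \<subseteq> flow_dom M (ham_vf M \<omega> K) 1" "flow M (ham_vf M \<omega> K) 1 ` X = X"
      using that by (auto simp: ham_funs_def compatible_def)
    show ?thesis
      using flow_continuous[OF K(1,2), of 1] K(3) T by (auto simp: continuous_map_in_subtopology)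
  qed
  have "homeomorphic_maps ?T ?T (flow M (ham_vf M \<omega> H) 1) (flow M (ham_vf M \<omega> G) 1)"
    unfolding homeomorphic_maps_def using c[OF H] c[OF G(1)] G(2,3) T by simp
  then have "homeomorphic_map ?T ?T (flow M (ham_vf M \<omega> H) 1)"
    using homeomorphic_map_maps by blast
  then show "homeomorphic_map ?T ?T f"
    by (rule homeomorphic_map_eq) (simp add: fH T)
  show "f \<in> extensional X" by (simp add: fH)
qed

lemma Ham_subgroup:
  assumes X: "X \<subseteq> points M"
  shows "subgroup (Ham X M \<omega>) (HomeoGroup (subtopology (mtop M) X))"
proof -
  let ?T = "subtopology (mtop M) X" and ?Fl = "\<lambda>H. restrict (flow M (ham_vf M \<omega> H) 1) X"
  let ?G = "HomeoGroup ?T"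
  have T: "topspace ?T = X" using X by auto
  have carr: "carrier ?G = {f \<in> extensional X. homeomorphic_map ?T ?T f}"
    unfolding HomeoGroup_def T by simp
  have sub: "Ham X M \<omega> \<subseteq> carrier ?G"
    using Ham_homeomorphic[OF X] by (auto simp: carr)
  have Bij: "f \<in> Bij X" if "f \<in> Ham X M \<omega>" for f
    using homeo_in_Bij[of f ?T, unfolded T] Ham_homeomorphic[OF X that] by blast
  have mult: "f \<otimes>\<^bsub>?G\<^esub> g = compose X f g" if "f \<in> Ham X M \<omega>" "g \<in> Ham X M \<omega>" for f g
    using Bij[OF that(1)] Bij[OF that(2)] unfolding HomeoGroup_def BijGroup_def T by simp
  have one: "\<one>\<^bsub>?G\<^esub> = (\<lambda>x\<in>X. x)"
    unfolding HomeoGroup_def BijGroup_def T by simp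
  interpret G: group ?G by (rule group_HomeoGroup)
  have im: "flow M (ham_vf M \<omega> H) 1 z \<in> X" if "H \<in> ham_funs M \<omega> X" "z \<in> X" for H z
  proof -
    have "flow M (ham_vf M \<omega> H) 1 ` X = X"
      using that(1) by (simp add: ham_funs_def compatible_def)
    then show ?thesis using that(2) by blast
  qed
  show ?thesis
  proof (rule G.subgroupI[OF sub])
    show "Ham X M \<omega> \<noteq> {}" using ham_funs_zero[OF X] by (auto simp: Ham_def)
    fix f assume f: "f \<in> Ham X M \<omega>"
    obtain H where H: "H \<in> ham_funs M \<omega> X" and fH: "f = ?Fl H"
      using f by (auto simp: Ham_def)
    show "inv\<^bsub>?G\<^esub> f \<in> Ham X M \<omega>"
    proof -
      obtain K where K: "K \<in> ham_funs M \<omega> X"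
        "\<And>z. z \<in> X \<Longrightarrow> flow M (ham_vf M \<omega> K) 1 (flow M (ham_vf M \<omega> H) 1 z) = z"
        "\<And>z. z \<in> X \<Longrightarrow> flow M (ham_vf M \<omega> H) 1 (flow M (ham_vf M \<omega> K) 1 z) = z"
        using that by (rule ham_inverse[OF H])
      have K': "?Fl K \<in> Ham X M \<omega>" using K(1) by (auto simp: Ham_def)
      have "compose X (?Fl K) f = (\<lambda>x\<in>X. x)"
        using K(2) im[OF H] by (auto simp: compose_def fH fun_eq_iff)
      then have "?Fl K \<otimes>\<^bsub>?G\<^esub> f = \<one>\<^bsub>?G\<^esub>" using mult[OF K' f] one by simp
      then have "inv\<^bsub>?G\<^esub> f = ?Fl K"
        using G.inv_equality sub f K' by blast
      then show ?thesis using K' by simp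
    qed
    fix f' assume f': "f' \<in> Ham X M \<omega>"
    obtain K where K: "K \<in> ham_funs M \<omega> X" and fK: "f' = ?Fl K"
      using f' by (auto simp: Ham_def)
    \<comment> \<open>In the product of \<open>f\<close> and \<open>f'\<close> the map
      \<open>f'\<close> acts first, so its Hamiltonian \<open>K\<close> is the first argument of the
      concatenation.\<close>
    obtain L where L: "L \<in> ham_funs M \<omega> X"
      "\<And>z. z \<in> X \<Longrightarrow> flow M (ham_vf M \<omega> L) 1 z = flow M (ham_vf M \<omega> H) 1 (flow M (ham_vf M \<omega> K) 1 z)"
      using that by (rule ham_compose[OF K H])
    have "compose X f f' = ?Fl L"
      using L(2) im[OF K] by (auto simp: compose_def fH fK fun_eq_iff)
    then show "f \<otimes>\<^bsub>?G\<^esub> f' \<in> Ham X M \<omega>"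
      using mult[OF f f'] L(1) by (auto simp: Ham_def)
  qed
qed

end

section \<open>Symplectic submanifolds\<close>

context smooth_mfd
begin

lemma smooth_curve_localI:
  assumes x: "continuous_map (top_of_set T) (mtop M) x" and d: "(V, \<psi>) \<in> maximal_atlas M"
    and loc: "\<And>s. s \<in> T \<Longrightarrow> x s \<in> V \<Longrightarrow>
      \<exists>U \<phi>. (U, \<phi>) \<in> maximal_atlas M \<and> x s \<in> U \<and> smooth_on {r\<in>T. x r \<in> U} (\<phi> \<circ> x)"
  shows "smooth_on {r\<in>T. x r \<in> V} (\<psi> \<circ> x)"
proof (rule smooth_on_local)
  fix s assume "s \<in> {r\<in>T. x r \<in> V}"
  then have s: "s \<in> T" "x s \<in> V" by auto
  obtain U \<phi> where U: "(U, \<phi>) \<in> maximal_atlas M" "x s \<in> U" "smooth_on {r\<in>T. x r \<in> U} (\<phi> \<circ> x)"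
    using loc[OF s] by blast
  obtain N where N: "open N" "{r\<in>T. x r \<in> U} = T \<inter> N"
    using continuous_curve_open[OF x chart_open[OF U(1)]] by (auto simp: openin_open)
  have sub: "x r \<in> U" if "r \<in> {r\<in>T. x r \<in> V} \<inter> N" for r using that N(2) by blast
  have 1: "smooth_on ({r\<in>T. x r \<in> V} \<inter> N) (\<phi> \<circ> x)"
    by (rule smooth_on_subset[OF U(3)]) (use sub in auto)
  have "smooth_on ({r\<in>T. x r \<in> V} \<inter> N) (\<lambda>r. \<psi> (inv_into U \<phi> ((\<phi> \<circ> x) r)))"
    by (rule smooth_on_compose[where g = "\<lambda>y. \<psi> (inv_into U \<phi> y)", OF 1 maximal_transition[OF U(1) d]])
      (use sub in auto)
  then have "smooth_on ({r\<in>T. x r \<in> V} \<inter> N) (\<psi> \<circ> x)"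
    by (rule smooth_on_cong[rotated]) (use sub chart_inv[OF U(1)] in auto)
  then show "\<exists>N. open N \<and> s \<in> N \<and> smooth_on ({r\<in>T. x r \<in> V} \<inter> N) (\<psi> \<circ> x)"
    using N s U(2) by blast
qed

lemma smooth_time_funs_locally_eq:
  assumes "\<And>p. p \<in> points M \<Longrightarrow>
    \<exists>W G. openin (mtop M) W \<and> p \<in> W \<and> G \<in> smooth_time_funs M \<and> (\<forall>q\<in>W. \<forall>t\<in>{0..1}. H t q = G t q)"
  shows "H \<in> smooth_time_funs M"
proof (rule smooth_time_funsI)
  fix p assume p: "p \<in> points M"
  obtain W G where W: "openin (mtop M) W" "p \<in> W" "G \<in> smooth_time_funs M" "\<forall>q\<in>W. \<forall>t\<in>{0..1}. H t q = G t q"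
    using assms[OF p] by blast
  obtain U \<phi> where U: "(U, \<phi>) \<in> atlas M" "p \<in> U" using atlas_cover[OF p] by blast
  note c = atlas_maximal[OF U(1)]
  have "smooth_on ({0..1} \<times> \<phi> ` (U \<inter> W)) (\<lambda>(t, y). H t (inv_into U \<phi> y))"
    by (rule smooth_on_cong[OF _ smooth_on_subset[OF smooth_time_funsD[OF W(3) c]]])
      (use W(4) chart_inv[OF c] in auto)
  then show "\<exists>U \<phi> W. (U, \<phi>) \<in> maximal_atlas M \<and> openin (mtop M) W \<and> p \<in> W \<and> W \<subseteq> U \<and>
       smooth_on ({0..1} \<times> \<phi> ` W) (\<lambda>(t, y). H t (inv_into U \<phi> y))"
    using U W c openin_Int[OF chart_open[OF c] W(1)]
    by (intro exI[of _ U] exI[of _ \<phi>] exI[of _ "U \<inter> W"]) simp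
qed

end

text \<open>Near \<open>s\<close> the curve equals its projection to \<open>F\<close>, whose
  derivative is the projection of \<open>e\<close>. Derivatives at a limit point are unique, so
  \<open>e\<close> is its own projection.\<close>

lemma vector_derivative_in_subspace:
  fixes y :: "real \<Rightarrow> 'e::euclidean_space"
  assumes F: "subspace F" and y: "(y has_vector_derivative e) (at s within T)" "y s \<in> F"
    and ev: "\<forall>\<^sub>F r in at s within T. y r \<in> F" and s: "s islimpt T" "s \<in> T"
  shows "e \<in> F"
proof -
  obtain B where B: "orthonormal_basis F B" using orthonormal_basis_exists[OF F] .
  have d: "((\<lambda>r. onb_proj B (y r)) has_vector_derivative onb_proj B e) (at s within T)"
    by (rule bounded_linear.has_vector_derivative[OF bounded_linear_onb_proj y(1)])
  have "\<forall>\<^sub>F r in at s within T. onb_proj B (y r) = y r"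
    using ev by eventually_elim (rule onb_proj_id[OF B])
  from has_derivative_transform_eventually[OF d[unfolded has_vector_derivative_def] this onb_proj_id[OF B y(2)] s(2)]
  have "(y has_vector_derivative onb_proj B e) (at s within T)"
    by (simp add: has_vector_derivative_def)
  with y(1) have "onb_proj B e = e"
    using vector_derivative_unique_within s(1) trivial_limit_within by blast
  then show ?thesis using onb_proj_in[OF F B, of e] by simp
qed

locale symplectic_sub =
  fixes M :: "('a, 'e::euclidean_space) mfd" and \<omega> :: "'a form2" and F :: "'e set" and X :: "'a set"
  assumes symp: "symplectic_manifold M \<omega>" and closed: "closedin (mtop M) X"
    and sub: "symplectic_submanifold M \<omega> F X"
begin

section \<open>The manifold structure and the form induced on X\<close>

abbreviation N :: "('a, 'e) mfd" where "N \<equiv> submfd M F X"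
abbreviation \<tau> :: "'a form2" where "\<tau> \<equiv> restrict_form M \<omega>"

sublocale form_mfd M \<omega> by (rule symplectic_form_mfd[OF symp])

lemma F: "subspace F" "F \<subseteq> model M" and X_points: "X \<subseteq> points M"
  using sub by (auto simp: symplectic_submanifold_def submanifold_def)

lemma slice_cover: "p \<in> X \<Longrightarrow> \<exists>U \<phi>. (U, \<phi>) \<in> slice_charts M F X \<and> p \<in> U"
  using sub by (force simp: symplectic_submanifold_def submanifold_def)

lemma slice_maximal: "(U, \<phi>) \<in> slice_charts M F X \<Longrightarrow> (U, \<phi>) \<in> maximal_atlas M"
  by (simp add: slice_charts_def)

lemma slice_image: "(U, \<phi>) \<in> slice_charts M F X \<Longrightarrow> \<phi> ` (U \<inter> X) = \<phi> ` U \<inter> F"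
  by (simp add: slice_charts_def)

lemma mtop_N: "mtop N = subtopology (mtop M) X" and model_N: "model N = F"
  by (simp_all add: submfd_def)

lemma points_N: "points N = X"
  using X_points by (auto simp: mtop_N)

lemma atlas_N: "c \<in> atlas N \<longleftrightarrow> (\<exists>U \<phi>. (U, \<phi>) \<in> slice_charts M F X \<and> c = (U \<inter> X, \<phi>))"
  by (force simp: submfd_def)

lemma slice_inv:
  assumes "(U, \<phi>) \<in> slice_charts M F X" "q \<in> U" "q \<in> X"
  shows "inv_into (U \<inter> X) \<phi> (\<phi> q) = q" "inv_into U \<phi> (\<phi> q) = q"
  using assms chart_inj[OF slice_maximal[OF assms(1)]] inj_on_subset[of \<phi> U "U \<inter> X"] by auto

lemma slice_is_chart:
  assumes c: "(U, \<phi>) \<in> slice_charts M F X"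
  shows "is_chart N (U \<inter> X, \<phi>)"
proof -
  note m = slice_maximal[OF c]
  have "openin (mtop N) (U \<inter> X)"
    using chart_open[OF m] by (auto simp: mtop_N openin_subtopology)
  moreover have "openin (top_of_set (model N)) (\<phi> ` (U \<inter> X))"
  proof -
    obtain T where "open T" "\<phi> ` U = model M \<inter> T"
      using chart_image_open[OF m] by (auto simp: openin_open)
    then show ?thesis
      using F(2) by (auto simp: openin_open model_N slice_image[OF c] intro!: exI[of _ T])
  qed
  moreover have "homeomorphic_map (subtopology (mtop N) (U \<inter> X)) (top_of_set (\<phi> ` (U \<inter> X))) \<phi>"
  proof -
    have "homeomorphic_map (subtopology (subtopology (mtop M) U) X) (subtopology (top_of_set (\<phi> ` U)) F) \<phi>"
    proof (rule homeomorphic_map_subtopologies[OF chart_homeomorphic[OF m]])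
      have "topspace (subtopology (mtop M) U) = U" using chart_subset[OF m] by auto
      then show "\<phi> ` (topspace (subtopology (mtop M) U) \<inter> X) = topspace (top_of_set (\<phi> ` U)) \<inter> F"
        using slice_image[OF c] by simp
    qed
    moreover have "X \<inter> (U \<inter> X) = U \<inter> X" by blast
    ultimately show ?thesis
      by (simp add: mtop_N subtopology_subtopology slice_image[OF c])
  qed
  ultimately show ?thesis by (simp add: is_chart_def)
qed

lemma slice_transition:
  assumes c: "(U, \<phi>) \<in> slice_charts M F X" and d: "(V, \<psi>) \<in> slice_charts M F X"
  shows "smooth_transition (U \<inter> X, \<phi>) (V \<inter> X, \<psi>)"
proof -
  have "smooth_on (\<phi> ` ((U \<inter> X) \<inter> (V \<inter> X))) (\<psi> \<circ> inv_into (U \<inter> X) \<phi>)"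
    by (rule smooth_on_cong[OF _ smooth_on_subset[OF maximal_transition[OF slice_maximal[OF c] slice_maximal[OF d]]]])
      (use slice_inv[OF c] in auto)
  then show ?thesis by (simp add: smooth_transition_def)
qed

lemma smooth_manifold_N: "smooth_manifold N"
  unfolding smooth_manifold_def
proof (intro conjI ballI)
  show "Hausdorff_space (mtop N)"
    unfolding mtop_N by (rule Hausdorff_space_subtopology[OF Hausdorff])
  show "second_countable (mtop N)"
    unfolding mtop_N using mfd by (intro second_countable_subtopology) (simp add: smooth_manifold_def)
  show "subspace (model N)" using F by (simp add: model_N)
  show "is_chart N c" if "c \<in> atlas N" for c
    using that slice_is_chart by (auto simp: atlas_N)
  show "\<Union> (fst ` atlas N) = points N"
  proof
    show "\<Union> (fst ` atlas N) \<subseteq> points N"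
      unfolding points_N by (auto simp: atlas_N)
    show "points N \<subseteq> \<Union> (fst ` atlas N)"
    proof
      fix p assume "p \<in> points N"
      then have p: "p \<in> X" by (simp only: points_N)
      then obtain U \<phi> where "(U, \<phi>) \<in> slice_charts M F X" "p \<in> U" using slice_cover by blast
      then have "(U \<inter> X, \<phi>) \<in> atlas N" "p \<in> U \<inter> X" using p by (auto simp: atlas_N)
      then show "p \<in> \<Union> (fst ` atlas N)" by force
    qed
  qed
  show "smooth_transition c d" if "c \<in> atlas N" "d \<in> atlas N" for c d
    using that slice_transition by (auto simp: atlas_N)
qed

interpretation NM: smooth_mfd N by unfold_locales (rule smooth_manifold_N)

lemma slice_atlas_N: "(U, \<phi>) \<in> slice_charts M F X \<Longrightarrow> (U \<inter> X, \<phi>) \<in> atlas N"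
  by (auto simp: atlas_N)

lemma slice_maximal_N: "(U, \<phi>) \<in> slice_charts M F X \<Longrightarrow> (U \<inter> X, \<phi>) \<in> maximal_atlas N"
  using NM.atlas_maximal slice_atlas_N by blast

lemma smooth_time_funs_restrict:
  assumes H: "H \<in> smooth_time_funs M" shows "H \<in> smooth_time_funs N"
proof -
  have "smooth_on ({0..1} \<times> \<phi> ` (U \<inter> X)) (\<lambda>(t, y). H t (inv_into (U \<inter> X) \<phi> y))"
    if c: "(U, \<phi>) \<in> slice_charts M F X" for U \<phi>
    by (rule smooth_on_cong[OF _ smooth_on_subset[OF smooth_time_funsD[OF H slice_maximal[OF c]]]])
      (use slice_inv[OF c] in auto)
  then show ?thesis by (auto simp: smooth_time_funs_def atlas_N)
qed

lemma smooth_funs_restrict: "f \<in> smooth_funs M \<Longrightarrow> f \<in> smooth_funs N"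
  using smooth_time_funs_restrict[of "\<lambda>t. f"] smooth_funs_time NM.smooth_funs_time by blast

text \<open>Both vectors differentiate along the same line in the slice chart. As \<open>e\<close>
  lies in \<open>F\<close>, the line stays in the image of X for small parameters, where the two
  inverse charts agree.\<close>

lemma incl_cvec:
  assumes c: "(U, \<phi>) \<in> slice_charts M F X" and p: "p \<in> U" "p \<in> X" and e: "e \<in> F"
  shows "incl_diff M (cvec N (U \<inter> X) \<phi> p e) = cvec M U \<phi> p e"
proof
  fix f :: "'a \<Rightarrow> real"
  have "open_along (\<phi> ` (U \<inter> X)) e"
    using NM.open_along_chart[OF slice_maximal_N[OF c] NM.chart_open[OF slice_maximal_N[OF c]] subset_refl] e
    by (simp add: model_N)
  then have "\<forall>\<^sub>F r in nhds 0. \<phi> p + r *\<^sub>R e \<in> \<phi> ` (U \<inter> X)"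
    using p by (auto simp: open_along_def)
  then have "\<forall>\<^sub>F r in nhds 0. (f \<circ> inv_into (U \<inter> X) \<phi>) (\<phi> p + r *\<^sub>R e) = (f \<circ> inv_into U \<phi>) (\<phi> p + r *\<^sub>R e)"
    by eventually_elim (use slice_inv[OF c] in auto)
  from dirderiv_cong[OF this]
  show "incl_diff M (cvec N (U \<inter> X) \<phi> p e) f = cvec M U \<phi> p e f"
    using smooth_funs_restrict by (simp add: incl_diff_def cvec_def o_def)
qed

lemma tangent_N:
  assumes c: "(U, \<phi>) \<in> slice_charts M F X" and p: "p \<in> U" "p \<in> X" and v: "v \<in> tangent_space N p"
  obtains e where "e \<in> F" "v = cvec N (U \<inter> X) \<phi> p e" "incl_diff M v = cvec M U \<phi> p e"
proof -
  obtain e where e: "e \<in> model N" "v = cvec N (U \<inter> X) \<phi> p e"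
    using NM.tangent_eq_cvec[OF slice_maximal_N[OF c] _ v] p by blast
  then show ?thesis
    using that[of e] incl_cvec[OF c p] by (simp add: model_N)
qed

lemma incl_tangent:
  assumes p: "p \<in> X" and v: "v \<in> tangent_space N p"
  shows "incl_diff M v \<in> tangent_space M p"
proof -
  obtain U \<phi> where c: "(U, \<phi>) \<in> slice_charts M F X" "p \<in> U" using slice_cover[OF p] by blast
  obtain e where "e \<in> F" "incl_diff M v = cvec M U \<phi> p e"
    using tangent_N[OF c p v] by blast
  then show ?thesis
    using cvec_tangent[OF slice_maximal[OF c(1)] c(2), of e] F(2) by auto
qed

text \<open>In a slice chart the coefficients of the restricted form are those of \<omega>,
  restricted to directions in \<open>F\<close> and to points of X. The algebraic properties pass
  through the linear map \<open>incl_diff\<close>.\<close>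

lemma form_mfd_N: "form_mfd N \<tau>"
proof unfold_locales
  show "nondegenerate N \<tau>" using sub by (simp add: symplectic_submanifold_def)
  fix p u v w and a b :: real
  assume "p \<in> points N" and t: "u \<in> tangent_space N p" "v \<in> tangent_space N p" "w \<in> tangent_space N p"
  then have p: "p \<in> X" "p \<in> points M" using points_N X_points by auto
  have "incl_diff M (\<lambda>f. a * u f + b * v f) = (\<lambda>f. a * incl_diff M u f + b * incl_diff M v f)"
    by (auto simp: incl_diff_def)
  then show "\<tau> p (\<lambda>f. a * u f + b * v f) w = a * \<tau> p u w + b * \<tau> p v w"
    using form_lin[OF p(2) incl_tangent[OF p(1) t(1)] incl_tangent[OF p(1) t(2)] incl_tangent[OF p(1) t(3)]]
    by (simp add: restrict_form_def)
next
  fix p v w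
  assume "p \<in> points N" and t: "v \<in> tangent_space N p" "w \<in> tangent_space N p"
  then have p: "p \<in> X" "p \<in> points M" using points_N X_points by auto
  show "\<tau> p v w = - \<tau> p w v"
    using form_skew[OF p(2) incl_tangent[OF p(1) t(1)] incl_tangent[OF p(1) t(2)]]
    by (simp add: restrict_form_def)
next
  fix V \<phi> e e'
  assume "(V, \<phi>) \<in> atlas N" "e \<in> model N" "e' \<in> model N"
  then obtain U where c: "(U, \<phi>) \<in> slice_charts M F X" and V: "V = U \<inter> X" and e: "e \<in> F" "e' \<in> F"
    by (auto simp: atlas_N model_N)
  have "smooth_on (\<phi> ` U) (\<lambda>y. \<omega> (inv_into U \<phi> y) (cvec M U \<phi> (inv_into U \<phi> y) e) (cvec M U \<phi> (inv_into U \<phi> y) e'))"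
    using symplectic_form_coeff[OF symp slice_maximal[OF c]] e F(2) by blast
  then show "smooth_on (\<phi> ` V) (\<lambda>y. \<tau> (inv_into V \<phi> y) (cvec N V \<phi> (inv_into V \<phi> y) e) (cvec N V \<phi> (inv_into V \<phi> y) e'))"
    by (rule smooth_on_cong[OF _ smooth_on_subset, rotated])
      (use slice_inv[OF c] incl_cvec[OF c] e in \<open>auto simp: V restrict_form_def\<close>)
qed

section \<open>Comparison of trajectories in X and in M\<close>

interpretation NF: form_mfd N \<tau> by (rule form_mfd_N)

text \<open>The equation in M tests only functions that restrict to smooth functions on X. Slice
  charts cover all positions of the curve, so its smoothness can be checked in them.\<close>

lemma solution_N_imp_M:
  assumes eq: "\<And>s q. s \<in> {0..1} \<Longrightarrow> q \<in> X \<Longrightarrow> incl_diff M (V s q) = V' s q"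
    and sol: "solution N V 1 x"
  shows "solution M V' 1 x"
  unfolding solution_def smooth_curve_def
proof (intro conjI ballI)
  have xX: "x s \<in> X" if "s \<in> {0..1}" for s
    using solution_in_points[OF sol that] points_N by simp
  have "continuous_map (top_of_set {0..1}) (subtopology (mtop M) X) x"
    using solution_continuous[OF sol] by (simp add: mtop_N)
  then show cont: "continuous_map (top_of_set {0..1}) (mtop M) x"
    by (simp add: continuous_map_in_subtopology)
  fix c assume c: "c \<in> atlas M"
  obtain W \<psi> where W: "c = (W, \<psi>)" by (cases c)
  have "smooth_on {s\<in>{0..1}. x s \<in> W} (\<psi> \<circ> x)"
  proof (rule smooth_curve_localI[OF cont atlas_maximal])
    show "(W, \<psi>) \<in> atlas M" using c W by simp
    fix s :: real assume s: "s \<in> {0..1}"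
    obtain U \<phi> where U: "(U, \<phi>) \<in> slice_charts M F X" "x s \<in> U" using slice_cover[OF xX[OF s]] by blast
    have "smooth_on {r\<in>{0..1}. x r \<in> U \<inter> X} (\<phi> \<circ> x)"
      using sol slice_atlas_N[OF U(1)] unfolding solution_def smooth_curve_def by blast
    moreover have "{r\<in>{0..1}. x r \<in> U \<inter> X} = {r\<in>{0..1}. x r \<in> U}" using xX by auto
    ultimately show "\<exists>U \<phi>. (U, \<phi>) \<in> maximal_atlas M \<and> x s \<in> U \<and> smooth_on {r\<in>{0..1}. x r \<in> U} (\<phi> \<circ> x)"
      using slice_maximal[OF U(1)] U(2) by auto
  qed
  then show "case c of (U, \<phi>) \<Rightarrow> smooth_on {s\<in>{0..1}. x s \<in> U} (\<phi> \<circ> x)" by (simp add: W)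
next
  fix s :: real and f assume s: "s \<in> {0..1}" and f: "f \<in> smooth_funs M"
  have "x s \<in> X" using solution_in_points[OF sol s] points_N by simp
  then have "V s (x s) f = V' s (x s) f"
    using eq[OF s, of "x s"] f by (metis incl_diff_def)
  then show "((\<lambda>r. f (x r)) has_real_derivative V' s (x s) f) (at s within {0..1})"
    using sol s smooth_funs_restrict[OF f] unfolding solution_def by metis
qed

text \<open>The equation in X has to be tested with functions given on X only. It is verified in a
  slice chart: the curve in coordinates has its derivative in \<open>F\<close>, and the chain rule
  along directions of \<open>F\<close> applies to the function in that chart.\<close>

lemma solution_M_imp_N:
  assumes eq: "\<And>s q. s \<in> {0..1} \<Longrightarrow> q \<in> X \<Longrightarrow> incl_diff M (V s q) = V' s q"
    and V: "\<And>s q. s \<in> {0..1} \<Longrightarrow> q \<in> X \<Longrightarrow> V s q \<in> tangent_space N q"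
    and sol: "solution M V' 1 x" and xX: "\<And>s. s \<in> {0..1} \<Longrightarrow> x s \<in> X"
  shows "solution N V 1 x"
  unfolding solution_def smooth_curve_def
proof (intro conjI ballI)
  note cont = solution_continuous[OF sol]
  show "continuous_map (top_of_set {0..1}) (mtop N) x"
    using cont xX by (auto simp: mtop_N continuous_map_in_subtopology)
  fix c assume c: "c \<in> atlas N"
  obtain U \<phi> where U: "c = (U \<inter> X, \<phi>)" "(U, \<phi>) \<in> slice_charts M F X" using c by (auto simp: atlas_N)
  have "smooth_on {s\<in>{0..1}. x s \<in> U} (\<phi> \<circ> x)"
  proof (rule smooth_curve_localI[OF cont slice_maximal[OF U(2)]])
    fix s :: real assume s: "s \<in> {0..1}"
    obtain W \<psi> where W: "(W, \<psi>) \<in> atlas M" "x s \<in> W"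
      using atlas_cover solution_in_points[OF sol s] by blast
    then show "\<exists>U \<phi>. (U, \<phi>) \<in> maximal_atlas M \<and> x s \<in> U \<and> smooth_on {r\<in>{0..1}. x r \<in> U} (\<phi> \<circ> x)"
      using sol atlas_maximal[OF W(1)] unfolding solution_def smooth_curve_def by blast
  qed
  then have "smooth_on {s\<in>{0..1}. x s \<in> U \<inter> X} (\<phi> \<circ> x)"
    by (rule smooth_on_subset) auto
  then show "case c of (U, \<phi>) \<Rightarrow> smooth_on {s\<in>{0..1}. x s \<in> U} (\<phi> \<circ> x)" by (simp add: U)
next
  fix s :: real and f assume s: "s \<in> {0..1}" and f: "f \<in> smooth_funs N"
  note cont = solution_continuous[OF sol]
  obtain U \<phi> where U: "(U, \<phi>) \<in> slice_charts M F X" "x s \<in> U" using slice_cover[OF xX[OF s]] by blast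
  note m = slice_maximal[OF U(1)]
  obtain e where e: "e \<in> F" "V s (x s) = cvec N (U \<inter> X) \<phi> (x s) e" "V' s (x s) = cvec M U \<phi> (x s) e"
    using tangent_N[OF U xX[OF s] V[OF s xX[OF s]]] eq[OF s xX[OF s]] by metis
  have ev: "\<forall>\<^sub>F r in at s within {0..1}. x r \<in> U"
    by (rule continuous_curve_eventually[OF cont chart_open[OF m] U(2) s])
  have evX: "\<forall>\<^sub>F r in at s within {0..1}. x r \<in> X"
    using xX by (auto simp: eventually_at_filter)
  have dx: "((\<lambda>r. \<phi> (x r)) has_vector_derivative e) (at s within {0..1})"
  proof (rule curve_chart_derivative[where x = x and s = s, OF m s U(2)])
    show "e \<in> model M" using e(1) F(2) by blast
    show "\<forall>\<^sub>F r in at s within {0..1}. x r \<in> W" if "openin (mtop M) W" "x s \<in> W" for W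
      by (rule continuous_curve_eventually[OF cont that s])
    show "((\<lambda>r. g (x r)) has_real_derivative cvec M U \<phi> (x s) e g) (at s within {0..1})"
      if "g \<in> smooth_funs M" for g
      using sol s that e(3) unfolding solution_def by metis
  qed
  let ?f = "f \<circ> inv_into (U \<inter> X) \<phi>"
  have oa: "open_along (\<phi> ` (U \<inter> X)) e"
    using NM.open_along_chart[OF slice_maximal_N[OF U(1)] NM.chart_open[OF slice_maximal_N[OF U(1)]] subset_refl] e(1)
    by (simp add: model_N)
  have "((\<lambda>r. ?f (\<phi> (x r))) has_vector_derivative dirderiv ?f (\<phi> (x s)) e) (at s within {0..1})"
  proof (rule has_vector_derivative_along_curve[where y = "\<lambda>r. \<phi> (x r)", OF NM.smooth_funsD[OF f slice_maximal_N[OF U(1)]] oa _ _ s dx])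
    show "\<phi> (x s) \<in> \<phi> ` (U \<inter> X)" using U(2) xX[OF s] by blast
    show "\<forall>\<^sub>F r in at s within {0..1}. \<phi> (x r) \<in> \<phi> ` (U \<inter> X)"
      using ev evX by eventually_elim blast
  qed
  then have d: "((\<lambda>r. ?f (\<phi> (x r))) has_real_derivative V s (x s) f) (at s within {0..1})"
    using f e(2) by (simp add: cvec_def has_real_derivative_iff_has_vector_derivative)
  have "\<forall>\<^sub>F r in at s within {0..1}. ?f (\<phi> (x r)) = f (x r)"
    using ev evX by eventually_elim (use slice_inv[OF U(1)] in simp)
  from has_derivative_transform_eventually[OF d[unfolded has_field_derivative_def] this _ s]
  show "((\<lambda>r. f (x r)) has_real_derivative V s (x s) f) (at s within {0..1})"
    using slice_inv[OF U xX[OF s]] by (simp add: has_field_derivative_def)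
qed

text \<open>Whichever side is known to be compatible supplies a family of trajectories. The same
  family solves the other equation, and both flows are read off from it.\<close>

lemma flow_N_eq_M:
  assumes H: "H \<in> smooth_time_funs M" and K: "K \<in> smooth_time_funs N"
    and eq: "\<And>s q. s \<in> {0..1} \<Longrightarrow> q \<in> X \<Longrightarrow> incl_diff M (ham_vf N \<tau> K s q) = ham_vf M \<omega> H s q"
    and "H \<in> ham_funs M \<omega> X \<or> K \<in> ham_funs N \<tau> X"
  shows "H \<in> ham_funs M \<omega> X \<and> K \<in> ham_funs N \<tau> X \<and>
    restrict (flow M (ham_vf M \<omega> H) 1) X = restrict (flow N (ham_vf N \<tau> K) 1) X"
proof -
  have "\<exists>g. (\<forall>z\<in>X. solution M (ham_vf M \<omega> H) 1 (g z) \<and> solution N (ham_vf N \<tau> K) 1 (g z) \<and> g z 0 = z) \<and>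
      (\<forall>s\<in>{0..1}. (\<lambda>z. g z s) ` X = X)"
    using assms(4)
  proof
    assume "H \<in> ham_funs M \<omega> X"
    then obtain g where g: "H \<in> smooth_time_funs M" "\<And>z. z \<in> X \<Longrightarrow> solution M (ham_vf M \<omega> H) 1 (g z)"
      "\<And>z. z \<in> X \<Longrightarrow> g z 0 = z" "\<And>s. s \<in> {0..1} \<Longrightarrow> (\<lambda>z. g z s) ` X = X"
      "\<And>s z. s \<in> {0..1} \<Longrightarrow> z \<in> X \<Longrightarrow> flow M (ham_vf M \<omega> H) s z = g z s"
      using that by (rule ham_funsE)
    have "solution N (ham_vf N \<tau> K) 1 (g z)" if z: "z \<in> X" for z
    proof (rule solution_M_imp_N[OF eq _ g(2)[OF z]])
      show "ham_vf N \<tau> K s q \<in> tangent_space N q" if "s \<in> {0..1}" "q \<in> X" for s q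
        using NF.ham_vf_works(1)[OF K that(1)] that(2) points_N by simp
      show "g z s \<in> X" if "s \<in> {0..1}" for s using g(4)[OF that] z by blast
    qed
    with g show ?thesis by (intro exI[of _ g]) simp
  next
    assume "K \<in> ham_funs N \<tau> X"
    then obtain g where g: "K \<in> smooth_time_funs N" "\<And>z. z \<in> X \<Longrightarrow> solution N (ham_vf N \<tau> K) 1 (g z)"
      "\<And>z. z \<in> X \<Longrightarrow> g z 0 = z" "\<And>s. s \<in> {0..1} \<Longrightarrow> (\<lambda>z. g z s) ` X = X"
      "\<And>s z. s \<in> {0..1} \<Longrightarrow> z \<in> X \<Longrightarrow> flow N (ham_vf N \<tau> K) s z = g z s"
      using that by (rule NF.ham_funsE)
    have "solution M (ham_vf M \<omega> H) 1 (g z)" if "z \<in> X" for z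
      by (rule solution_N_imp_M[OF eq g(2)[OF that]])
    with g show ?thesis by (intro exI[of _ g]) simp
  qed
  then obtain g where g: "\<And>z. z \<in> X \<Longrightarrow> solution M (ham_vf M \<omega> H) 1 (g z)"
    "\<And>z. z \<in> X \<Longrightarrow> solution N (ham_vf N \<tau> K) 1 (g z)" "\<And>z. z \<in> X \<Longrightarrow> g z 0 = z"
    "\<And>s. s \<in> {0..1} \<Longrightarrow> (\<lambda>z. g z s) ` X = X"
    by metis
  have one: "(1::real) \<in> {0..1}" by simp
  have h: "H \<in> ham_funs M \<omega> X" by (rule ham_funsI(1)[where g = g, OF H]) (erule g)+
  have k: "K \<in> ham_funs N \<tau> X" by (rule NF.ham_funsI(1)[where g = g, OF K]) (erule g)+
  have fh: "flow M (ham_vf M \<omega> H) 1 z = g z 1" if "z \<in> X" for z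
    by (rule ham_funsI(2)[where g = g, OF H]) (erule g | rule one that)+
  have fk: "flow N (ham_vf N \<tau> K) 1 z = g z 1" if "z \<in> X" for z
    by (rule NF.ham_funsI(2)[where g = g, OF K]) (erule g | rule one that)+
  have "restrict (flow M (ham_vf M \<omega> H) 1) X = restrict (flow N (ham_vf N \<tau> K) 1) X"
    by (rule restrict_ext) (simp add: fh fk)
  with h k show ?thesis by blast
qed

text \<open>A vector field whose flow preserves \<open>X\<close> is tangent to \<open>X\<close>, because every point of \<open>X\<close> is
  passed at every time by a trajectory that lies in \<open>X\<close>.\<close>

lemma ham_vf_restrict:
  assumes H: "H \<in> ham_funs M \<omega> X" and s: "s \<in> {0..1}" and q: "q \<in> X"
  shows "incl_diff M (ham_vf N \<tau> H s q) = ham_vf M \<omega> H s q"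
proof -
  obtain g where Hs: "H \<in> smooth_time_funs M" and g: "\<And>z. z \<in> X \<Longrightarrow> solution M (ham_vf M \<omega> H) 1 (g z)"
    "\<And>z. z \<in> X \<Longrightarrow> g z 0 = z" "\<And>s. s \<in> {0..1} \<Longrightarrow> (\<lambda>z. g z s) ` X = X"
    "\<And>s z. s \<in> {0..1} \<Longrightarrow> z \<in> X \<Longrightarrow> flow M (ham_vf M \<omega> H) s z = g z s"
    using that by (rule ham_funsE[OF H])
  obtain z where z: "z \<in> X" "q = g z s" using g(3)[OF s] q by blast
  note sol = g(1)[OF z(1)] and cont = solution_continuous[OF g(1)[OF z(1)]]
  have gX: "g z r \<in> X" if "r \<in> {0..1}" for r using g(3)[OF that] z(1) by blast
  have qM: "q \<in> points M" using q X_points by blast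
  obtain U \<phi> where U: "(U, \<phi>) \<in> slice_charts M F X" "q \<in> U" using slice_cover[OF q] by blast
  note m = slice_maximal[OF U(1)]
  obtain e where e: "e \<in> model M" "ham_vf M \<omega> H s q = cvec M U \<phi> q e"
    using tangent_eq_cvec[OF m U(2) ham_vf_works(1)[OF Hs s qM]] by blast
  have "e \<in> F"
  proof (rule vector_derivative_in_subspace[OF F(1)])
    show "((\<lambda>r. \<phi> (g z r)) has_vector_derivative e) (at s within {0..1})"
    proof (rule curve_chart_derivative[where x = "g z" and s = s, OF m s _ e(1)])
      show "g z s \<in> U" using U(2) z(2) by simp
      show "\<forall>\<^sub>F r in at s within {0..1}. g z r \<in> W" if "openin (mtop M) W" "g z s \<in> W" for W
        by (rule continuous_curve_eventually[OF cont that s])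
      show "((\<lambda>r. f (g z r)) has_real_derivative cvec M U \<phi> (g z s) e f) (at s within {0..1})"
        if "f \<in> smooth_funs M" for f
        using sol s that e(2) z(2) unfolding solution_def by metis
    qed
    have im: "\<phi> q' \<in> F" if "q' \<in> U" "q' \<in> X" for q'
      using slice_image[OF U(1)] that by blast
    show "\<phi> (g z s) \<in> F" using im U(2) q z(2) by blast
    have "\<forall>\<^sub>F r in at s within {0..1}. g z r \<in> U"
      by (rule continuous_curve_eventually[OF cont chart_open[OF m] _ s]) (use U(2) z(2) in simp)
    moreover have "\<forall>\<^sub>F r in at s within {0..1}. g z r \<in> X"
      using gX by (auto simp: eventually_at_filter)
    ultimately show "\<forall>\<^sub>F r in at s within {0..1}. \<phi> (g z r) \<in> F"
      by eventually_elim (rule im)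
    show "s islimpt {0..1}"
      by (rule connected_imp_perfect) (use s in \<open>auto simp: atLeastAtMost_singleton_iff\<close>)
    show "s \<in> {0..1}" by (rule s)
  qed
  let ?v = "cvec N (U \<inter> X) \<phi> q e"
  have incl: "incl_diff M ?v = ham_vf M \<omega> H s q"
    using incl_cvec[OF U(1,2) q \<open>e \<in> F\<close>] e(2) by simp
  have "ham_vf N \<tau> H s q = ?v"
  proof (rule NF.ham_vf_eqI)
    show "q \<in> points N" using q by (simp only: points_N)
    show "?v \<in> tangent_space N q"
      by (rule NM.cvec_tangent[OF slice_maximal_N[OF U(1)]]) (use U q \<open>e \<in> F\<close> in \<open>auto simp: model_N\<close>)
    fix w assume w: "w \<in> tangent_space N q"
    have "\<tau> q ?v w = \<omega> q (ham_vf M \<omega> H s q) (incl_diff M w)"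
      by (simp add: restrict_form_def incl)
    also have "\<dots> = incl_diff M w (H s)"
      by (rule ham_vf_works(2)[OF Hs s qM incl_tangent[OF q w]])
    also have "\<dots> = w (H s)"
      using smooth_time_funs_at[OF Hs s] by (simp add: incl_diff_def)
    finally show "\<tau> q ?v w = w (H s)" .
  qed
  then show ?thesis using incl by simp
qed

text \<open>The covector that the differential of an extension must be at a point of X in order that
  its Hamiltonian vector field there is that of \<open>K\<close>. On vectors tangent to X it is the
  differential of \<open>K\<close>; on the others it is an additional prescription.\<close>

definition conormal :: "(real \<Rightarrow> 'a \<Rightarrow> real) \<Rightarrow> real \<Rightarrow> 'a \<Rightarrow> 'a tvec \<Rightarrow> real" where
  "conormal K s q w = \<omega> q (incl_diff M (ham_vf N \<tau> K s q)) w"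

text \<open>\<open>P\<close> has along \<open>X\<close> the value and the differential of \<open>b\<close> times an extension of \<open>K\<close> whose
  Hamiltonian vector field is tangent to \<open>X\<close>. These pairs form a module over the smooth functions, so
  local extensions can be glued.\<close>

definition partial_extension :: "(real \<Rightarrow> 'a \<Rightarrow> real) \<Rightarrow> ('a \<Rightarrow> real) \<Rightarrow> (real \<Rightarrow> 'a \<Rightarrow> real) \<Rightarrow> bool" where
  "partial_extension K b P \<longleftrightarrow> b \<in> smooth_funs M \<and> P \<in> smooth_time_funs M \<and>
     (\<forall>s\<in>{0..1}. \<forall>q\<in>X. P s q = b q * K s q \<and>
        (\<forall>w\<in>tangent_space M q. w (P s) = w b * K s q + b q * conormal K s q w))"

lemma partial_extension_zero: "partial_extension K (\<lambda>q. 0) (\<lambda>t q. 0)"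
  using smooth_funs_const[of 0] smooth_funs_time[of "\<lambda>q. 0"] tangent_const
  by (simp add: partial_extension_def)

lemma partial_extension_add:
  assumes "partial_extension K b P" "partial_extension K b' P'"
  shows "partial_extension K (\<lambda>q. b q + b' q) (\<lambda>t q. P t q + P' t q)"
  unfolding partial_extension_def
proof (intro conjI ballI)
  have b: "b \<in> smooth_funs M" "b' \<in> smooth_funs M" and P: "P \<in> smooth_time_funs M" "P' \<in> smooth_time_funs M"
    using assms by (auto simp: partial_extension_def)
  show "(\<lambda>q. b q + b' q) \<in> smooth_funs M" by (rule smooth_funs_add[OF b])
  show "(\<lambda>t q. P t q + P' t q) \<in> smooth_time_funs M" by (rule smooth_time_funs_add[OF P])
  fix s :: real and q assume s: "s \<in> {0..1}" and q: "q \<in> X"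
  show "P s q + P' s q = (b q + b' q) * K s q"
    using assms s q by (simp add: partial_extension_def algebra_simps)
  fix w assume w: "w \<in> tangent_space M q"
  have "w (\<lambda>q. P s q + P' s q) = w (P s) + w (P' s)"
    by (rule tangent_add[OF w smooth_time_funs_at[OF P(1) s] smooth_time_funs_at[OF P(2) s]])
  moreover have "w (P s) = w b * K s q + b q * conormal K s q w" "w (P' s) = w b' * K s q + b' q * conormal K s q w"
    using assms s q w by (auto simp: partial_extension_def)
  ultimately show "w (\<lambda>q. P s q + P' s q) = w (\<lambda>q. b q + b' q) * K s q + (b q + b' q) * conormal K s q w"
    using tangent_add[OF w b] by (simp add: algebra_simps)
qed

lemma partial_extension_mult:
  assumes f: "f \<in> smooth_funs M" and e: "partial_extension K b P"
  shows "partial_extension K (\<lambda>q. f q * b q) (\<lambda>t q. f q * P t q)"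
  unfolding partial_extension_def
proof (intro conjI ballI)
  have b: "b \<in> smooth_funs M" and P: "P \<in> smooth_time_funs M"
    using e by (auto simp: partial_extension_def)
  show "(\<lambda>q. f q * b q) \<in> smooth_funs M" by (rule smooth_funs_mult[OF f b])
  show "(\<lambda>t q. f q * P t q) \<in> smooth_time_funs M"
    using smooth_time_funs_mult[OF _ P, of "\<lambda>t. f"] f smooth_funs_time by blast
  fix s :: real and q assume s: "s \<in> {0..1}" and q: "q \<in> X"
  have Pq: "P s q = b q * K s q" using e s q by (simp add: partial_extension_def)
  then show "f q * P s q = f q * b q * K s q" by simp
  fix w assume w: "w \<in> tangent_space M q"
  have "w (P s) = w b * K s q + b q * conormal K s q w"
    using e s q w by (auto simp: partial_extension_def)
  then show "w (\<lambda>q. f q * P s q) = w (\<lambda>q. f q * b q) * K s q + f q * b q * conormal K s q w"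
    using tangent_mult[OF w f b] tangent_mult[OF w f smooth_time_funs_at[OF P s]] Pq
    by (simp add: algebra_simps)
qed

lemma partial_extension_sum:
  "(\<And>i. i \<in> I \<Longrightarrow> partial_extension K (b i) (P i)) \<Longrightarrow>
    partial_extension K (\<lambda>q. \<Sum>i\<in>I. b i q) (\<lambda>t q. \<Sum>i\<in>I. P i t q)"
  by (induction I rule: infinite_finite_induct) (auto intro: partial_extension_zero partial_extension_add)

lemma tangent_locally_zero:
  assumes w: "w \<in> tangent_space M q" and W: "openin (mtop M) W" "q \<in> W" and f: "f \<in> smooth_funs M" "\<And>p. p \<in> W \<Longrightarrow> f p = 0"
  shows "w f = 0"
  using tangent_local[OF w W f(1) smooth_funs_const[of 0]] f(2) tangent_const[OF w] by simp

text \<open>As X is closed, there is a bump function at \<open>p\<close> that vanishes in a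
  neighbourhood of X. Its value and differential are zero along X, so P = 0 is a partner for
  it.\<close>

lemma partial_extension_off_X:
  assumes p: "p \<in> points M" "p \<notin> X"
  obtains b P W where "partial_extension K b P" "openin (mtop M) W" "p \<in> W" "\<And>q. q \<in> W \<Longrightarrow> b q = 1"
proof -
  have "openin (mtop M) (points M - X)" using closed by blast
  then obtain b W C where b: "b \<in> smooth_funs M" "openin (mtop M) W" "p \<in> W" "\<And>q. q \<in> W \<Longrightarrow> b q = 1"
    "closedin (mtop M) C" "C \<subseteq> points M - X" "\<And>q. q \<notin> C \<Longrightarrow> b q = 0"
    using bump_exists[of "points M - X" p] p by blast
  have op: "openin (mtop M) (points M - C)" using b(5) by blast
  have z: "b q = 0" "w b = 0" if "q \<in> X" "w \<in> tangent_space M q" for q w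
  proof -
    have "q \<notin> C" using b(6) that(1) by blast
    then show "b q = 0" by (rule b(7))
    show "w b = 0"
      by (rule tangent_locally_zero[OF that(2) op _ b(1)]) (use \<open>q \<notin> C\<close> that(1) X_points b(7) in auto)
  qed
  have z': "b q = 0" if "q \<in> X" for q using b(6,7) that by blast
  have "partial_extension K b (\<lambda>t q. 0)"
    unfolding partial_extension_def
  proof (intro conjI ballI)
    show "b \<in> smooth_funs M" by (rule b(1))
    show "(\<lambda>t q. 0) \<in> smooth_time_funs M" using smooth_funs_const[of 0] smooth_funs_time by blast
    fix s :: real and q assume q: "q \<in> X"
    show "0 = b q * K s q" by (simp add: z'[OF q])
    show "w (\<lambda>q. 0) = w b * K s q + b q * conormal K s q w" if "w \<in> tangent_space M q" for w
      by (simp add: z[OF q that] tangent_const[OF that])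
  qed
  then show ?thesis using b(2,3,4) by (rule that)
qed

text \<open>In a slice chart let \<pi> be the orthogonal projection onto \<open>F\<close>. The
  extension takes at y the value K(\<pi> y) + \<omega>(Y, y - \<pi> y), where Y is the Hamiltonian
  vector of \<open>K\<close> at \<pi> y. At a point of X its derivative in direction z is dK(\<pi>
  z) + \<omega>(Y, z - \<pi> z), and this is \<omega>(Y, z), because dK is \<omega>(Y, _) on
  \<open>F\<close>.\<close>

lemma partial_extension_at_X:
  assumes K: "K \<in> smooth_time_funs N" and p: "p \<in> X"
  obtains b P W where "partial_extension K b P" "openin (mtop M) W" "p \<in> W" "\<And>q. q \<in> W \<Longrightarrow> b q = 1"
proof -
  obtain U \<phi> where U: "(U, \<phi>) \<in> slice_charts M F X" and pU: "p \<in> U" using slice_cover[OF p] by blast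
  note m = slice_maximal[OF U] and mN = slice_maximal_N[OF U]
  obtain B where B: "orthonormal_basis F B" using orthonormal_basis_exists[OF F(1)] .
  obtain B' where B': "orthonormal_basis (model M) B'" using orthonormal_basis_exists[OF subspace_model] .
  then have Bf': "finite B'" "B' \<subseteq> model M" and Brep': "y \<in> model M \<Longrightarrow> y = (\<Sum>i\<in>B'. (y \<bullet> i) *\<^sub>R i)" for y
    unfolding orthonormal_basis_def by blast+
  let ?\<pi> = "onb_proj B" and ?\<psi> = "inv_into U \<phi>" and ?S = "{0..1::real} \<times> \<phi> ` (U \<inter> X)"
  have \<pi>F: "?\<pi> y \<in> F" for y by (rule onb_proj_in[OF F(1) B])
  have \<pi>id: "?\<pi> y = y" if "y \<in> F" for y by (rule onb_proj_id[OF B that])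
  have \<pi>lin: "?\<pi> (y + r *\<^sub>R z) = ?\<pi> y + r *\<^sub>R ?\<pi> z" for y z and r :: real
    using bounded_linear.linear[OF bounded_linear_onb_proj, of B] by (simp add: linear_add linear_scale)
  obtain h where h: "smooth_on ?S h" "\<And>t y. t \<in> {0..1} \<Longrightarrow> y \<in> \<phi> ` (U \<inter> X) \<Longrightarrow> h (t, y) \<in> model N"
    "\<And>t q. t \<in> {0..1} \<Longrightarrow> q \<in> U \<inter> X \<Longrightarrow> ham_vf N \<tau> K t q = cvec N (U \<inter> X) \<phi> q (h (t, \<phi> q))"
    "\<And>t q w. t \<in> {0..1} \<Longrightarrow> q \<in> U \<inter> X \<Longrightarrow> w \<in> tangent_space N q \<Longrightarrow>
       \<tau> q (cvec N (U \<inter> X) \<phi> q (h (t, \<phi> q))) w = w (K t)"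
    using that by (rule NF.ham_vf_chart[OF slice_atlas_N[OF U] K])
  have hF: "h (t, y) \<in> F" "h (t, y) \<in> model M" if "t \<in> {0..1}" "y \<in> \<phi> ` (U \<inter> X)" for t y
    using h(2)[OF that] F(2) by (auto simp: model_N)
  \<comment> \<open>The components of the covector \<omega>(Y, _) in the ambient chart, as functions
    of time and of a point of the slice.\<close>
  define a where "a j z = \<omega> (?\<psi> (snd z)) (cvec M U \<phi> (?\<psi> (snd z)) (h z)) (cvec M U \<phi> (?\<psi> (snd z)) j)" for j z
  \<comment> \<open>Smoothness of the form is available for fixed directions only, so the moving
    direction \<open>h z\<close> is expanded in the basis \<open>B'\<close>.\<close>
  have sma: "smooth_on ?S (a j)" if j: "j \<in> B'" for j
  proof -
    let ?c = "\<lambda>i z. \<omega> (?\<psi> (snd z)) (cvec M U \<phi> (?\<psi> (snd z)) i) (cvec M U \<phi> (?\<psi> (snd z)) j)"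
    have "smooth_on ?S (?c i)" if "i \<in> B'" for i
      by (rule smooth_on_compose[OF smooth_on_snd[OF smooth_on_id] symplectic_form_coeff[OF symp m]])
        (use that j Bf' in auto)
    then have "smooth_on ?S (\<lambda>z. \<Sum>i\<in>B'. (h z \<bullet> i) * ?c i z)"
      by (intro smooth_on_sum smooth_on_mult smooth_on_inner h(1) smooth_on_const)
    then show ?thesis
    proof (rule smooth_on_cong[rotated])
      fix z assume z: "z \<in> ?S"
      then have q: "?\<psi> (snd z) \<in> U" using slice_inv[OF U] by auto
      have hz: "h z \<in> model M" using hF(2)[of "fst z" "snd z"] z by auto
      have "cvec M U \<phi> (?\<psi> (snd z)) (h z) = cvec M U \<phi> (?\<psi> (snd z)) (\<Sum>i\<in>B'. (h z \<bullet> i) *\<^sub>R i)"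
        using Brep'[OF hz] by simp
      then show "(\<Sum>i\<in>B'. (h z \<bullet> i) * ?c i z) = a j z"
        unfolding a_def using form_cvec_sum[OF m q Bf' cvec_tangent[OF m q]] j Bf'(2) by auto
    qed
  qed
  have pairing: "\<omega> q (cvec M U \<phi> q (h (s, \<phi> q))) (cvec M U \<phi> q z) = (\<Sum>j\<in>B'. (z \<bullet> j) * a j (s, \<phi> q))"
    if "s \<in> {0..1}" "q \<in> U" "q \<in> X" "z \<in> model M" for s q z
    using form_cvec_right[OF m that(2) B' cvec_tangent[OF m that(2)] that(4)] hF(2)[OF that(1)] that(2,3) slice_inv[OF U that(2,3)]
    by (auto simp: a_def)
  define L where "L s q = K s (?\<psi> (?\<pi> (\<phi> q))) + (\<Sum>j\<in>B'. ((\<phi> q - ?\<pi> (\<phi> q)) \<bullet> j) * a j (s, ?\<pi> (\<phi> q)))" for s q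
  obtain T where T: "open T" "\<phi> ` U = model M \<inter> T"
    using chart_image_open[OF m] by (auto simp: openin_open)
  \<comment> \<open>The formula for \<open>L\<close> needs the projected coordinates to lie in the
    chart image. This is an open condition that holds at all points of X in the chart.\<close>
  define W where "W = {q\<in>U. \<phi> q \<in> ?\<pi> -` T}"
  have "open (?\<pi> -` T)"
    by (intro open_vimage T(1) linear_continuous_on bounded_linear_onb_proj)
  from chart_open_preimage[OF m this] have W: "openin (mtop M) W" "W \<subseteq> U"
    by (auto simp: W_def)
  have \<pi>W: "?\<pi> (\<phi> q) \<in> \<phi> ` (U \<inter> X)" if "q \<in> W" for q
    using that T(2) \<pi>F F(2) slice_image[OF U] by (auto simp: W_def)
  have \<phi>F: "\<phi> q \<in> F" if "q \<in> U" "q \<in> X" for q using slice_image[OF U] that by blast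
  have XW: "q \<in> W" if "q \<in> U" "q \<in> X" for q
    using that \<pi>id[OF \<phi>F[OF that]] T(2) by (auto simp: W_def)
  have smL: "smooth_on ({0..1} \<times> \<phi> ` W) (\<lambda>(t, y). L t (?\<psi> y))"
  proof -
    let ?R = "{0..1::real} \<times> \<phi> ` W"
    have 1: "smooth_on ?R (\<lambda>z. (fst z, ?\<pi> (snd z)))"
      by (intro smooth_on_Pair smooth_on_fst smooth_on_id
          smooth_on_linear_compose[OF bounded_linear_onb_proj] smooth_on_snd)
    have in_S: "(fst z, ?\<pi> (snd z)) \<in> ?S" if "z \<in> ?R" for z using that \<pi>W by auto
    have 2: "smooth_on ?R (\<lambda>z. (\<lambda>(t, y). K t (inv_into (U \<inter> X) \<phi> y)) (fst z, ?\<pi> (snd z)))"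
      by (rule smooth_on_compose[OF 1 NM.smooth_time_funsD[OF K mN]]) (rule in_S)
    have 3: "smooth_on ?R (\<lambda>z. a j (fst z, ?\<pi> (snd z)))" if "j \<in> B'" for j
      by (rule smooth_on_compose[OF 1 sma[OF that]]) (rule in_S)
    have 4: "smooth_on ?R (\<lambda>z. ((snd z - ?\<pi> (snd z)) \<bullet> j) * a j (fst z, ?\<pi> (snd z)))" if "j \<in> B'" for j
      by (intro smooth_on_mult[OF _ 3[OF that]] smooth_on_inner smooth_on_diff smooth_on_const smooth_on_id
          smooth_on_linear_compose[OF bounded_linear_onb_proj] smooth_on_snd)
    have "smooth_on ?R (\<lambda>z. K (fst z) (inv_into (U \<inter> X) \<phi> (?\<pi> (snd z))) +
        (\<Sum>j\<in>B'. ((snd z - ?\<pi> (snd z)) \<bullet> j) * a j (fst z, ?\<pi> (snd z))))"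
      using smooth_on_add[OF 2 smooth_on_sum[of B' _ "\<lambda>j z. ((snd z - ?\<pi> (snd z)) \<bullet> j) * a j (fst z, ?\<pi> (snd z))", OF 4]]
      by simp
    then show ?thesis
    proof (rule smooth_on_cong[rotated])
      fix z assume z: "z \<in> ?R"
      then obtain t q where q: "z = (t, \<phi> q)" "q \<in> W" by auto
      obtain q' where q': "q' \<in> U" "q' \<in> X" "?\<pi> (\<phi> q) = \<phi> q'" using \<pi>W[OF q(2)] by auto
      have "?\<psi> (\<phi> q) = q" using chart_inv[OF m] q(2) W(2) by blast
      then show "K (fst z) (inv_into (U \<inter> X) \<phi> (?\<pi> (snd z))) +
          (\<Sum>j\<in>B'. ((snd z - ?\<pi> (snd z)) \<bullet> j) * a j (fst z, ?\<pi> (snd z))) = (case z of (t, y) \<Rightarrow> L t (?\<psi> y))"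
        using slice_inv[OF U q'(1,2)] q'(3) by (simp add: L_def q)
    qed
  qed
  obtain b W1 C where b: "b \<in> smooth_funs M" "openin (mtop M) W1" "p \<in> W1" "\<And>q. q \<in> W1 \<Longrightarrow> b q = 1"
    "closedin (mtop M) C" "C \<subseteq> W" "\<And>q. q \<notin> C \<Longrightarrow> b q = 0"
    using bump_exists[OF W(1) XW[OF pU p]] by blast
  define P where "P t q = b q * L t q" for t q
  have P: "P \<in> smooth_time_funs M"
    unfolding P_def[abs_def] by (rule cutoff_smooth_time[OF m W b(5,6,1,7) smL])
  have LX: "L s q = K s q" if "q \<in> U" "q \<in> X" for s q
    using \<pi>id[OF \<phi>F[OF that]] slice_inv[OF U that] by (simp add: L_def)
  have op: "openin (mtop M) (points M - C)" using b(5) by blast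
  have dP: "w (P s) = w b * K s q + b q * conormal K s q w"
    if s: "s \<in> {0..1}" and q: "q \<in> X" and w: "w \<in> tangent_space M q" for s q w
  proof (cases "q \<in> C")
    \<comment> \<open>Outside \<open>C\<close> both \<open>b\<close> and \<open>P\<close> vanish in
      a neighbourhood, so both sides are 0.\<close>
    case False
    have qC: "q \<in> points M - C" using False q X_points by auto
    have "w b = 0" by (rule tangent_locally_zero[OF w op qC b(1)]) (simp add: b(7))
    moreover have "w (P s) = 0"
      by (rule tangent_locally_zero[OF w op qC smooth_time_funs_at[OF P s]]) (simp add: b(7) P_def)
    ultimately show ?thesis using b(7)[OF False] by simp
  next
    case True
    then have qU: "q \<in> U" using b(6) W(2) by blast
    obtain z where z: "z \<in> model M" "w = cvec M U \<phi> q z"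
      using tangent_eq_cvec[OF m qU w] by blast
    let ?z = "?\<pi> z"
    have qS: "\<phi> q \<in> \<phi> ` (U \<inter> X)" using qU q by blast
    have oa: "open_along (\<phi> ` (U \<inter> X)) ?z"
      using NM.open_along_chart[OF mN NM.chart_open[OF mN] subset_refl] \<pi>F by (simp add: model_N)
    have dK: "((\<lambda>r. K s (inv_into (U \<inter> X) \<phi> (\<phi> q + r *\<^sub>R ?z))) has_real_derivative cvec N (U \<inter> X) \<phi> q ?z (K s)) (at 0)"
      by (rule NM.cvec_derivative[OF mN _ _ NM.smooth_time_funs_at[OF K s]]) (use qU q \<pi>F in \<open>auto simp: model_N\<close>)
    have K_eq: "cvec N (U \<inter> X) \<phi> q ?z (K s) = (\<Sum>j\<in>B'. (?z \<bullet> j) * a j (s, \<phi> q))"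
    proof -
      have t: "cvec N (U \<inter> X) \<phi> q ?z \<in> tangent_space N q"
        by (rule NM.cvec_tangent[OF mN]) (use qU q \<pi>F in \<open>auto simp: model_N\<close>)
      have "cvec N (U \<inter> X) \<phi> q ?z (K s) = \<tau> q (cvec N (U \<inter> X) \<phi> q (h (s, \<phi> q))) (cvec N (U \<inter> X) \<phi> q ?z)"
        using h(4)[OF s _ t] qU q by simp
      also have "\<dots> = \<omega> q (cvec M U \<phi> q (h (s, \<phi> q))) (cvec M U \<phi> q ?z)"
        using incl_cvec[OF U qU q hF(1)[OF s qS]] incl_cvec[OF U qU q \<pi>F[of z]] by (simp add: restrict_form_def)
      also have "\<dots> = (\<Sum>j\<in>B'. (?z \<bullet> j) * a j (s, \<phi> q))"
        using pairing[OF s qU q, of ?z] \<pi>F[of z] F(2) by blast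
      finally show ?thesis .
    qed
    \<comment> \<open>The factor r vanishes at r = 0, so the derivative of \<open>a j\<close> along
      the slice contributes nothing.\<close>
    have da: "((\<lambda>r. (r * ((z - ?z) \<bullet> j)) * a j (s, \<phi> q + r *\<^sub>R ?z)) has_real_derivative ((z - ?z) \<bullet> j) * a j (s, \<phi> q)) (at 0)"
      if j: "j \<in> B'" for j
    proof -
      have "((\<lambda>r. a j ((s, \<phi> q) + r *\<^sub>R (0, ?z))) has_real_derivative dirderiv (a j) (s, \<phi> q) (0, ?z)) (at 0)"
        by (rule has_real_derivative_dirderiv[OF sma[OF j] open_along_Times[OF oa]]) (use s qS in auto)
      then have "((\<lambda>r. a j (s, \<phi> q + r *\<^sub>R ?z)) has_real_derivative dirderiv (a j) (s, \<phi> q) (0, ?z)) (at 0)" by simp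
      from DERIV_mult[OF DERIV_cmult_right[OF DERIV_ident, of "(z - ?z) \<bullet> j"] this] show ?thesis by simp
    qed
    have dL': "((\<lambda>r. K s (inv_into (U \<inter> X) \<phi> (\<phi> q + r *\<^sub>R ?z)) +
        (\<Sum>j\<in>B'. (r * ((z - ?z) \<bullet> j)) * a j (s, \<phi> q + r *\<^sub>R ?z))) has_real_derivative
        (\<Sum>j\<in>B'. (?z \<bullet> j) * a j (s, \<phi> q)) + (\<Sum>j\<in>B'. ((z - ?z) \<bullet> j) * a j (s, \<phi> q))) (at 0)"
      using dK unfolding K_eq by (intro DERIV_add DERIV_sum da)
    \<comment> \<open>The tangential part of \<open>z\<close>, which enters through dK, and its
      normal part recombine to the pairing with \<open>z\<close> itself.\<close>
    have sum_eq: "(\<Sum>j\<in>B'. (?z \<bullet> j) * a j (s, \<phi> q)) + (\<Sum>j\<in>B'. ((z - ?z) \<bullet> j) * a j (s, \<phi> q)) = conormal K s q w"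
    proof -
      have "conormal K s q w = \<omega> q (cvec M U \<phi> q (h (s, \<phi> q))) (cvec M U \<phi> q z)"
        using h(3)[OF s] qU q incl_cvec[OF U qU q hF(1)[OF s qS]] z(2) by (simp add: conormal_def)
      also have "\<dots> = (\<Sum>j\<in>B'. (z \<bullet> j) * a j (s, \<phi> q))"
        by (rule pairing[OF s qU q z(1)])
      finally show ?thesis by (simp add: sum.distrib[symmetric] algebra_simps inner_diff_left)
    qed
    have ev1: "\<forall>\<^sub>F r in nhds 0. \<phi> q + r *\<^sub>R z \<in> \<phi> ` W"
      using open_along_chart[OF m W z(1)] XW[OF qU q] by (auto simp: open_along_def)
    have ev2: "\<forall>\<^sub>F r in nhds 0. \<phi> q + r *\<^sub>R ?z \<in> \<phi> ` (U \<inter> X)"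
      using oa qS by (auto simp: open_along_def)
    have ev: "\<forall>\<^sub>F r in nhds 0. K s (inv_into (U \<inter> X) \<phi> (\<phi> q + r *\<^sub>R ?z)) +
        (\<Sum>j\<in>B'. (r * ((z - ?z) \<bullet> j)) * a j (s, \<phi> q + r *\<^sub>R ?z)) = L s (?\<psi> (\<phi> q + r *\<^sub>R z))"
      using ev1 ev2
    proof eventually_elim
      fix r assume 1: "\<phi> q + r *\<^sub>R z \<in> \<phi> ` W" and 2: "\<phi> q + r *\<^sub>R ?z \<in> \<phi> ` (U \<inter> X)"
      have \<phi>\<psi>: "\<phi> (?\<psi> (\<phi> q + r *\<^sub>R z)) = \<phi> q + r *\<^sub>R z" using 1 W(2) by (intro f_inv_into_f) auto
      have \<pi>: "?\<pi> (\<phi> q + r *\<^sub>R z) = \<phi> q + r *\<^sub>R ?z" using \<pi>lin \<pi>id[OF \<phi>F[OF qU q]] by simp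
      obtain q' where "q' \<in> U" "q' \<in> X" "\<phi> q + r *\<^sub>R ?z = \<phi> q'" using 2 by auto
      then have inv: "inv_into (U \<inter> X) \<phi> (\<phi> q + r *\<^sub>R ?z) = ?\<psi> (\<phi> q + r *\<^sub>R ?z)" using slice_inv[OF U] by simp
      have "(\<phi> q + r *\<^sub>R z - (\<phi> q + r *\<^sub>R ?z)) \<bullet> j = r * ((z - ?z) \<bullet> j)" for j
        by (simp add: inner_diff_left inner_add_left algebra_simps)
      then show "K s (inv_into (U \<inter> X) \<phi> (\<phi> q + r *\<^sub>R ?z)) +
          (\<Sum>j\<in>B'. (r * ((z - ?z) \<bullet> j)) * a j (s, \<phi> q + r *\<^sub>R ?z)) = L s (?\<psi> (\<phi> q + r *\<^sub>R z))"
        unfolding L_def \<phi>\<psi> \<pi> inv by simp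
    qed
    have dL: "((\<lambda>r. L s (?\<psi> (\<phi> q + r *\<^sub>R z))) has_real_derivative conormal K s q w) (at 0)"
      using dL' unfolding sum_eq DERIV_cong_ev[OF refl ev refl] .
    have db: "((\<lambda>r. b (?\<psi> (\<phi> q + r *\<^sub>R z))) has_real_derivative w b) (at 0)"
      using cvec_derivative[OF m qU z(1) b(1)] z(2) by simp
    have "((\<lambda>r. P s (?\<psi> (\<phi> q + r *\<^sub>R z))) has_real_derivative w b * K s q + b q * conormal K s q w) (at 0)"
      using DERIV_mult[OF db dL] slice_inv[OF U qU q] LX[OF qU q] by (simp add: P_def algebra_simps)
    then show ?thesis
      unfolding z(2) by (rule cvec_eqI[OF smooth_time_funs_at[OF P s]])
  qed
  have "partial_extension K b P"
    unfolding partial_extension_def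
  proof (intro conjI ballI)
    fix s :: real and q assume s: "s \<in> {0..1}" and q: "q \<in> X"
    show "P s q = b q * K s q"
    proof (cases "q \<in> C")
      case True
      then show ?thesis using LX[OF _ q] b(6) W(2) by (auto simp: P_def)
    qed (simp add: P_def b(7))
    show "w (P s) = w b * K s q + b q * conormal K s q w" if "w \<in> tangent_space M q" for w
      by (rule dP[OF s q that])
  qed (use b P in auto)
  then show ?thesis using b(2,3,4) by (rule that)
qed

text \<open>A countable gluing in place of a partition of unity. With c n the product of 1 - b k
  over k < n, the weights c n * b n sum telescopically to 1 - c m. Since b k is 1 on
  \<open>W k\<close>, all c n with n > k vanish there, so on \<open>W k\<close> the sum is finite
  and the total weight is 1.\<close>

lemma hamiltonian_extension:
  assumes K: "K \<in> smooth_time_funs N"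
  obtains H where "H \<in> smooth_time_funs M"
    "\<And>s q w. s \<in> {0..1} \<Longrightarrow> q \<in> X \<Longrightarrow> w \<in> tangent_space M q \<Longrightarrow> w (H s) = conormal K s q w"
proof -
  define \<U> where "\<U> = {W. openin (mtop M) W \<and> (\<exists>b P. partial_extension K b P \<and> (\<forall>q\<in>W. b q = 1))}"
  have loc: "\<exists>W\<in>\<U>. p \<in> W" if pM: "p \<in> points M" for p
  proof (cases "p \<in> X")
    case True
    obtain b P W where "partial_extension K b P" "openin (mtop M) W" "p \<in> W" "\<And>q. q \<in> W \<Longrightarrow> b q = 1"
      using that by (rule partial_extension_at_X[OF K True])
    then show ?thesis by (auto simp: \<U>_def)
  next
    case False
    obtain b P W where "partial_extension K b P" "openin (mtop M) W" "p \<in> W" "\<And>q. q \<in> W \<Longrightarrow> b q = 1"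
      using that by (rule partial_extension_off_X[OF pM False])
    then show ?thesis by (auto simp: \<U>_def)
  qed
  \<comment> \<open>Second countability yields a countable subcover, which the inductive product of
    the factors 1 - b k requires.\<close>
  have "Lindelof_space (mtop M)"
    using mfd by (intro second_countable_imp_Lindelof_space) (simp add: smooth_manifold_def)
  moreover have "\<Union>\<U> = points M"
    using loc openin_subset by (fastforce simp: \<U>_def)
  ultimately obtain \<V> where \<V>: "countable \<V>" "\<V> \<subseteq> \<U>" "\<Union>\<V> = points M"
    unfolding Lindelof_space_def by (metis (mono_tags, lifting) \<U>_def mem_Collect_eq)
  \<comment> \<open>The empty set is added so that the enumeration is defined even when the cover is
    empty.\<close>
  have "{} \<in> \<U>" using partial_extension_zero by (auto simp: \<U>_def)
  define W where "W = from_nat_into (insert {} \<V>)"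
  have rW: "range W = insert {} \<V>" unfolding W_def by (rule range_from_nat_into) (use \<V>(1) in auto)
  have WU: "W n \<in> \<U>" for n using rW \<V>(2) \<open>{} \<in> \<U>\<close> by (metis insertE rangeI subsetD)
  have Wcov: "\<exists>n. p \<in> W n" if p: "p \<in> points M" for p
  proof -
    obtain V where V: "V \<in> \<V>" "p \<in> V" using \<V>(3) p by blast
    then have "V \<in> range W" unfolding rW by simp
    then obtain n where "V = W n" by (rule rangeE)
    then show ?thesis using V(2) by auto
  qed
  have Wop: "openin (mtop M) (W n)" for n using WU[of n] by (simp add: \<U>_def)
  have "\<forall>n. \<exists>b P. partial_extension K b P \<and> (\<forall>q\<in>W n. b q = 1)" using WU by (auto simp: \<U>_def)
  then obtain b P where bP: "\<And>n. partial_extension K (b n) (P n)" "\<And>n q. q \<in> W n \<Longrightarrow> b n q = 1"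
    by metis
  have bs: "b n \<in> smooth_funs M" for n using bP(1)[of n] by (simp add: partial_extension_def)
  define c where "c n q = (\<Prod>k<n. 1 - b k q)" for n q
  have c_Suc: "c (Suc n) q = c n q * (1 - b n q)" for n q by (simp add: c_def)
  have cs: "c n \<in> smooth_funs M" for n
  proof (induction n)
    case 0
    then show ?case using smooth_funs_const[of 1] by (simp add: c_def)
  next
    case (Suc n)
    have "(\<lambda>q. 1 * 1 + (-1) * b n q) \<in> smooth_funs M"
      by (rule smooth_funs_lincomb[OF smooth_funs_const bs])
    from smooth_funs_mult[OF Suc this] show ?case by (simp add: c_Suc[abs_def])
  qed
  have c0: "c n q = 0" if "q \<in> W k" "k < n" for n k q
    unfolding c_def by (rule prod_zero) (use that bP(2) in auto)
  have tele: "(\<Sum>n<m. c n q * b n q) = 1 - c m q" for m q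
    by (induction m) (simp_all add: c_Suc algebra_simps, simp add: c_def)
  define S where "S m t q = (\<Sum>n<m. c n q * P n t q)" for m t q
  have ext: "partial_extension K (\<lambda>q. 1 - c m q) (S m)" for m
    using partial_extension_sum[of "{..<m}" K "\<lambda>n q. c n q * b n q" "\<lambda>n t q. c n q * P n t q"]
      partial_extension_mult[OF cs bP(1)] tele
    by (simp add: S_def[abs_def])
  \<comment> \<open>The partial sum stops after the first index whose set contains the point;
    \<open>Suc\<close> keeps the term of that index. Later terms vanish there, so every
    \<open>m\<close> with \<open>q\<close> in \<open>W m\<close> gives the same value, and
    \<open>H\<close> agrees with the smooth function \<open>S (Suc m)\<close> on the open set
    \<open>W m\<close>.\<close>
  define H where "H t q = S (Suc (LEAST n. q \<in> W n)) t q" for t q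
  have HS: "H t q = S (Suc m) t q" if "q \<in> W m" for t q m
  proof -
    define k where "k = (LEAST n. q \<in> W n)"
    have k: "q \<in> W k" "k \<le> m" unfolding k_def using that by (auto intro: LeastI Least_le)
    have "S (Suc m) t q = S (Suc k) t q"
      unfolding S_def by (rule sum.mono_neutral_right) (use k c0[OF k(1)] in auto)
    then show ?thesis by (simp add: H_def k_def)
  qed
  have Ss: "S m \<in> smooth_time_funs M" for m using ext[of m] by (simp add: partial_extension_def)
  have Hs: "H \<in> smooth_time_funs M"
    by (rule smooth_time_funs_locally_eq) (use Wcov Wop Ss HS in meson)
  have "w (H s) = conormal K s q w" if s: "s \<in> {0..1}" and q: "q \<in> X" and w: "w \<in> tangent_space M q" for s q w
  proof -
    obtain m where m: "q \<in> W m" using Wcov q X_points by blast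
    have "w (H s) = w (S (Suc m) s)"
      by (rule tangent_local[OF w Wop m smooth_time_funs_at[OF Hs s] smooth_time_funs_at[OF Ss s]]) (rule HS)
    also have "\<dots> = w (\<lambda>q. 1 - c (Suc m) q) * K s q + (1 - c (Suc m) q) * conormal K s q w"
      using ext[of "Suc m"] s q w unfolding partial_extension_def by blast
    \<comment> \<open>The total weight is constantly 1 on \<open>W m\<close>, so the term with the
      values of \<open>K\<close> drops out and only the prescribed covector remains.\<close>
    also have "w (\<lambda>q. 1 - c (Suc m) q) = 0"
    proof -
      have "(\<lambda>q. 1 - c (Suc m) q) \<in> smooth_funs M" using ext[of "Suc m"] by (simp add: partial_extension_def)
      then have "w (\<lambda>q. 1 - c (Suc m) q) = w (\<lambda>q. 1)"
        by (rule tangent_local[OF w Wop m _ smooth_funs_const]) (use c0[of _ m "Suc m"] in simp)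
      then show ?thesis using tangent_const[OF w] by simp
    qed
    finally show ?thesis using c0[OF m, of "Suc m"] by simp
  qed
  with Hs show ?thesis by (rule that)
qed

lemma Ham_eq: "Ham X M \<omega> = Ham X N \<tau>"
proof
  show "Ham X M \<omega> \<subseteq> Ham X N \<tau>"
  proof
    fix f assume "f \<in> Ham X M \<omega>"
    then obtain H where H: "H \<in> ham_funs M \<omega> X" and f: "f = restrict (flow M (ham_vf M \<omega> H) 1) X"
      by (auto simp: Ham_def)
    have Hs: "H \<in> smooth_time_funs M" using H by (simp add: ham_funs_def)
    have "H \<in> ham_funs N \<tau> X \<and> f = restrict (flow N (ham_vf N \<tau> H) 1) X"
      using flow_N_eq_M[OF Hs smooth_time_funs_restrict[OF Hs] ham_vf_restrict[OF H]] H f by blast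
    then show "f \<in> Ham X N \<tau>" by (auto simp: Ham_def)
  qed
  show "Ham X N \<tau> \<subseteq> Ham X M \<omega>"
  proof
    fix f assume "f \<in> Ham X N \<tau>"
    then obtain K where K: "K \<in> ham_funs N \<tau> X" and f: "f = restrict (flow N (ham_vf N \<tau> K) 1) X"
      by (auto simp: Ham_def)
    have Ks: "K \<in> smooth_time_funs N" using K by (simp add: ham_funs_def)
    obtain H where Hs: "H \<in> smooth_time_funs M"
      and dH: "\<And>s q w. s \<in> {0..1} \<Longrightarrow> q \<in> X \<Longrightarrow> w \<in> tangent_space M q \<Longrightarrow> w (H s) = conormal K s q w"
      using that by (rule hamiltonian_extension[OF Ks])
    have eq: "incl_diff M (ham_vf N \<tau> K s q) = ham_vf M \<omega> H s q" if s: "s \<in> {0..1}" and q: "q \<in> X" for s q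
    proof (rule ham_vf_eqI[symmetric])
      show "q \<in> points M" using q X_points by blast
      have "q \<in> points N" using q by (simp only: points_N)
      then show "incl_diff M (ham_vf N \<tau> K s q) \<in> tangent_space M q"
        by (intro incl_tangent[OF q] NF.ham_vf_works(1)[OF Ks s])
      show "\<omega> q (incl_diff M (ham_vf N \<tau> K s q)) w = w (H s)" if "w \<in> tangent_space M q" for w
        using dH[OF s q that] by (simp add: conormal_def)
    qed
    have "H \<in> ham_funs M \<omega> X \<and> f = restrict (flow M (ham_vf M \<omega> H) 1) X"
      using flow_N_eq_M[OF Hs Ks eq] K f by metis
    then show "f \<in> Ham X M \<omega>" by (auto simp: Ham_def)
  qed
qed

end

theorem proposition1:
  fixes M :: "('a, 'e::euclidean_space) mfd" and \<omega> :: "'a form2" and X :: "'a set"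
  assumes "symplectic_manifold M \<omega>" and "closedin (mtop M) X"
  shows "subgroup (Ham X M \<omega>) (HomeoGroup (subtopology (mtop M) X)) \<and>
         (\<forall>F. symplectic_submanifold M \<omega> F X \<longrightarrow>
            Ham X M \<omega> = Ham X (submfd M F X) (restrict_form M \<omega>))"
proof (intro conjI allI impI)
  show "subgroup (Ham X M \<omega>) (HomeoGroup (subtopology (mtop M) X))"
    by (rule form_mfd.Ham_subgroup[OF symplectic_form_mfd[OF assms(1)] closedin_subset[OF assms(2)]])
  show "Ham X M \<omega> = Ham X (submfd M F X) (restrict_form M \<omega>)" if "symplectic_submanifold M \<omega> F X" for F
    by (rule symplectic_sub.Ham_eq) (use assms that in \<open>simp add: symplectic_sub_def\<close>)
qed

end
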